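(* The local expanded mixed multiscale problem (L) has a unique solution $((\theta_h^l,u_h^l),p_h^l)\in X_h^l\times Q_h$. The hybrid local expanded mixed multiscale problem (HL) has a unique solution $(\bar\theta_h^l,\bar u_h^l,\bar p_h^l,\lambda_h^l)\in X_{1,h}^l\times\tilde X_{2,h}^l\times Q_h\times\Pi_h^l$. Moreover, $((\bar\theta_h^l,\bar u_h^l),\bar p_h^l)=((\theta_h^l,u_h^l),p_h^l)$. (Problems (L) and (HL) are written out in the context.)
   Context: $\Omega\subset\mathbb R^d$ ($d=2,3$) is a bounded Lipschitz domain, $f\in L^2(\Omega)$, and $k$ is a symmetric matrix field with $k_{\min}|\zeta|^2\le\zeta^Tk(x)\zeta\le k_{\max}|\zeta|^2$ for all $\zeta\in\mathbb R^d$, $x\in\Omega$, with constants $0<k_{\min}\le k_{\max}$. $(\cdot,\cdot)_D$ is the $L^2(D)$ inner product, $(\cdot,\cdot)=(\cdot,\cdot)_\Omega$. $H(div,\Omega)=\{v\in[L^2(\Omega)]^d:div\,v\in L^2(\Omega)\}$. Mesh: $\mathfrak T_h$ is a quasi-uniform partition of $\Omega$ into cells $K$, $h$ the maximal cell diameter, $\mathcal F_h$ the set of interior faces. $V_h\subset H(div,\Omega)$ is the lowest-order Raviart–Thomas space $RT_0$ on $\mathfrak T_h$, $V_h(K)=V_h|_K$ with basis $\chi_e^K$ (one for each face $e\subset\partial K$) satisfying $div\,\chi_e^K=1/|K|$, $\chi_e^K\cdot n=1/|e|$ on $e$ and $0$ on the other faces ($n$ the outward normal). $Q_h$ is the space of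 piecewise constants. Multiscale spaces: for each basis function $\chi=\chi_e^K$, $(\eta_\chi^K,\psi_\chi^K,\phi_\chi^K)$ solves (with $\phi_\chi^K$ determined up to a constant) $\psi_\chi^K+k\eta_\chi^K=0$, $\eta_\chi^K-\nabla\phi_\chi^K=0$, $div\,\psi_\chi^K=div\,\chi$ in $K$, $\psi_\chi^K\cdot n=\chi\cdot n$ on $\partial K$. $X_{1,h}^l=\{\theta\in[L^2(\Omega)]^d:\theta|_K\in\mathrm{span}\{\eta_\chi^K\}\ \forall K\}$, $\tilde X_{2,h}^l=\{u\in[L^2(\Omega)]^d:u|_K\in\mathrm{span}\{\psi_\chi^K\}\ \forall K\}$, $X_{2,h}^l=\tilde X_{2,h}^l\cap H(div,\Omega)$, $X_h^l=X_{1,h}^l\times X_{2,h}^l$. $\Pi_h^l=\{\pi\in L^2(\mathcal F_h):\pi|_e\in X_{2,h}^l\cdot n_e\ \forall e\in\mathcal F_h\}$, with $\pi=0$ on faces $e\subset\partial\Omega$. $[C_h^l(\tau_h),\pi_h]=\sum_K(\tau_h\cdot n_{\partial K},\pi_h)_{\partial K}$ for $\tau_h\in\tilde X_{2,h}^l$, $\pi_h\in\Pi_h^l$. Problem (L): find $((\theta_h^l,u_h^l),p_h^l)\in X_h^l\times Q_h$ with $(k\theta_h^l,\xi_h)+(u_h^l,\xi_h)=0$ for all $\xi_h\in X_{1,h}^l$; $(\theta_h^l,\tau_h)+(p_h^l,div\,\tau_h)=0$ for all $\tau_h\in X_{2,h}^l$; $(div\,u_h^l,q_h)=(f,q_h)$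 for all $q_h\in Q_h$. Problem (HL): find $(\bar\theta_h^l,\bar u_h^l,\bar p_h^l,\lambda_h^l)\in X_{1,h}^l\times\tilde X_{2,h}^l\times Q_h\times\Pi_h^l$ with $(k\bar\theta_h^l,\xi_h)+(\bar u_h^l,\xi_h)=0$ for all $\xi_h\in X_{1,h}^l$; $(\bar\theta_h^l,\tau_h)+\sum_K(\bar p_h^l,div\,\tau_h)_K=[C_h^l(\tau_h),\lambda_h^l]$ for all $\tau_h\in\tilde X_{2,h}^l$; $\sum_K(div\,\bar u_h^l,q_h)_K=(f,q_h)$ for all $q_h\in Q_h$; $[C_h^l(\bar u_h^l),\pi_h]=0$ for all $\pi_h\in\Pi_h^l$. *)

theory Defs
  imports "HOL-Analysis.Analysis"
begin

subsection \<open>Domain, square integrable functions, weak derivatives\<close>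

text \<open>Near each boundary point the domain is the strict epigraph, in some direction \<open>\<nu>\<close>, of a
  Lipschitz function \<open>\<gamma>\<close>; only the values of \<open>\<gamma>\<close> on the hyperplane orthogonal to \<open>\<nu>\<close> matter.\<close>

definition bounded_lipschitz_domain :: "(real^'d) set \<Rightarrow> bool" where
  "bounded_lipschitz_domain \<Omega> \<longleftrightarrow>
     open \<Omega> \<and> connected \<Omega> \<and> bounded \<Omega> \<and> \<Omega> \<noteq> {} \<and>
     (\<forall>x\<in>frontier \<Omega>. \<exists>\<nu> \<gamma> L U. norm \<nu> = 1 \<and> L-lipschitz_on UNIV \<gamma> \<and> open U \<and> x \<in> U \<and>
        \<Omega> \<inter> U = {y \<in> U. \<gamma> (y - (y \<bullet> \<nu>) *\<^sub>R \<nu>) < y \<bullet> \<nu>})"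

text \<open>Elements of \<open>L\<^sup>2\<close> are represented by functions; identities between them are a.e.\ identities.\<close>

definition L2 :: "'a measure \<Rightarrow> ('a \<Rightarrow> 'b::{real_normed_vector,second_countable_topology}) set" where
  "L2 M = {u. u \<in> borel_measurable M \<and> integrable M (\<lambda>x. (norm (u x))\<^sup>2)}"

definition l2_inner ::
    "(real^'d) set \<Rightarrow> (real^'d \<Rightarrow> 'b::real_inner) \<Rightarrow> (real^'d \<Rightarrow> 'b) \<Rightarrow> real" where
  "l2_inner D u v = (LINT x|lebesgue_on D. u x \<bullet> v x)"

definition C1_with_gradient :: "(real^'d \<Rightarrow> real) \<Rightarrow> (real^'d \<Rightarrow> real^'d) \<Rightarrow> bool" where
  "C1_with_gradient w G \<longleftrightarrow> (\<forall>x. GDERIV w x :> G x) \<and> continuous_on UNIV G"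

text \<open>Test functions have their support in \<open>interior D\<close>, so that \<open>D\<close> may be the open domain or a
  closed mesh cell. For square integrable functions, testing with \<open>C\<^sup>1\<close> and with \<open>C\<^sup>\<infinity>\<close> functions of
  compact support gives the same weak derivatives.\<close>

definition test_function ::
    "(real^'d) set \<Rightarrow> (real^'d \<Rightarrow> real) \<Rightarrow> (real^'d \<Rightarrow> real^'d) \<Rightarrow> bool" where
  "test_function D w G \<longleftrightarrow> C1_with_gradient w G \<and>
     (\<exists>S. compact S \<and> S \<subseteq> interior D \<and> (\<forall>x. x \<notin> S \<longrightarrow> w x = 0))"

definition has_weak_div ::
    "(real^'d) set \<Rightarrow> (real^'d \<Rightarrow> real^'d) \<Rightarrow> (real^'d \<Rightarrow> real) \<Rightarrow> bool" where
  "has_weak_div D u g \<longleftrightarrow> u \<in> L2 (lebesgue_on D) \<and> g \<in> L2 (lebesgue_on D) \<and>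
     (\<forall>w G. test_function D w G \<longrightarrow> l2_inner D u G = - l2_inner D g w)"

definition has_weak_gradient ::
    "(real^'d) set \<Rightarrow> (real^'d \<Rightarrow> real) \<Rightarrow> (real^'d \<Rightarrow> real^'d) \<Rightarrow> bool" where
  "has_weak_gradient D \<phi> g \<longleftrightarrow> \<phi> \<in> L2 (lebesgue_on D) \<and> g \<in> L2 (lebesgue_on D) \<and>
     (\<forall>w G. test_function D w G \<longrightarrow>
        (LINT x|lebesgue_on D. \<phi> x *\<^sub>R G x) = - (LINT x|lebesgue_on D. w x *\<^sub>R g x))"

definition Hdiv :: "(real^'d) set \<Rightarrow> (real^'d \<Rightarrow> real^'d) set" where
  "Hdiv D = {u. \<exists>g. has_weak_div D u g}"

definition weak_div :: "(real^'d) set \<Rightarrow> (real^'d \<Rightarrow> real^'d) \<Rightarrow> real^'d \<Rightarrow> real" where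
  "weak_div D u = (SOME g. has_weak_div D u g)"

subsection \<open>Meshes\<close>

text \<open>Cells are the shapes on which lowest-order Raviart--Thomas elements are affinely defined:
  simplices and parallelotopes (in particular rectangles and bricks).\<close>

definition parallelotope_map :: "real^'d \<Rightarrow> real^'d^'d \<Rightarrow> real^'d \<Rightarrow> real^'d" where
  "parallelotope_map a A \<xi> = a + A *v \<xi>"

definition mesh_cell :: "(real^'d) set \<Rightarrow> bool" where
  "mesh_cell K \<longleftrightarrow> int CARD('d) simplex K \<or>
     (\<exists>a A. invertible A \<and> K = parallelotope_map a A ` cbox 0 1)"

definition is_mesh :: "(real^'d) set \<Rightarrow> (real^'d) set set \<Rightarrow> bool" where
  "is_mesh \<Omega> \<T> \<longleftrightarrow>
     finite \<T> \<and> (\<forall>K\<in>\<T>. mesh_cell K) \<and> \<Union>\<T> = closure \<Omega> \<and>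
     (\<forall>K\<in>\<T>. \<forall>K'\<in>\<T>. K \<noteq> K' \<longrightarrow> interior K \<inter> interior K' = {}) \<and>
     (\<forall>K\<in>\<T>. \<forall>K'\<in>\<T>. (K \<inter> K') face_of K \<and> (K \<inter> K') face_of K')"

definition mesh_size :: "(real^'d) set set \<Rightarrow> real" where
  "mesh_size \<T> = Max (diameter ` \<T>)"

definition quasi_uniform :: "real \<Rightarrow> (real^'d) set set \<Rightarrow> bool" where
  "quasi_uniform \<rho> \<T> \<longleftrightarrow> (\<forall>K\<in>\<T>. \<exists>x. cball x (\<rho> * mesh_size \<T>) \<subseteq> K)"

definition facets :: "(real^'d) set \<Rightarrow> (real^'d) set set" where
  "facets K = {e. e facet_of K}"

definition interior_faces :: "(real^'d) set \<Rightarrow> (real^'d) set set \<Rightarrow> (real^'d) set set" where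
  "interior_faces \<Omega> \<T> = {e \<in> (\<Union>K\<in>\<T>. facets K). \<not> e \<subseteq> frontier \<Omega>}"

definition boundary_faces :: "(real^'d) set \<Rightarrow> (real^'d) set set \<Rightarrow> (real^'d) set set" where
  "boundary_faces \<Omega> \<T> = {e \<in> (\<Union>K\<in>\<T>. facets K). e \<subseteq> frontier \<Omega>}"

definition outward_normal :: "(real^'d) set \<Rightarrow> (real^'d) set \<Rightarrow> real^'d" where
  "outward_normal K e = (THE n. norm n = 1 \<and> (\<forall>x\<in>K. \<forall>y\<in>e. n \<bullet> x \<le> n \<bullet> y))"

text \<open>A unit normal \<open>n\<^sub>e\<close> of a face, with an arbitrary but fixed orientation.\<close>

definition face_normal :: "(real^'d) set \<Rightarrow> real^'d" where
  "face_normal e = (SOME n. norm n = 1 \<and> (\<forall>x\<in>e. \<forall>y\<in>e. n \<bullet> (x - y) = 0))"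

text \<open>The \<open>(d-1)\<close>-dimensional surface measure on a flat face \<open>e\<close>: the measure of a subset of \<open>e\<close> is
  the \<open>d\<close>-dimensional Lebesgue measure of the right prism of height \<open>1\<close> over it. The prism is
  centred at \<open>e\<close>, and \<open>closest_point (affine hull e)\<close> is the orthogonal projection onto the
  hyperplane spanned by \<open>e\<close>.\<close>

definition face_prism :: "(real^'d) set \<Rightarrow> (real^'d) set" where
  "face_prism e = {x. closest_point (affine hull e) x \<in> e \<and>
                      dist x (closest_point (affine hull e) x) \<le> 1/2}"

definition face_measure :: "(real^'d) set \<Rightarrow> (real^'d) measure" where
  "face_measure e =
     distr (restrict_space lborel (face_prism e)) (restrict_space borel e)
       (closest_point (affine hull e))"

definition face_area :: "(real^'d) set \<Rightarrow> real" where
  "face_area e = measure (face_measure e) e"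

text \<open>Normal traces on \<open>\<partial>K\<close> are defined by Green's formula; \<open>g e\<close> is the trace \<open>u \<cdot> n\<close> on the face \<open>e\<close>,
  \<open>n\<close> being the outward normal of \<open>K\<close>. The trace of a general field in \<open>H(div,K)\<close> is only a
  functional; here it is required to be square integrable, as is the case for all fields below.\<close>

definition has_normal_trace ::
    "(real^'d) set \<Rightarrow> (real^'d \<Rightarrow> real^'d) \<Rightarrow> ((real^'d) set \<Rightarrow> real^'d \<Rightarrow> real) \<Rightarrow> bool" where
  "has_normal_trace K u g \<longleftrightarrow>
     (\<forall>e\<in>facets K. g e \<in> L2 (face_measure e)) \<and>
     (\<exists>dv. has_weak_div K u dv \<and>
        (\<forall>w G. C1_with_gradient w G \<longrightarrow>
           l2_inner K u G + l2_inner K dv w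
             = (\<Sum>e\<in>facets K. LINT y|face_measure e. g e y * w y)))"

definition normal_trace ::
    "(real^'d) set \<Rightarrow> (real^'d \<Rightarrow> real^'d) \<Rightarrow> (real^'d) set \<Rightarrow> real^'d \<Rightarrow> real" where
  "normal_trace K u = (SOME g. has_normal_trace K u g)"

subsection \<open>Raviart--Thomas basis functions and multiscale basis functions\<close>

text \<open>On a simplex the fields \<open>a + b x\<close> with \<open>b\<close> scalar; on a parallelotope the Piola images of the
  fields on the unit cube whose \<open>i\<close>-th component is affine in \<open>\<xi>\<^sub>i\<close> alone (the constant factor
  \<open>1 / det A\<close> is absorbed by the coefficients).\<close>

definition RT0 :: "(real^'d) set \<Rightarrow> (real^'d \<Rightarrow> real^'d) set" where
  "RT0 K = {v.
     (int CARD('d) simplex K \<and> (\<exists>a b. \<forall>x\<in>K. v x = a + b *\<^sub>R x)) \<or>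
     (\<exists>a A. invertible A \<and> K = parallelotope_map a A ` cbox 0 1 \<and>
        (\<exists>\<alpha> \<beta>. \<forall>\<xi>\<in>cbox 0 1.
           v (parallelotope_map a A \<xi>) = A *v (\<chi> i. \<alpha> $ i + \<beta> $ i * \<xi> $ i)))}"

definition RT0_basis :: "(real^'d) set \<Rightarrow> (real^'d) set \<Rightarrow> (real^'d \<Rightarrow> real^'d) \<Rightarrow> bool" where
  "RT0_basis K e v \<longleftrightarrow> v \<in> RT0 K \<and>
     has_weak_div K v (\<lambda>_. 1 / measure lebesgue K) \<and>
     (\<forall>e'\<in>facets K. \<forall>y\<in>e'.
        v y \<bullet> outward_normal K e' = (if e' = e then 1 / face_area e else 0))"

definition local_solution ::
    "(real^'d \<Rightarrow> real^'d^'d) \<Rightarrow> (real^'d) set \<Rightarrow> (real^'d \<Rightarrow> real^'d) \<Rightarrow>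
     (real^'d \<Rightarrow> real^'d) \<Rightarrow> (real^'d \<Rightarrow> real^'d) \<Rightarrow> (real^'d \<Rightarrow> real) \<Rightarrow> bool" where
  "local_solution k K v \<eta> \<psi> \<phi> \<longleftrightarrow>
     \<eta> \<in> L2 (lebesgue_on K) \<and> \<psi> \<in> L2 (lebesgue_on K) \<and>
     (AE x in lebesgue_on K. \<psi> x + k x *v \<eta> x = 0) \<and>
     has_weak_gradient K \<phi> \<eta> \<and>
     (\<exists>g. has_weak_div K v g \<and> has_weak_div K \<psi> g) \<and>
     has_normal_trace K \<psi> (\<lambda>e y. v y \<bullet> outward_normal K e)"

subsection \<open>Discrete spaces\<close>

text \<open>In this and the following subsection \<open>\<eta> K e\<close> and \<open>\<psi> K e\<close> are the multiscale basis functions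
  of the cell \<open>K\<close> belonging to its face \<open>e\<close>.\<close>

definition multiscale_space ::
    "(real^'d) set \<Rightarrow> (real^'d) set set \<Rightarrow>
     ((real^'d) set \<Rightarrow> (real^'d) set \<Rightarrow> real^'d \<Rightarrow> real^'d) \<Rightarrow> (real^'d \<Rightarrow> real^'d) set" where
  "multiscale_space \<Omega> \<T> b = {v \<in> L2 (lebesgue_on \<Omega>).
     \<forall>K\<in>\<T>. \<exists>c. AE x in lebesgue_on K. v x = (\<Sum>e\<in>facets K. c e *\<^sub>R b K e x)}"

abbreviation "X1 \<Omega> \<T> \<eta> \<equiv> multiscale_space \<Omega> \<T> \<eta>"
abbreviation "X2_broken \<Omega> \<T> \<psi> \<equiv> multiscale_space \<Omega> \<T> \<psi>"

definition X2 ::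
    "(real^'d) set \<Rightarrow> (real^'d) set set \<Rightarrow>
     ((real^'d) set \<Rightarrow> (real^'d) set \<Rightarrow> real^'d \<Rightarrow> real^'d) \<Rightarrow> (real^'d \<Rightarrow> real^'d) set" where
  "X2 \<Omega> \<T> \<psi> = X2_broken \<Omega> \<T> \<psi> \<inter> Hdiv \<Omega>"

definition Qh :: "(real^'d) set \<Rightarrow> (real^'d) set set \<Rightarrow> (real^'d \<Rightarrow> real) set" where
  "Qh \<Omega> \<T> = {q \<in> L2 (lebesgue_on \<Omega>). \<forall>K\<in>\<T>. \<exists>c. AE x in lebesgue_on K. q x = c}"

text \<open>A function on the mesh skeleton is a function of the points of the faces; distinct faces meet
  only in null sets of the surface measures. On \<open>e\<close>, the field \<open>u \<cdot> n\<^sub>e\<close> is obtained from the outward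
  normal trace on either adjacent cell by adjusting the sign.\<close>

definition Pih ::
    "(real^'d) set \<Rightarrow> (real^'d) set set \<Rightarrow>
     ((real^'d) set \<Rightarrow> (real^'d) set \<Rightarrow> real^'d \<Rightarrow> real^'d) \<Rightarrow> (real^'d \<Rightarrow> real) set" where
  "Pih \<Omega> \<T> \<psi> = {\<pi>.
     (\<forall>e\<in>interior_faces \<Omega> \<T>. \<pi> \<in> L2 (face_measure e) \<and>
        (\<exists>u\<in>X2 \<Omega> \<T> \<psi>. \<forall>K\<in>\<T>. e \<in> facets K \<longrightarrow>
           (AE y in face_measure e.
              \<pi> y = (face_normal e \<bullet> outward_normal K e) * normal_trace K u e y))) \<and>
     (\<forall>e\<in>boundary_faces \<Omega> \<T>. AE y in face_measure e. \<pi> y = 0)}"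

definition Ch :: "(real^'d) set set \<Rightarrow> (real^'d \<Rightarrow> real^'d) \<Rightarrow> (real^'d \<Rightarrow> real) \<Rightarrow> real" where
  "Ch \<T> \<tau> \<pi> = (\<Sum>K\<in>\<T>. \<Sum>e\<in>facets K. LINT y|face_measure e. normal_trace K \<tau> e y * \<pi> y)"

subsection \<open>The local problem and its hybrid version\<close>

definition solves_L ::
    "(real^'d) set \<Rightarrow> (real^'d) set set \<Rightarrow> (real^'d \<Rightarrow> real^'d^'d) \<Rightarrow> (real^'d \<Rightarrow> real) \<Rightarrow>
     ((real^'d) set \<Rightarrow> (real^'d) set \<Rightarrow> real^'d \<Rightarrow> real^'d) \<Rightarrow>
     ((real^'d) set \<Rightarrow> (real^'d) set \<Rightarrow> real^'d \<Rightarrow> real^'d) \<Rightarrow>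
     (real^'d \<Rightarrow> real^'d) \<Rightarrow> (real^'d \<Rightarrow> real^'d) \<Rightarrow> (real^'d \<Rightarrow> real) \<Rightarrow> bool" where
  "solves_L \<Omega> \<T> k f \<eta> \<psi> \<theta> u p \<longleftrightarrow>
     \<theta> \<in> X1 \<Omega> \<T> \<eta> \<and> u \<in> X2 \<Omega> \<T> \<psi> \<and> p \<in> Qh \<Omega> \<T> \<and>
     (\<forall>\<xi>\<in>X1 \<Omega> \<T> \<eta>. l2_inner \<Omega> (\<lambda>x. k x *v \<theta> x) \<xi> + l2_inner \<Omega> u \<xi> = 0) \<and>
     (\<forall>\<tau>\<in>X2 \<Omega> \<T> \<psi>. l2_inner \<Omega> \<theta> \<tau> + l2_inner \<Omega> p (weak_div \<Omega> \<tau>) = 0) \<and>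
     (\<forall>q\<in>Qh \<Omega> \<T>. l2_inner \<Omega> (weak_div \<Omega> u) q = l2_inner \<Omega> f q)"

definition solves_HL ::
    "(real^'d) set \<Rightarrow> (real^'d) set set \<Rightarrow> (real^'d \<Rightarrow> real^'d^'d) \<Rightarrow> (real^'d \<Rightarrow> real) \<Rightarrow>
     ((real^'d) set \<Rightarrow> (real^'d) set \<Rightarrow> real^'d \<Rightarrow> real^'d) \<Rightarrow>
     ((real^'d) set \<Rightarrow> (real^'d) set \<Rightarrow> real^'d \<Rightarrow> real^'d) \<Rightarrow>
     (real^'d \<Rightarrow> real^'d) \<Rightarrow> (real^'d \<Rightarrow> real^'d) \<Rightarrow> (real^'d \<Rightarrow> real) \<Rightarrow> (real^'d \<Rightarrow> real) \<Rightarrow>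
     bool" where
  "solves_HL \<Omega> \<T> k f \<eta> \<psi> \<theta> u p lam \<longleftrightarrow>
     \<theta> \<in> X1 \<Omega> \<T> \<eta> \<and> u \<in> X2_broken \<Omega> \<T> \<psi> \<and> p \<in> Qh \<Omega> \<T> \<and> lam \<in> Pih \<Omega> \<T> \<psi> \<and>
     (\<forall>\<xi>\<in>X1 \<Omega> \<T> \<eta>. l2_inner \<Omega> (\<lambda>x. k x *v \<theta> x) \<xi> + l2_inner \<Omega> u \<xi> = 0) \<and>
     (\<forall>\<tau>\<in>X2_broken \<Omega> \<T> \<psi>.
        l2_inner \<Omega> \<theta> \<tau> + (\<Sum>K\<in>\<T>. l2_inner K p (weak_div K \<tau>)) = Ch \<T> \<tau> lam) \<and>
     (\<forall>q\<in>Qh \<Omega> \<T>. (\<Sum>K\<in>\<T>. l2_inner K (weak_div K u) q) = l2_inner \<Omega> f q) \<and>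
     (\<forall>\<pi>\<in>Pih \<Omega> \<T> \<psi>. Ch \<T> u \<pi> = 0)"

end

theory Submission
  imports Defs
begin

text \<open>In each cell the fields \<open>\<psi>\<close> are linearly independent, because their normal traces are, and
  \<open>\<psi> = - k \<eta>\<close>. Testing the first equation with differences of coefficients, coercivity of \<open>k\<close> shows
  that \<open>\<theta>\<close> and \<open>u\<close> have the same coefficients. A broken field lies in \<open>H(div,\<Omega>)\<close> iff its coefficients
  on the two sides of every interior face cancel, and multipliers are constant on each interior
  face, so both problems become finite linear systems for the coefficients; (HL) is the Lagrange
  multiplier form of (L). The systems are definite on the coefficients, and the multipliers are
  determined because a cellwise constant function that is orthogonal to all discrete divergences
  has no jumps and vanishes next to the boundary. The latter propagates to all cells: following a
  generic line, one passes through facets from cell to cell until one leaves the domain.\<close>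

subsection \<open>Finite saddle point systems and moment problems\<close>


text \<open>No solution is written down. Only the square system of (HL) is solved, by uniqueness,
  and (L) inherits its solution because the multiplier terms vanish on conforming test fields.
  Uniqueness of cell values and multipliers takes the place of an inf-sup condition; it needs an
  anchor, which the boundary provides: fluxes through boundary faces are unconstrained, and
  multipliers are zero there. The analytic obstacle is that divergences and normal traces are known
  only through integral identities, and \<open>weak_div\<close> and \<open>normal_trace\<close> are
  arbitrary choices among the functions that satisfy them. Uniqueness up to null sets must be proved
  inside the cells and on their faces. Both proofs rest on one moment lemma for measures on compact
  sets: arbitrary polynomials are multiplied by a factor that suppresses all unwanted contributions,
  a bump function in the volume and a product of affine functions on the faces. After that,
  divergence and traces of each \<psi> are constants, and its coefficient is the total outward flux
  through the face.\<close>

text \<open>Gaussian elimination, one equation per induction step: either the new row is zero, or it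
  is solved for a pivot unknown.\<close>

lemma underdetermined_homogeneous:
  fixes a :: "'i \<Rightarrow> 'j \<Rightarrow> real"
  assumes "finite I" "finite J" "card I < card J"
  shows "\<exists>x. (\<exists>j\<in>J. x j \<noteq> 0) \<and> (\<forall>i\<in>I. (\<Sum>j\<in>J. a i j * x j) = 0)"
  using assms
proof (induction I arbitrary: J a rule: finite_induct)
  case empty
  then obtain j where "j \<in> J" by fastforce
  then show ?case by (intro exI[of _ "\<lambda>_. 1"]) auto
next
  case (insert i0 I)
  show ?case
  proof (cases "\<forall>j\<in>J. a i0 j = 0")
    case True
    have "card I < card J" using insert.prems insert.hyps by simp
    then obtain x where "\<exists>j\<in>J. x j \<noteq> 0" "\<forall>i\<in>I. (\<Sum>j\<in>J. a i j * x j) = 0"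
      using insert.IH[of J a] insert.prems by blast
    with True show ?thesis by (intro exI[of _ x]) auto
  next
    case False
    then obtain j0 where j0: "j0 \<in> J" "a i0 j0 \<noteq> 0" by blast
    let ?J = "J - {j0}"
    \<comment> \<open>Row \<open>i\<close> after subtracting the multiple of row \<open>i0\<close>
      that clears column \<open>j0\<close>.\<close>
    let ?a = "\<lambda>i j. a i j - a i j0 * a i0 j / a i0 j0"
    have "card I < card ?J" using insert.prems insert.hyps j0 by simp
    then obtain x where x: "\<exists>j\<in>?J. x j \<noteq> 0" "\<forall>i\<in>I. (\<Sum>j\<in>?J. ?a i j * x j) = 0"
      using insert.IH[of ?J ?a] insert.prems by blast
    define s where "s = (\<Sum>j\<in>?J. a i0 j * x j)"
    \<comment> \<open>The pivot value is read off from equation \<open>i0\<close>; the other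
      unknowns keep their values.\<close>
    define y where "y = (\<lambda>j. if j = j0 then - s / a i0 j0 else x j)"
    have sum_y: "(\<Sum>j\<in>J. b j * y j) = b j0 * (- s / a i0 j0) + (\<Sum>j\<in>?J. b j * x j)" for b
      using insert.prems j0 by (subst sum.remove[of J j0]) (auto simp: y_def)
    have "\<exists>j\<in>J. y j \<noteq> 0" using x(1) by (auto simp: y_def)
    moreover have "(\<Sum>j\<in>J. a i0 j * y j) = 0"
      unfolding sum_y using j0 by (simp add: s_def)
    moreover have "(\<Sum>j\<in>J. a i j * y j) = 0" if "i \<in> I" for i
    proof -
      have "0 = (\<Sum>j\<in>?J. ?a i j * x j)" using x(2) that by simp
      also have "\<dots> = (\<Sum>j\<in>?J. a i j * x j) - (\<Sum>j\<in>?J. (a i j0 / a i0 j0) * (a i0 j * x j))"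
        by (simp add: sum_subtractf[symmetric] algebra_simps)
      also have "\<dots> = (\<Sum>j\<in>?J. a i j * x j) - a i j0 / a i0 j0 * s"
        by (simp only: s_def sum_distrib_left)
      finally show ?thesis unfolding sum_y by simp
    qed
    ultimately show ?thesis by (intro exI[of _ y]) auto
  qed
qed

text \<open>The Fredholm alternative by counting: the negated right-hand side becomes one more
  column, so a nontrivial kernel vector exists. Injectivity forces its entry in the new column to be
  nonzero, and dividing by that entry gives a solution.\<close>

lemma injective_system_solvable:
  fixes m :: "'i \<Rightarrow> 'i \<Rightarrow> real"
  assumes "finite I"
    and inj: "\<And>x. (\<forall>i\<in>I. (\<Sum>j\<in>I. m i j * x j) = 0) \<Longrightarrow> \<forall>j\<in>I. x j = 0"
  shows "\<exists>x. \<forall>i\<in>I. (\<Sum>j\<in>I. m i j * x j) = b i"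
proof -
  let ?J = "insert None (Some ` I)"
  let ?a = "\<lambda>i j. case j of None \<Rightarrow> - b i | Some j \<Rightarrow> m i j"
  have "card I < card ?J" using assms(1) by (simp add: card_image)
  then obtain x where x: "\<exists>j\<in>?J. x j \<noteq> 0" "\<forall>i\<in>I. (\<Sum>j\<in>?J. ?a i j * x j) = 0"
    using underdetermined_homogeneous[of I ?J ?a] assms(1) by auto
  have eq: "(\<Sum>j\<in>I. m i j * x (Some j)) = b i * x None" if "i \<in> I" for i
    using x(2) that assms(1) by (auto simp: sum.reindex)
  have "x None \<noteq> 0"
  proof
    assume "x None = 0"
    then have "\<forall>j\<in>I. x (Some j) = 0" using inj[of "\<lambda>j. x (Some j)"] eq by simp
    with x(1) \<open>x None = 0\<close> show False by auto
  qed
  then show ?thesis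
    using eq by (intro exI[of _ "\<lambda>j. x (Some j) / x None"])
      (simp add: sum_divide_distrib[symmetric])
qed

text \<open>Testing the first row with \<open>c\<close> itself turns the multiplier term into the
  second row, which vanishes, so only the quadratic form of \<open>A\<close> remains. Definiteness
  is phrased without a sign, which covers the negative definite pairing of \<eta> with
  \<psi>.\<close>

lemma saddle_point_unique:
  fixes A :: "'a \<Rightarrow> 'a \<Rightarrow> real" and B :: "'i \<Rightarrow> 'a \<Rightarrow> real"
  assumes pos: "\<And>c. (\<Sum>\<alpha>\<in>D. \<Sum>\<beta>\<in>D. c \<alpha> * c \<beta> * A \<alpha> \<beta>) = 0 \<Longrightarrow> \<forall>\<alpha>\<in>D. c \<alpha> = 0"
    and inj: "\<And>\<mu>. (\<forall>\<alpha>\<in>D. (\<Sum>i\<in>I. \<mu> i * B i \<alpha>) = 0) \<Longrightarrow> \<forall>i\<in>I. \<mu> i = 0"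
    and eq1: "\<And>\<beta>. \<beta> \<in> D \<Longrightarrow> (\<Sum>\<alpha>\<in>D. c \<alpha> * A \<alpha> \<beta>) + (\<Sum>i\<in>I. \<mu> i * B i \<beta>) = 0"
    and eq2: "\<And>i. i \<in> I \<Longrightarrow> (\<Sum>\<alpha>\<in>D. B i \<alpha> * c \<alpha>) = 0"
  shows "(\<forall>\<alpha>\<in>D. c \<alpha> = 0) \<and> (\<forall>i\<in>I. \<mu> i = 0)"
proof -
  have "0 = (\<Sum>\<beta>\<in>D. c \<beta> * ((\<Sum>\<alpha>\<in>D. c \<alpha> * A \<alpha> \<beta>) + (\<Sum>i\<in>I. \<mu> i * B i \<beta>)))"
    by (simp add: eq1)
  also have "\<dots> = (\<Sum>\<beta>\<in>D. \<Sum>\<alpha>\<in>D. c \<alpha> * c \<beta> * A \<alpha> \<beta>) + (\<Sum>\<beta>\<in>D. \<Sum>i\<in>I. \<mu> i * (B i \<beta> * c \<beta>))"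
    by (simp add: sum.distrib distrib_left sum_distrib_left mult_ac)
  also have "(\<Sum>\<beta>\<in>D. \<Sum>i\<in>I. \<mu> i * (B i \<beta> * c \<beta>)) = (\<Sum>i\<in>I. \<mu> i * (\<Sum>\<beta>\<in>D. B i \<beta> * c \<beta>))"
    by (subst sum.swap) (simp add: sum_distrib_left)
  also have "\<dots> = 0" by (simp add: eq2)
  also have "(\<Sum>\<beta>\<in>D. \<Sum>\<alpha>\<in>D. c \<alpha> * c \<beta> * A \<alpha> \<beta>) = (\<Sum>\<alpha>\<in>D. \<Sum>\<beta>\<in>D. c \<alpha> * c \<beta> * A \<alpha> \<beta>)"
    by (rule sum.swap)
  finally have "\<forall>\<alpha>\<in>D. c \<alpha> = 0" by (intro pos) simp
  moreover from this have "\<forall>i\<in>I. \<mu> i = 0" using eq1 by (intro inj) simp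
  ultimately show ?thesis by blast
qed

text \<open>The block matrix over \<open>D <+> I\<close> is square, and
  \<open>saddle_point_unique\<close> says that it is injective.\<close>

lemma saddle_point_exists:
  fixes A :: "'a \<Rightarrow> 'a \<Rightarrow> real" and B :: "'i \<Rightarrow> 'a \<Rightarrow> real"
  assumes fin: "finite D" "finite I"
    and pos: "\<And>c. (\<Sum>\<alpha>\<in>D. \<Sum>\<beta>\<in>D. c \<alpha> * c \<beta> * A \<alpha> \<beta>) = 0 \<Longrightarrow> \<forall>\<alpha>\<in>D. c \<alpha> = 0"
    and inj: "\<And>\<mu>. (\<forall>\<alpha>\<in>D. (\<Sum>i\<in>I. \<mu> i * B i \<alpha>) = 0) \<Longrightarrow> \<forall>i\<in>I. \<mu> i = 0"
  shows "\<exists>c \<mu>. (\<forall>\<beta>\<in>D. (\<Sum>\<alpha>\<in>D. c \<alpha> * A \<alpha> \<beta>) + (\<Sum>i\<in>I. \<mu> i * B i \<beta>) = 0) \<and>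
               (\<forall>i\<in>I. (\<Sum>\<alpha>\<in>D. B i \<alpha> * c \<alpha>) = F i)"
proof -
  define m :: "'a + 'i \<Rightarrow> 'a + 'i \<Rightarrow> real" where
    "m = (\<lambda>r s. case r of
        Inl \<beta> \<Rightarrow> (case s of Inl \<alpha> \<Rightarrow> A \<alpha> \<beta> | Inr i \<Rightarrow> B i \<beta>)
      | Inr j \<Rightarrow> (case s of Inl \<alpha> \<Rightarrow> B j \<alpha> | Inr i \<Rightarrow> 0))"
  have row1: "(\<Sum>s\<in>D <+> I. m (Inl \<beta>) s * x s) =
      (\<Sum>\<alpha>\<in>D. x (Inl \<alpha>) * A \<alpha> \<beta>) + (\<Sum>i\<in>I. x (Inr i) * B i \<beta>)" for \<beta> x
    by (subst sum.Plus[OF fin]) (simp add: m_def mult.commute)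
  have row2: "(\<Sum>s\<in>D <+> I. m (Inr j) s * x s) = (\<Sum>\<alpha>\<in>D. B j \<alpha> * x (Inl \<alpha>))" for j x
    by (subst sum.Plus[OF fin]) (simp add: m_def)
  have "\<forall>s\<in>D <+> I. x s = 0" if "\<forall>r\<in>D <+> I. (\<Sum>s\<in>D <+> I. m r s * x s) = 0" for x
  proof -
    have "(\<forall>\<alpha>\<in>D. x (Inl \<alpha>) = 0) \<and> (\<forall>i\<in>I. x (Inr i) = 0)"
    proof (rule saddle_point_unique[OF pos inj])
      show "(\<Sum>\<alpha>\<in>D. x (Inl \<alpha>) * A \<alpha> \<beta>) + (\<Sum>i\<in>I. x (Inr i) * B i \<beta>) = 0" if "\<beta> \<in> D" for \<beta>
        using \<open>\<forall>r\<in>D <+> I. _ r = 0\<close> that row1[of \<beta> x] by (metis InlI)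
      show "(\<Sum>\<alpha>\<in>D. B i \<alpha> * x (Inl \<alpha>)) = 0" if "i \<in> I" for i
        using \<open>\<forall>r\<in>D <+> I. _ r = 0\<close> that row2[of i x] by (metis InrI)
    qed
    then show ?thesis by auto
  qed
  then obtain x where x: "\<forall>r\<in>D <+> I. (\<Sum>s\<in>D <+> I. m r s * x s) = (case r of Inl \<beta> \<Rightarrow> 0 | Inr i \<Rightarrow> F i)"
    using injective_system_solvable[of "D <+> I" m "\<lambda>r. case r of Inl \<beta> \<Rightarrow> 0 | Inr i \<Rightarrow> F i"]
      finite_Plus[OF fin] by (elim meta_impE exE) assumption+
  show ?thesis
  proof (intro exI[of _ "\<lambda>\<alpha>. x (Inl \<alpha>)"] exI[of _ "\<lambda>i. x (Inr i)"] conjI ballI)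
    fix \<beta> assume "\<beta> \<in> D"
    then show "(\<Sum>\<alpha>\<in>D. x (Inl \<alpha>) * A \<alpha> \<beta>) + (\<Sum>i\<in>I. x (Inr i) * B i \<beta>) = 0"
      using x row1[of \<beta> x] by force
  next
    fix i assume "i \<in> I"
    then show "(\<Sum>\<alpha>\<in>D. B i \<alpha> * x (Inl \<alpha>)) = F i"
      using x row2[of i x] by force
  qed
qed

section \<open>Polynomial moments of measures on compact sets\<close>

text \<open>Polynomials approximate ramp functions uniformly on \<open>S\<close>, ramps decrease to
  indicators of closed sets, and closed sets generate the Borel sets. \<open>M\<close> is kept
  general because it will be Lebesgue measure on a ball as well as surface measure on a
  face.\<close>

lemma AE_zero_if_polynomial_moments_zero:
  fixes g :: "'a::euclidean_space \<Rightarrow> real"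
  assumes S: "compact S" and sets: "sets M = sets (restrict_space borel S)"
    and int: "integrable M g"
    and zero: "\<And>P. real_polynomial_function P \<Longrightarrow> (\<integral>x. g x * P x \<partial>M) = 0"
  shows "AE x in M. g x = 0"
proof -
  have space: "space M = S" using sets_eq_imp_space_eq[OF sets] by (simp add: space_restrict_space)
  have meas_eq: "borel_measurable M = borel_measurable (restrict_space borel S)"
    by (rule measurable_cong_sets[OF sets refl])
  have cont: "h \<in> borel_measurable M" if "continuous_on UNIV h" for h :: "'a \<Rightarrow> real"
    unfolding meas_eq
    by (rule borel_measurable_continuous_on_restrict[OF continuous_on_subset[OF that subset_UNIV]])
  have Bsets: "B \<inter> S \<in> sets M" if "B \<in> sets borel" for B
    using that unfolding sets sets_restrict_space by auto
  have ind: "(indicator B :: 'a \<Rightarrow> real) \<in> borel_measurable M" if "B \<in> sets borel" for B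
    unfolding meas_eq by (rule measurable_restrict_space1[OF borel_measurable_indicator[OF that]])
  have sint: "set_integrable M B g" if "B \<in> sets borel" for B
    unfolding set_integrable_def
  proof (rule Bochner_Integration.integrable_bound[OF int])
    show "(\<lambda>x. indicator B x *\<^sub>R g x) \<in> borel_measurable M"
      by (rule borel_measurable_scaleR[OF ind[OF that] borel_measurable_integrable[OF int]])
  qed (simp add: indicator_def)
  have closed0: "(LINT x:F|M. g x) = 0" if F: "closed F" for F
  proof (cases "F = {}")
    case True then show ?thesis by (simp add: set_lebesgue_integral_def)
  next
    case False
    \<comment> \<open>For positive \<open>n\<close>, a ramp that is 1 on \<open>F\<close> and
      reaches 0 at distance \<open>1 / n\<close>.\<close>
    define h where "h n x = max 0 (1 - real n * infdist x F)" for n x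
    have conth: "continuous_on UNIV (h n)" for n
      unfolding h_def by (intro continuous_intros)
    have "\<exists>P. real_polynomial_function P \<and> (\<forall>x\<in>S. \<bar>h n x - P x\<bar> < 1 / real (Suc n))" for n
    proof -
      have "continuous_on S (h n)" using conth continuous_on_subset by blast
      then obtain P where "real_polynomial_function P" "\<And>x. x \<in> S \<Longrightarrow> \<bar>h n x - P x\<bar> < 1 / real (Suc n)"
        by (rule Stone_Weierstrass_real_polynomial_function[OF S, of _ "1 / real (Suc n)"]) (simp, blast)
      then show ?thesis by blast
    qed
    then have "\<exists>P. \<forall>n. real_polynomial_function (P n) \<and> (\<forall>x\<in>S. \<bar>h n x - P n x\<bar> < 1 / real (Suc n))"
      by (intro choice allI)
    then obtain P where P: "\<And>n. real_polynomial_function (P n)"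
      "\<And>n x. x \<in> S \<Longrightarrow> \<bar>h n x - P n x\<bar> < 1 / real (Suc n)" by blast
    have limh: "(\<lambda>n. h n x) \<longlonglongrightarrow> indicator F x" for x
    proof (cases "x \<in> F")
      case True then show ?thesis by (simp add: h_def)
    next
      case nF: False
      have pos: "infdist x F > 0" by (rule infdist_pos_not_in_closed[OF F False nF])
      have "eventually (\<lambda>n. 1 / infdist x F \<le> real n) sequentially"
        using eventually_ge_at_top[of "nat \<lceil>1 / infdist x F\<rceil>"]
        by eventually_elim (meson of_nat_le_iff order_trans real_nat_ceiling_ge)
      then have "eventually (\<lambda>n. h n x = indicator F x) sequentially"
      proof eventually_elim
        case (elim n)
        then have "1 \<le> real n * infdist x F" using pos by (simp add: pos_divide_le_eq)
        with nF show ?case by (simp add: h_def)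
      qed
      then show ?thesis by (simp add: tendsto_eventually)
    qed
    have limP: "(\<lambda>n. P n x) \<longlonglongrightarrow> indicator F x" if "x \<in> S" for x
    proof -
      have "(\<lambda>n. h n x - P n x) \<longlonglongrightarrow> 0"
      proof (rule Lim_null_comparison)
        show "\<forall>\<^sub>F n in sequentially. norm (h n x - P n x) \<le> 1 / real (Suc n)"
          using P(2)[OF that] by (intro always_eventually) (auto intro: less_imp_le)
        show "(\<lambda>n. 1 / real (Suc n)) \<longlonglongrightarrow> 0" 
          using LIMSEQ_inverse_real_of_nat by (simp only: inverse_eq_divide)
      qed
      from tendsto_diff[OF limh[of x] this] show ?thesis by simp
    qed
    \<comment> \<open>The ramps lie between 0 and 1 and \<open>P n\<close> is within distance 1 of
      them on \<open>S\<close>, whence the majorant 2|g|.\<close>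
    have "(\<lambda>n. \<integral>x. g x * P n x \<partial>M) \<longlonglongrightarrow> (\<integral>x. g x * indicator F x \<partial>M)"
    proof (rule integral_dominated_convergence[where w = "\<lambda>x. \<bar>g x\<bar> * 2"])
      show "(\<lambda>x. g x * indicator F x) \<in> borel_measurable M"
        by (rule borel_measurable_times[OF borel_measurable_integrable[OF int] ind])
          (use F in simp)
      show "(\<lambda>x. g x * P n x) \<in> borel_measurable M" for n
        by (intro borel_measurable_times[OF borel_measurable_integrable[OF int] cont]
            continuous_at_imp_continuous_on ballI continuous_real_polymonial_function P(1))
      show "integrable M (\<lambda>x. \<bar>g x\<bar> * 2)" using int by simp
      show "AE x in M. (\<lambda>n. g x * P n x) \<longlonglongrightarrow> g x * indicator F x"
        by (rule AE_I2) (use limP space in \<open>auto intro!: tendsto_intros\<close>)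
      show "AE x in M. norm (g x * P n x) \<le> \<bar>g x\<bar> * 2" for n
      proof (rule AE_I2)
        fix x assume "x \<in> space M"
        then have "\<bar>h n x - P n x\<bar> < 1 / real (Suc n)" using P(2) space by auto
        moreover have "1 / real (Suc n) \<le> 1" by simp
        moreover have "0 \<le> h n x" "h n x \<le> 1"
          using infdist_nonneg[of x F] by (auto simp: h_def)
        ultimately have "\<bar>P n x\<bar> \<le> 2" by linarith
        then show "norm (g x * P n x) \<le> \<bar>g x\<bar> * 2"
          by (simp add: abs_mult mult_left_mono)
      qed
    qed
    then have "(\<integral>x. g x * indicator F x \<partial>M) = 0"
      using zero[OF P(1)] by (simp add: LIMSEQ_const_iff)
    then show ?thesis by (simp add: set_lebesgue_integral_def mult.commute)
  qed
  have borel0: "(LINT x:B|M. g x) = 0" if "B \<in> sets borel" for B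
  proof -
    have gen: "sets borel = sigma_sets UNIV (Collect (closed :: 'a set \<Rightarrow> bool))"
      by (simp add: borel_eq_closed)
    have stable: "Int_stable (Collect (closed :: 'a set \<Rightarrow> bool))"
      by (auto simp: Int_stable_def)
    have "B \<in> sigma_sets UNIV (Collect closed)" using that gen by blast
    show ?thesis
      \<comment> \<open>Dynkin's argument: closed sets are stable under intersection, and vanishing
        of the integral passes to complements, by the moment of the constant 1, and to countable
        disjoint unions.\<close>
      proof (rule sigma_sets_induct_disjoint[OF stable _ \<open>B \<in> sigma_sets UNIV (Collect closed)\<close>, of "\<lambda>B. (LINT x:B|M. g x) = 0"])
      fix A :: "'a set" assume A: "A \<in> sigma_sets UNIV (Collect closed)" "(LINT x:A|M. g x) = 0"
      have A': "A \<in> sets borel" using A gen by blast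
      have "(LINT x:UNIV - A|M. g x) = (\<integral>x. g x - indicator A x *\<^sub>R g x \<partial>M)"
        unfolding set_lebesgue_integral_def
        by (intro Bochner_Integration.integral_cong) (auto simp: indicator_def)
      also have "\<dots> = (\<integral>x. g x \<partial>M) - (\<integral>x. indicator A x *\<^sub>R g x \<partial>M)"
        using sint[OF A'] by (intro Bochner_Integration.integral_diff int) (simp add: set_integrable_def)
      also have "\<dots> = 0" using A(2) zero[of "\<lambda>_. 1"] by (simp add: set_lebesgue_integral_def real_polynomial_function.intros(2))
      finally show "(LINT x:UNIV - A|M. g x) = 0" .
    next
      fix A :: "nat \<Rightarrow> 'a set"
      assume A: "disjoint_family A" "range A \<subseteq> sigma_sets UNIV (Collect closed)"
        "\<And>i. (LINT x:A i|M. g x) = 0"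
      have A': "A i \<in> sets borel" for i using A(2) gen by blast
      have eqS: "(LINT x:C|M. g x) = (LINT x:C \<inter> S|M. g x)" for C
        unfolding set_lebesgue_integral_def
        by (intro Bochner_Integration.integral_cong) (auto simp: indicator_def space)
      have "(LINT x:(\<Union>i. A i)|M. g x) = (LINT x:(\<Union>i. A i \<inter> S)|M. g x)"
        by (subst eqS) simp
      also have "\<dots> = (\<Sum>i. LINT x:A i \<inter> S|M. g x)"
      proof (rule lebesgue_integral_countable_add)
        show "A i \<inter> S \<in> sets M" for i using Bsets A' by blast
        show "(A i \<inter> S) \<inter> (A j \<inter> S) = {}" if "i \<noteq> j" for i j
          using A(1) that by (auto simp: disjoint_family_on_def)
        have "(\<Union>i. A i \<inter> S) \<in> sets borel"
          using A' S by (auto intro: borel_compact)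
        then show "set_integrable M (\<Union>i. A i \<inter> S) g" by (rule sint)
      qed
      also have "\<dots> = 0" using A(3) eqS by simp
      finally show "(LINT x:(\<Union>i. A i)|M. g x) = 0" .
    qed (use closed0 in \<open>auto simp: set_lebesgue_integral_def\<close>)
  qed
  show ?thesis
  proof (rule density_unique_real[OF int, of "\<lambda>_. 0"])
    fix A assume "A \<in> sets M"
    then obtain B where B: "B \<in> sets borel" "A = B \<inter> S"
      unfolding sets sets_restrict_space by auto
    have "A \<in> sets borel" using B S by (auto intro: borel_compact)
    then show "(LINT x:A|M. g x) = (LINT x:A|M. 0)" by (simp add: borel0)
  qed simp
qed

subsection \<open>Test functions and square integrable functions\<close>


lemma C1_add:
  assumes "C1_with_gradient v G" "C1_with_gradient w H"
  shows "C1_with_gradient (\<lambda>x. v x + w x) (\<lambda>x. G x + H x)"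
  using assms unfolding C1_with_gradient_def
  by (simp add: GDERIV_add continuous_on_add)

lemma C1_continuous:
  assumes "C1_with_gradient w G"
  shows "continuous_on UNIV w" "continuous_on UNIV G"
proof -
  show "continuous_on UNIV w"
  proof (intro continuous_at_imp_continuous_on ballI)
    fix x show "isCont w x"
      using assms has_derivative_continuous unfolding C1_with_gradient_def gderiv_def by blast
  qed
  show "continuous_on UNIV G" using assms unfolding C1_with_gradient_def by blast
qed

lemma C1_mult:
  assumes "C1_with_gradient v G" "C1_with_gradient w H"
  shows "C1_with_gradient (\<lambda>x. v x * w x) (\<lambda>x. v x *\<^sub>R H x + w x *\<^sub>R G x)"
  unfolding C1_with_gradient_def
proof (intro conjI allI)
  fix x
  show "GDERIV (\<lambda>x. v x * w x) x :> v x *\<^sub>R H x + w x *\<^sub>R G x"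
    using assms GDERIV_mult unfolding C1_with_gradient_def by blast
qed (intro continuous_on_add continuous_on_scaleR C1_continuous[OF assms(1)] C1_continuous[OF assms(2)])

lemma C1_const: "C1_with_gradient (\<lambda>_. c) (\<lambda>_. 0)"
  unfolding C1_with_gradient_def by (simp add: GDERIV_const)

text \<open>This admits polynomials in Green's formula. A linear functional has the constant
  gradient \<open>adjoint f 1\<close>.\<close>

lemma C1_real_polynomial_function:
  fixes P :: "real^'d \<Rightarrow> real"
  assumes "real_polynomial_function P"
  shows "\<exists>G. C1_with_gradient P G"
  using assms
proof (induction rule: real_polynomial_function.induct)
  case (linear f)
  then interpret f: bounded_linear f .
  have "f h = h \<bullet> adjoint f 1" for h
    using adjoint_works[OF f.linear_axioms, of h 1] by simp
  then have "f = (\<lambda>h. h \<bullet> adjoint f 1)" by (rule ext)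
  with f.has_derivative[OF has_derivative_ident] show ?case
    unfolding C1_with_gradient_def gderiv_def by (intro exI[of _ "\<lambda>_. adjoint f 1"]) auto
next
  case (const c)
  then show ?case using C1_const by blast
next
  case (add f g)
  then show ?case by (elim exE) (rule exI, erule (1) C1_add)
next
  case (mult f g)
  then show ?case by (elim exE) (rule exI, erule (1) C1_mult)
qed

text \<open>The squared positive part of r^2 - |x - y|^2. Squaring makes it continuously
  differentiable across the sphere, which is all that \<open>test_function\<close> demands, while it
  stays positive on the open ball.\<close>

definition bump :: "real^'d \<Rightarrow> real \<Rightarrow> real^'d \<Rightarrow> real" where
  "bump y r x = (max 0 (r\<^sup>2 - (x - y) \<bullet> (x - y)))\<^sup>2"

lemma bump_nonneg: "0 \<le> bump y r x"
  by (simp add: bump_def)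

lemma bump_pos: "0 < bump y r x" if "x \<in> ball y r"
proof -
  have "norm (x - y) < r" using that by (simp add: dist_norm norm_minus_commute)
  then have "(norm (x - y))\<^sup>2 < r\<^sup>2" by (intro power_strict_mono) auto
  then show ?thesis by (simp add: bump_def power2_norm_eq_inner)
qed

lemma bump_zero: "bump y r x = 0" if "x \<notin> ball y r" "r > 0"
proof -
  have "r \<le> norm (x - y)" using that by (simp add: dist_norm norm_minus_commute)
  then have "r\<^sup>2 \<le> (norm (x - y))\<^sup>2" using that(2) by (intro power_mono) auto
  then show ?thesis by (simp add: bump_def power2_norm_eq_inner)
qed

text \<open>At zero the difference quotient is bounded by |s|; elsewhere the function is locally a
  square or zero.\<close>

lemma DERIV_max_0_square: "DERIV (\<lambda>s. (max 0 s)\<^sup>2) t :> 2 * max 0 (t::real)"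
proof (cases "t = 0")
  case True
  have "((\<lambda>s. (max 0 s)\<^sup>2 / s) \<longlongrightarrow> 0) (at (0::real))"
  proof (rule Lim_null_comparison)
    show "\<forall>\<^sub>F s in at (0::real). norm ((max 0 s)\<^sup>2 / s) \<le> \<bar>s\<bar>"
      by (intro always_eventually) (auto simp: max_def power2_eq_square)
    show "((\<lambda>s::real. \<bar>s\<bar>) \<longlongrightarrow> 0) (at 0)"
      by (rule tendsto_eq_intros refl)+ simp
  qed
  then show ?thesis using True by (simp add: has_field_derivative_iff)
next
  case False
  show ?thesis
  proof (cases "t > 0")
    case True
    have "((\<lambda>s. s\<^sup>2) has_field_derivative 2 * max 0 t) (at t)"
      using True by (auto intro!: derivative_eq_intros)
    moreover have E: "\<forall>\<^sub>F s in nhds t. s\<^sup>2 = (max 0 s)\<^sup>2"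
      using True by (auto simp: eventually_nhds max_def intro!: exI[of _ "{0<..}"])
    ultimately show ?thesis
      using DERIV_cong_ev[OF refl E refl] by simp
  next
    case nt: False
    with False have t: "t < 0" by simp
    have "((\<lambda>s::real. 0::real) has_field_derivative 2 * max 0 t) (at t)"
      using t by (auto intro!: derivative_eq_intros)
    moreover have E: "\<forall>\<^sub>F s in nhds t. (0::real) = (max 0 s)\<^sup>2"
      using t by (auto simp: eventually_nhds max_def intro!: exI[of _ "{..<0}"])
    ultimately show ?thesis
      using DERIV_cong_ev[OF refl E refl] by simp
  qed
qed

lemma C1_bump:
  "C1_with_gradient (bump y r) (\<lambda>x. (2 * max 0 (r\<^sup>2 - (x - y) \<bullet> (x - y))) *\<^sub>R (- 2 *\<^sub>R (x - y)))"
  unfolding C1_with_gradient_def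
proof (intro conjI allI)
  fix x
  have "GDERIV (\<lambda>x. r\<^sup>2 - (x - y) \<bullet> (x - y)) x :> - 2 *\<^sub>R (x - y)"
    unfolding gderiv_def
    by (auto intro!: derivative_eq_intros simp: inner_commute algebra_simps)
  from GDERIV_DERIV_compose[OF this DERIV_max_0_square]
  show "GDERIV (bump y r) x :> (2 * max 0 (r\<^sup>2 - (x - y) \<bullet> (x - y))) *\<^sub>R (- 2 *\<^sub>R (x - y))"
    by (simp only: bump_def[abs_def])
next
  show "continuous_on UNIV (\<lambda>x. (2 * max 0 (r\<^sup>2 - (x - y) \<bullet> (x - y))) *\<^sub>R (- 2 *\<^sub>R (x - y)))"
    by (rule continuous_intros)+
qed

lemma test_function_mono:
  "test_function D w G \<Longrightarrow> interior D \<subseteq> interior D' \<Longrightarrow> test_function D' w G"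
  unfolding test_function_def by blast

text \<open>The complement of \<open>S\<close> is open, so \<open>w\<close> vanishes near each of
  its points and its gradient vanishes there too.\<close>

lemma test_function_vanishes:
  assumes "test_function D w G"
  obtains S where "compact S" "S \<subseteq> interior D" "\<And>x. x \<notin> S \<Longrightarrow> w x = 0" "\<And>x. x \<notin> S \<Longrightarrow> G x = 0"
proof -
  from assms obtain S where S: "compact S" "S \<subseteq> interior D" "\<And>x. x \<notin> S \<Longrightarrow> w x = 0"
    and C1: "\<And>x. GDERIV w x :> G x"
    unfolding test_function_def C1_with_gradient_def by blast
  have "G x = 0" if x: "x \<notin> S" for x
  proof -
    have "open (- S)" using S(1) by (simp add: compact_imp_closed open_Compl)
    then have "((\<lambda>_. 0) has_derivative (\<lambda>h. h \<bullet> G x)) (at x)"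
      using C1[of x] S(3) x unfolding gderiv_def
      by (auto intro: has_derivative_transform_within_open[of w _ x UNIV "- S"])
    then have "(\<lambda>h. h \<bullet> G x) = (\<lambda>_. 0)"
      by (rule has_derivative_unique) (rule has_derivative_const)
    then have "G x \<bullet> G x = 0" by metis
    then show ?thesis by simp
  qed
  with S that show thesis by blast
qed

text \<open>This localises arbitrary C1 functions. Applied to polynomials, it yields all moments of
  a function weighted with the bump.\<close>

lemma test_function_bump_mult:
  assumes "C1_with_gradient w H" "r > 0" "cball y r \<subseteq> interior D"
  shows "\<exists>G. test_function D (\<lambda>x. bump y r x * w x) G"
proof -
  have "\<forall>x. x \<notin> cball y r \<longrightarrow> bump y r x * w x = 0"
    using bump_zero[of _ y r] assms(2) by auto
  then show ?thesis
    using C1_mult[OF C1_bump assms(1), of y r] assms(3) unfolding test_function_def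
    by (meson compact_cball)
qed

section \<open>Square integrable functions and their inner products, up to null sets\<close>

lemma L2_measurable: "u \<in> L2 M \<Longrightarrow> u \<in> borel_measurable M"
  by (simp add: L2_def)

lemma L2_inner_integrable:
  fixes u v :: "'a \<Rightarrow> 'b::{real_inner,second_countable_topology}"
  assumes "u \<in> L2 M" "v \<in> L2 M"
  shows "integrable M (\<lambda>x. u x \<bullet> v x)"
proof (rule Bochner_Integration.integrable_bound)
  show "integrable M (\<lambda>x. (norm (u x))\<^sup>2 + (norm (v x))\<^sup>2)"
    using assms by (simp add: L2_def)
  show "(\<lambda>x. u x \<bullet> v x) \<in> borel_measurable M"
    by (intro borel_measurable_inner L2_measurable assms)
  have "\<bar>u x \<bullet> v x\<bar> \<le> (norm (u x))\<^sup>2 + (norm (v x))\<^sup>2" for x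
  proof -
    have "\<bar>u x \<bullet> v x\<bar> \<le> norm (u x) * norm (v x)" by (rule Cauchy_Schwarz_ineq2)
    also have "\<dots> \<le> 2 * (norm (u x) * norm (v x))" by simp
    also have "\<dots> \<le> (norm (u x))\<^sup>2 + (norm (v x))\<^sup>2"
      using sum_squares_bound[of "norm (u x)" "norm (v x)"] by (simp only: mult.assoc)
    finally show ?thesis .
  qed
  then show "AE x in M. norm (u x \<bullet> v x) \<le> norm ((norm (u x))\<^sup>2 + (norm (v x))\<^sup>2)"
    by simp
qed

lemma L2_add:
  assumes "u \<in> L2 M" "v \<in> L2 M"
  shows "(\<lambda>x. u x + v x) \<in> L2 M"
  unfolding L2_def
proof (intro CollectI conjI)
  show meas: "(\<lambda>x. u x + v x) \<in> borel_measurable M" by (intro borel_measurable_add L2_measurable assms)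
  show "integrable M (\<lambda>x. (norm (u x + v x))\<^sup>2)"
  proof (rule Bochner_Integration.integrable_bound)
    show "integrable M (\<lambda>x. 2 * (norm (u x))\<^sup>2 + 2 * (norm (v x))\<^sup>2)"
      using assms by (simp add: L2_def)
    have "(norm (u x + v x))\<^sup>2 \<le> 2 * (norm (u x))\<^sup>2 + 2 * (norm (v x))\<^sup>2" for x
    proof -
      have "(norm (u x + v x))\<^sup>2 \<le> (norm (u x) + norm (v x))\<^sup>2"
        by (intro power_mono norm_triangle_ineq) simp
      also have "\<dots> \<le> 2 * (norm (u x))\<^sup>2 + 2 * (norm (v x))\<^sup>2"
        using sum_squares_bound[of "norm (u x)" "norm (v x)"] by (simp add: power2_sum)
      finally show ?thesis .
    qed
    then show "AE x in M. norm ((norm (u x + v x))\<^sup>2) \<le> norm (2 * (norm (u x))\<^sup>2 + 2 * (norm (v x))\<^sup>2)"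
      by simp
  qed (use meas in simp)
qed

lemma L2_scaleR: "u \<in> L2 M \<Longrightarrow> (\<lambda>x. c *\<^sub>R u x) \<in> L2 M"
  by (auto simp: L2_def power_mult_distrib intro: borel_measurable_scaleR)

lemma L2_zero: "(\<lambda>_. 0) \<in> L2 M"
  by (simp add: L2_def)

lemma L2_sum: "(\<And>i. i \<in> A \<Longrightarrow> u i \<in> L2 M) \<Longrightarrow> (\<lambda>x. \<Sum>i\<in>A. u i x) \<in> L2 M"
  by (induction A rule: infinite_finite_induct) (auto simp: L2_zero L2_add)

lemma L2_bounded:
  assumes "finite_measure M" "u \<in> borel_measurable M" "\<And>x. x \<in> space M \<Longrightarrow> norm (u x) \<le> B"
  shows "u \<in> L2 M"
proof -
  interpret finite_measure M by fact
  have "integrable M (\<lambda>x. (norm (u x))\<^sup>2)"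
    by (rule integrable_const_bound[of _ "B\<^sup>2"])
      (use assms in \<open>auto intro!: AE_I2 power_mono\<close>)
  with assms(2) show ?thesis by (simp add: L2_def)
qed

lemma L2_imp_integrable:
  fixes u :: "'a \<Rightarrow> real"
  assumes "finite_measure M" "u \<in> L2 M"
  shows "integrable M u"
  using L2_inner_integrable[OF assms(2) L2_bounded[OF assms(1), of "\<lambda>_. 1" 1]] by simp

lemma L2_continuous:
  fixes w :: "real^'d \<Rightarrow> 'b::euclidean_space"
  assumes "continuous_on UNIV w" "compact S"
  shows "w \<in> L2 (lebesgue_on S)"
proof -
  have "S \<in> lmeasurable" using assms(2) by (rule lmeasurable_compact)
  moreover have "compact (w ` S)"
    using assms by (intro compact_continuous_image) (auto intro: continuous_on_subset)
  then obtain B where "\<And>x. x \<in> S \<Longrightarrow> norm (w x) \<le> B"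
    by (meson bounded_iff compact_imp_bounded image_eqI)
  ultimately show ?thesis
    using continuous_imp_measurable_on_sets_lebesgue[OF continuous_on_subset[OF assms(1)]]
    by (intro L2_bounded[of _ _ B]) (auto simp: finite_measure_lebesgue_on fmeasurableD)
qed

text \<open>Lebesgue measure is complete, so a.e. equality preserves measurability and
  representatives can be exchanged freely.\<close>

lemma borel_measurable_lebesgue_on_AE:
  fixes u v :: "real^'d \<Rightarrow> 'b::euclidean_space"
  assumes D: "D \<in> sets lebesgue" and u: "u \<in> borel_measurable (lebesgue_on D)"
    and ae: "AE x in lebesgue_on D. u x = v x"
  shows "v \<in> borel_measurable (lebesgue_on D)"
proof -
  have "(\<lambda>x. if x \<in> D then u x else 0) \<in> borel_measurable lebesgue"
    using u D by (simp add: borel_measurable_if)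
  moreover have "AE x in lebesgue. (if x \<in> D then u x else 0) = (if x \<in> D then v x else 0)"
    using ae D by (subst (asm) AE_restrict_space_iff) auto
  ultimately have "(\<lambda>x. if x \<in> D then v x else 0) \<in> borel_measurable lebesgue"
    by (rule borel_measurable_AE)
  then show ?thesis using D by (simp add: borel_measurable_if)
qed

lemma L2_AE_cong:
  fixes u v :: "real^'d \<Rightarrow> 'b::euclidean_space"
  assumes D: "D \<in> sets lebesgue" and u: "u \<in> L2 (lebesgue_on D)"
    and ae: "AE x in lebesgue_on D. u x = v x"
  shows "v \<in> L2 (lebesgue_on D)"
proof -
  have v: "v \<in> borel_measurable (lebesgue_on D)"
    using borel_measurable_lebesgue_on_AE[OF D L2_measurable[OF u] ae] .
  have "integrable (lebesgue_on D) (\<lambda>x. (norm (v x))\<^sup>2) \<longleftrightarrow>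
        integrable (lebesgue_on D) (\<lambda>x. (norm (u x))\<^sup>2)"
    by (rule integrable_cong_AE) (use u v ae in \<open>auto simp: L2_def\<close>)
  with u v show ?thesis by (simp add: L2_def)
qed

lemma l2_inner_cong_AE:
  fixes u u' v v' :: "real^'d \<Rightarrow> 'b::euclidean_space"
  assumes D: "D \<in> sets lebesgue" and u: "u \<in> L2 (lebesgue_on D)" and v: "v \<in> L2 (lebesgue_on D)"
    and ae: "AE x in lebesgue_on D. u x = u' x" "AE x in lebesgue_on D. v x = v' x"
  shows "l2_inner D u v = l2_inner D u' v'"
  unfolding l2_inner_def
proof (rule integral_cong_AE)
  show "(\<lambda>x. u x \<bullet> v x) \<in> borel_measurable (lebesgue_on D)"
    "(\<lambda>x. u' x \<bullet> v' x) \<in> borel_measurable (lebesgue_on D)"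
    by (intro borel_measurable_inner L2_measurable u v L2_AE_cong[OF D u ae(1)] L2_AE_cong[OF D v ae(2)])+
  show "AE x in lebesgue_on D. u x \<bullet> v x = u' x \<bullet> v' x" using ae by eventually_elim simp
qed

lemma l2_inner_commute: "l2_inner D u v = l2_inner D v u"
  by (simp add: l2_inner_def inner_commute)

lemma l2_inner_diff_left:
  fixes u v w :: "real^'d \<Rightarrow> 'b::euclidean_space"
  assumes "u \<in> L2 (lebesgue_on D)" "v \<in> L2 (lebesgue_on D)" "w \<in> L2 (lebesgue_on D)"
  shows "l2_inner D (\<lambda>x. u x - v x) w = l2_inner D u w - l2_inner D v w"
  unfolding l2_inner_def inner_diff_left
  by (rule Bochner_Integration.integral_diff; rule L2_inner_integrable; fact)

lemma l2_inner_sum_left: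
  fixes w :: "real^'d \<Rightarrow> 'b::euclidean_space"
  assumes "\<And>i. i \<in> A \<Longrightarrow> u i \<in> L2 (lebesgue_on D)" "w \<in> L2 (lebesgue_on D)"
  shows "l2_inner D (\<lambda>x. \<Sum>i\<in>A. c i *\<^sub>R u i x) w = (\<Sum>i\<in>A. c i * l2_inner D (u i) w)"
  unfolding l2_inner_def inner_sum_left inner_scaleR_left
  by (subst Bochner_Integration.integral_sum) (use assms in \<open>auto intro: L2_inner_integrable\<close>)

lemma l2_inner_sum_right:
  fixes w :: "real^'d \<Rightarrow> 'b::euclidean_space"
  assumes "\<And>i. i \<in> A \<Longrightarrow> u i \<in> L2 (lebesgue_on D)" "w \<in> L2 (lebesgue_on D)"
  shows "l2_inner D w (\<lambda>x. \<Sum>i\<in>A. c i *\<^sub>R u i x) = (\<Sum>i\<in>A. c i * l2_inner D w (u i))"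
  using l2_inner_sum_left[of A u D w c] assms by (simp add: l2_inner_commute)

subsection \<open>Weak divergences\<close>


lemma AE_lebesgue_iff_negligible:
  fixes P :: "'a::euclidean_space \<Rightarrow> bool"
  shows "(AE x in lebesgue. P x) \<longleftrightarrow> negligible {x. \<not> P x}"
proof
  assume "AE x in lebesgue. P x"
  then obtain N where "N \<in> null_sets lebesgue" "{x. \<not> P x} \<subseteq> N"
    unfolding eventually_ae_filter by auto
  then show "negligible {x. \<not> P x}"
    by (meson negligible_iff_null_sets negligible_subset)
next
  assume "negligible {x. \<not> P x}"
  then show "AE x in lebesgue. P x"
    by (intro AE_I'[of "{x. \<not> P x}"]) (auto simp: negligible_iff_null_sets)
qed

lemma AE_lebesgue_on_iff_negligible:
  fixes P :: "'a::euclidean_space \<Rightarrow> bool"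
  assumes "D \<in> sets lebesgue"
  shows "(AE x in lebesgue_on D. P x) \<longleftrightarrow> negligible {x \<in> D. \<not> P x}"
proof -
  have "{x. \<not> (x \<in> D \<longrightarrow> P x)} = {x \<in> D. \<not> P x}" by auto
  then show ?thesis
    using assms by (simp add: AE_restrict_space_iff AE_lebesgue_iff_negligible)
qed

lemma bump_le: "bump y r x \<le> (r\<^sup>2)\<^sup>2"
  unfolding bump_def by (intro power_mono) auto

lemma bump_measurable: "bump y r \<in> borel_measurable borel"
  by (rule borel_measurable_continuous_onI[OF C1_continuous(1)[OF C1_bump]])

text \<open>The fundamental lemma of the calculus of variations on a ball: the bump turns every
  polynomial into a test function, so all moments of \<open>g\<close> times the bump vanish, and in
  the open ball the bump can be divided out.\<close>

lemma AE_zero_on_ball: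
  fixes g :: "real^'d \<Rightarrow> real"
  assumes D: "D \<in> sets lebesgue" and g: "integrable (lebesgue_on D) g"
    and zero: "\<And>w G. test_function D w G \<Longrightarrow> (LINT x|lebesgue_on D. g x * w x) = 0"
    and r: "r > 0" "cball y r \<subseteq> interior D"
  shows "negligible {x \<in> ball y r. g x \<noteq> 0}"
proof -
  let ?S = "cball y r"
  let ?h = "\<lambda>x. if x \<in> D then g x else 0"
  let ?b = "bump y r"
  define M where "M = restrict_space lborel ?S"
  have h: "integrable lebesgue ?h"
    using g D by (simp add: Lebesgue_Measure.integrable_restrict_UNIV)
  \<comment> \<open>The moment lemma works with Borel sets, while \<open>g\<close> is only Lebesgue
    measurable; a Borel representative bridges the gap.\<close>
  then obtain h' where h': "h' \<in> borel_measurable lborel" and eq: "AE x in lborel. ?h x = h' x"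
    using completion_ex_borel_measurable_real[of ?h lborel] by auto
  have eq': "AE x in lebesgue. ?h x = h' x" using eq by (rule AE_completion)
  have h'c: "h' \<in> borel_measurable lebesgue" using h' by (rule measurable_completion)
  have "integrable lebesgue h'"
    using integrable_cong_AE[OF borel_measurable_integrable[OF h] h'c eq'] h by simp
  then have ih': "integrable lborel h'" using integrable_completion[OF h'] by simp
  have bm: "?b \<in> borel_measurable lborel" using bump_measurable by simp
  have ihb: "integrable lborel (\<lambda>x. h' x * ?b x)"
  proof (rule Bochner_Integration.integrable_bound)
    show "integrable lborel (\<lambda>x. h' x * (r\<^sup>2)\<^sup>2)" using ih' by simp
    show "(\<lambda>x. h' x * ?b x) \<in> borel_measurable lborel" using h' bm by (rule borel_measurable_times)
    show "AE x in lborel. norm (h' x * ?b x) \<le> norm (h' x * (r\<^sup>2)\<^sup>2)"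
    proof (rule AE_I2)
      fix x
      have "\<bar>h' x\<bar> * ?b x \<le> \<bar>h' x\<bar> * (r\<^sup>2)\<^sup>2" by (intro mult_left_mono bump_le) simp
      then show "norm (h' x * ?b x) \<le> norm (h' x * (r\<^sup>2)\<^sup>2)"
        by (simp add: abs_mult bump_nonneg)
    qed
  qed
  have S: "?S \<inter> space lborel \<in> sets lborel" by simp
  have supp: "indicator ?S x *\<^sub>R (h' x * ?b x * q) = h' x * ?b x * q" for x q
    using bump_zero[of x y r] r by (cases "x \<in> ?S") auto
  have "AE x in M. h' x * ?b x = 0"
  proof (rule AE_zero_if_polynomial_moments_zero)
    show "compact ?S" by simp
    show "sets M = sets (restrict_space borel ?S)"
      unfolding M_def by (rule sets_restrict_space_cong) simp
    show "integrable M (\<lambda>x. h' x * ?b x)"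
      unfolding M_def integrable_restrict_space[OF S] supp[of _ 1, unfolded mult_1_right] by (rule ihb)
    fix P :: "real^'d \<Rightarrow> real" assume P: "real_polynomial_function P"
    obtain H where H: "C1_with_gradient P H" using C1_real_polynomial_function[OF P] by blast
    have Pm: "P \<in> borel_measurable lborel"
      using borel_measurable_continuous_onI[OF C1_continuous(1)[OF H]] by simp
    have m: "(\<lambda>x. h' x * ?b x * P x) \<in> borel_measurable lborel"
      by (intro borel_measurable_times h' bm Pm)
    have "(\<integral>x. h' x * ?b x * P x \<partial>M) = (\<integral>x. h' x * ?b x * P x \<partial>lborel)"
      unfolding M_def integral_restrict_space[OF S] supp ..
    also have "\<dots> = (\<integral>x. h' x * ?b x * P x \<partial>lebesgue)"
      by (rule integral_completion[OF m, symmetric])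
    also have "\<dots> = (\<integral>x. (if x \<in> D then g x * (?b x * P x) else 0) \<partial>lebesgue)"
    proof (rule integral_cong_AE)
      show m1: "(\<lambda>x. h' x * ?b x * P x) \<in> borel_measurable lebesgue"
        using m by (rule measurable_completion)
      have e: "AE x in lebesgue. h' x * ?b x * P x = (if x \<in> D then g x * (?b x * P x) else 0)"
        using eq' by eventually_elim (auto split: if_splits)
      then show "AE x in lebesgue. h' x * ?b x * P x = (if x \<in> D then g x * (?b x * P x) else 0)" .
      show "(\<lambda>x. if x \<in> D then g x * (?b x * P x) else 0) \<in> borel_measurable lebesgue"
        by (rule borel_measurable_AE[OF m1 e])
    qed
    also have "\<dots> = (LINT x|lebesgue_on D. g x * (?b x * P x))"
      using D by (rule Lebesgue_Measure.integral_restrict_UNIV)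
    also have "\<dots> = 0"
      using test_function_bump_mult[OF H r] zero by blast
    finally show "(\<integral>x. h' x * ?b x * P x \<partial>M) = 0" .
  qed
  then have "AE x in lborel. x \<in> ?S \<longrightarrow> h' x * ?b x = 0"
    unfolding M_def by (subst (asm) AE_restrict_space_iff) auto
  then have "AE x in lebesgue. x \<in> ?S \<longrightarrow> h' x * ?b x = 0" by (rule AE_completion)
  with eq' have "AE x in lebesgue. x \<in> ball y r \<longrightarrow> g x = 0"
  proof eventually_elim
    case (elim x)
    show ?case
    proof
      assume x: "x \<in> ball y r"
      then have "x \<in> ?S" by auto
      then have "x \<in> D" using r(2) interior_subset by blast
      with elim x bump_pos[OF x] \<open>x \<in> ?S\<close> show "g x = 0" by auto
    qed
  qed
  then have "negligible {x. \<not> (x \<in> ball y r \<longrightarrow> g x = 0)}"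
    by (simp only: AE_lebesgue_iff_negligible)
  then show ?thesis by (rule negligible_subset) auto
qed

text \<open>Test functions see only the interior, so the rest of \<open>D\<close> has to be null.
  Inside, small balls suffice because negligibility is a local property.\<close>

lemma AE_zero_if_test_integrals_zero:
  fixes g :: "real^'d \<Rightarrow> real"
  assumes D: "D \<in> sets lebesgue" and g: "integrable (lebesgue_on D) g"
    and zero: "\<And>w G. test_function D w G \<Longrightarrow> (LINT x|lebesgue_on D. g x * w x) = 0"
    and fr: "negligible (D - interior D)"
  shows "AE x in lebesgue_on D. g x = 0"
proof -
  let ?N = "{x \<in> interior D. g x \<noteq> 0}"
  have "negligible ?N"
  proof (rule locally_negligible_alt[THEN iffD2], rule ballI)
    fix y assume y: "y \<in> ?N"
    then have "y \<in> interior D" by simp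
    then obtain r where r: "r > 0" "cball y r \<subseteq> interior D"
      using open_contains_cball[THEN iffD1, OF open_interior] by metis
    show "\<exists>U. openin (top_of_set ?N) U \<and> y \<in> U \<and> negligible U"
    proof (intro exI conjI)
      show "openin (top_of_set ?N) (?N \<inter> ball y r)" by (simp add: openin_open_Int)
      show "y \<in> ?N \<inter> ball y r" using y r by simp
      show "negligible (?N \<inter> ball y r)"
        by (rule negligible_subset[OF AE_zero_on_ball[OF D g zero r]]) auto
    qed
  qed
  then have "negligible (?N \<union> (D - interior D))" using fr by (rule negligible_Un)
  then have "negligible {x \<in> D. \<not> g x = 0}" by (rule negligible_subset) auto
  then show ?thesis using D by (simp add: AE_lebesgue_on_iff_negligible)
qed

lemma L2_continuous_compact_support:
  fixes v :: "real^'d \<Rightarrow> 'b::euclidean_space"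
  assumes D: "D \<in> lmeasurable" and S: "compact S" and v: "continuous_on UNIV v" "\<And>x. x \<notin> S \<Longrightarrow> v x = 0"
  shows "v \<in> L2 (lebesgue_on D)"
proof -
  have "compact (v ` S)"
    by (rule compact_continuous_image[OF continuous_on_subset[OF v(1)] S]) simp
  then obtain B where B: "\<And>x. x \<in> S \<Longrightarrow> norm (v x) \<le> B"
    by (meson bounded_iff compact_imp_bounded image_eqI)
  have "norm (v x) \<le> max B 0" for x using B[of x] v(2)[of x] by (cases "x \<in> S") auto
  moreover have "v \<in> borel_measurable (lebesgue_on D)"
    by (rule continuous_imp_measurable_on_sets_lebesgue[OF continuous_on_subset[OF v(1)]])
      (use D in auto)
  ultimately show ?thesis
    using D by (intro L2_bounded[of _ _ "max B 0"] finite_measure_lebesgue_on) auto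
qed

lemma test_function_in_L2:
  assumes "test_function D w G" "D \<in> lmeasurable"
  shows "w \<in> L2 (lebesgue_on D)" "G \<in> L2 (lebesgue_on D)"
proof -
  obtain S where S: "compact S" "S \<subseteq> interior D" "\<And>x. x \<notin> S \<Longrightarrow> w x = 0" "\<And>x. x \<notin> S \<Longrightarrow> G x = 0"
    by (rule test_function_vanishes[OF assms(1)]) blast
  have C1: "C1_with_gradient w G" using assms(1) by (simp add: test_function_def)
  show "w \<in> L2 (lebesgue_on D)" "G \<in> L2 (lebesgue_on D)"
    using L2_continuous_compact_support[OF assms(2) S(1) C1_continuous(1)[OF C1]]
      L2_continuous_compact_support[OF assms(2) S(1) C1_continuous(2)[OF C1]] S by blast+
qed

lemma has_weak_div_unique:
  assumes D: "D \<in> lmeasurable" and fr: "negligible (D - interior D)"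
    and "has_weak_div D u g" "has_weak_div D u g'"
  shows "AE x in lebesgue_on D. g x = g' x"
proof -
  have D': "D \<in> sets lebesgue" using D by auto
  have L2: "g \<in> L2 (lebesgue_on D)" "g' \<in> L2 (lebesgue_on D)"
    using assms by (auto simp: has_weak_div_def)
  have "AE x in lebesgue_on D. g x - g' x = 0"
  proof (rule AE_zero_if_test_integrals_zero[OF D' _ _ fr])
    show "integrable (lebesgue_on D) (\<lambda>x. g x - g' x)"
      using L2_imp_integrable[OF finite_measure_lebesgue_on[OF D]] L2 by blast
    fix w G assume t: "test_function D w G"
    then have "l2_inner D g w = l2_inner D g' w"
      using assms(3,4) unfolding has_weak_div_def by (metis neg_equal_iff_equal)
    then have "l2_inner D (\<lambda>x. g x - g' x) w = 0"
      using l2_inner_diff_left[OF L2 test_function_in_L2(1)[OF t D]] by simp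
    then show "(LINT x|lebesgue_on D. (g x - g' x) * w x) = 0" by (simp add: l2_inner_def)
  qed
  then show ?thesis by simp
qed

text \<open>The choice made by \<open>weak_div\<close> is harmless, since any two candidates agree
  almost everywhere.\<close>

lemma weak_div_eq:
  assumes "D \<in> lmeasurable" "negligible (D - interior D)" "has_weak_div D u g"
  shows "has_weak_div D u (weak_div D u)" "AE x in lebesgue_on D. weak_div D u x = g x"
proof -
  show "has_weak_div D u (weak_div D u)"
    unfolding weak_div_def by (rule someI[of "has_weak_div D u", OF assms(3)])
  from has_weak_div_unique[OF assms(1,2) this assms(3)]
  show "AE x in lebesgue_on D. weak_div D u x = g x" .
qed

lemma has_weak_div_cong_AE:
  assumes D: "D \<in> lmeasurable" and wd: "has_weak_div D u g"
    and ae: "AE x in lebesgue_on D. u x = u' x" "AE x in lebesgue_on D. g x = g' x"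
  shows "has_weak_div D u' g'"
proof -
  have D': "D \<in> sets lebesgue" using D by auto
  have L2: "u \<in> L2 (lebesgue_on D)" "g \<in> L2 (lebesgue_on D)"
    using wd by (auto simp: has_weak_div_def)
  show ?thesis
    unfolding has_weak_div_def
  proof (intro conjI allI impI)
    show "u' \<in> L2 (lebesgue_on D)" by (rule L2_AE_cong[OF D' L2(1) ae(1)])
    show "g' \<in> L2 (lebesgue_on D)" by (rule L2_AE_cong[OF D' L2(2) ae(2)])
    fix w G assume t: "test_function D w G"
    have "l2_inner D u G = l2_inner D u' G"
      by (rule l2_inner_cong_AE[OF D' L2(1) test_function_in_L2(2)[OF t D] ae(1)]) simp
    moreover have "l2_inner D g w = l2_inner D g' w"
      by (rule l2_inner_cong_AE[OF D' L2(2) test_function_in_L2(1)[OF t D] ae(2)]) simp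
    ultimately show "l2_inner D u' G = - l2_inner D g' w"
      using wd t unfolding has_weak_div_def by metis
  qed
qed

lemma has_weak_div_sum:
  assumes D: "D \<in> lmeasurable" and wd: "\<And>i. i \<in> A \<Longrightarrow> has_weak_div D (u i) (g i)"
  shows "has_weak_div D (\<lambda>x. \<Sum>i\<in>A. c i *\<^sub>R u i x) (\<lambda>x. \<Sum>i\<in>A. c i *\<^sub>R g i x)"
  unfolding has_weak_div_def
proof (intro conjI allI impI)
  have L2: "\<And>i. i \<in> A \<Longrightarrow> u i \<in> L2 (lebesgue_on D)" "\<And>i. i \<in> A \<Longrightarrow> g i \<in> L2 (lebesgue_on D)"
    using wd by (auto simp: has_weak_div_def)
  show "(\<lambda>x. \<Sum>i\<in>A. c i *\<^sub>R u i x) \<in> L2 (lebesgue_on D)"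
    by (intro L2_sum L2_scaleR L2)
  show "(\<lambda>x. \<Sum>i\<in>A. c i *\<^sub>R g i x) \<in> L2 (lebesgue_on D)"
    by (intro L2_sum L2_scaleR L2)
  fix w G assume t: "test_function D w G"
  have "l2_inner D (\<lambda>x. \<Sum>i\<in>A. c i *\<^sub>R u i x) G = (\<Sum>i\<in>A. c i * l2_inner D (u i) G)"
    by (rule l2_inner_sum_left[OF L2(1) test_function_in_L2(2)[OF t D]])
  also have "\<dots> = - (\<Sum>i\<in>A. c i * l2_inner D (g i) w)"
    unfolding sum_negf[symmetric]
    by (rule sum.cong[OF refl]) (use wd t in \<open>auto simp: has_weak_div_def\<close>)
  also have "(\<Sum>i\<in>A. c i * l2_inner D (g i) w) = l2_inner D (\<lambda>x. \<Sum>i\<in>A. c i *\<^sub>R g i x) w"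
    by (rule l2_inner_sum_left[OF L2(2) test_function_in_L2(1)[OF t D], symmetric])
  finally show "l2_inner D (\<lambda>x. \<Sum>i\<in>A. c i *\<^sub>R u i x) G = - l2_inner D (\<lambda>x. \<Sum>i\<in>A. c i *\<^sub>R g i x) w" .
qed

section \<open>Restriction to subsets and summation over a partition\<close>

text \<open>Inclusion is asked for only up to a null set, because a closed cell may contain boundary
  points of the open domain.\<close>

lemma borel_measurable_lebesgue_on_subset_AE:
  fixes u :: "real^'d \<Rightarrow> 'b::euclidean_space"
  assumes D: "D \<in> sets lebesgue" and K: "K \<in> sets lebesgue" and neg: "negligible (K - D)"
    and u: "u \<in> borel_measurable (lebesgue_on D)"
  shows "u \<in> borel_measurable (lebesgue_on K)"
proof -
  have "(\<lambda>x. if x \<in> D then u x else 0) \<in> borel_measurable lebesgue"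
    using u D by (simp add: borel_measurable_if)
  then have "(\<lambda>x. if x \<in> D then u x else 0) \<in> borel_measurable (lebesgue_on K)"
    by (rule measurable_restrict_space1)
  moreover have "AE x in lebesgue_on K. (if x \<in> D then u x else 0) = u x"
    unfolding AE_lebesgue_on_iff_negligible[OF K]
    by (rule negligible_subset[OF neg]) auto
  ultimately show ?thesis by (rule borel_measurable_lebesgue_on_AE[OF K])
qed

lemma integrable_lebesgue_on_subset_AE:
  fixes h :: "real^'d \<Rightarrow> real"
  assumes D: "D \<in> sets lebesgue" and K: "K \<in> sets lebesgue" and neg: "negligible (K - D)"
    and h: "integrable (lebesgue_on D) h"
  shows "integrable (lebesgue_on K) h"
proof -
  have m: "h \<in> borel_measurable (lebesgue_on K)"
    by (rule borel_measurable_lebesgue_on_subset_AE[OF D K neg borel_measurable_integrable[OF h]])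
  have "integrable lebesgue (\<lambda>x. if x \<in> D then h x else 0)"
    using h D by (simp add: Lebesgue_Measure.integrable_restrict_UNIV)
  then have "integrable lebesgue (\<lambda>x. if x \<in> K then h x else 0)"
  proof (rule Bochner_Integration.integrable_bound)
    show "(\<lambda>x. if x \<in> K then h x else 0) \<in> borel_measurable lebesgue"
      using m K by (simp add: borel_measurable_if)
    show "AE x in lebesgue. norm (if x \<in> K then h x else 0) \<le> norm (if x \<in> D then h x else 0)"
      unfolding AE_lebesgue_iff_negligible by (rule negligible_subset[OF neg]) auto
  qed
  then show ?thesis using K by (simp add: Lebesgue_Measure.integrable_restrict_UNIV)
qed

lemma L2_subset_AE:
  fixes u :: "real^'d \<Rightarrow> 'b::euclidean_space"
  assumes "D \<in> sets lebesgue" "K \<in> sets lebesgue" "negligible (K - D)" "u \<in> L2 (lebesgue_on D)"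
  shows "u \<in> L2 (lebesgue_on K)"
  using assms borel_measurable_lebesgue_on_subset_AE integrable_lebesgue_on_subset_AE
  unfolding L2_def by blast

lemma integral_lebesgue_on_support:
  fixes h :: "real^'d \<Rightarrow> real"
  assumes "D \<in> sets lebesgue" "K \<in> sets lebesgue" "\<And>x. x \<in> K - D \<Longrightarrow> h x = 0" "\<And>x. x \<in> D - K \<Longrightarrow> h x = 0"
  shows "(LINT x|lebesgue_on D. h x) = (LINT x|lebesgue_on K. h x)"
proof -
  have "(\<lambda>x. if x \<in> D then h x else 0) = (\<lambda>x. if x \<in> K then h x else 0)"
    using assms(3,4) by (auto simp: fun_eq_iff)
  then show ?thesis using Lebesgue_Measure.integral_restrict_UNIV[OF assms(1), of h] Lebesgue_Measure.integral_restrict_UNIV[OF assms(2), of h]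
    by simp
qed

text \<open>A test function on \<open>K\<close> is also one on \<open>D\<close>, and its support
  lies in both sets, so the integrals over \<open>D\<close> and \<open>K\<close> agree.\<close>

lemma has_weak_div_subset:
  assumes D: "D \<in> sets lebesgue" and K: "K \<in> sets lebesgue" and neg: "negligible (K - D)"
    and int: "interior K \<subseteq> interior D" and wd: "has_weak_div D u g"
  shows "has_weak_div K u g"
  unfolding has_weak_div_def
proof (intro conjI allI impI)
  show "u \<in> L2 (lebesgue_on K)" "g \<in> L2 (lebesgue_on K)"
    using wd L2_subset_AE[OF D K neg] by (auto simp: has_weak_div_def)
  fix w G assume t: "test_function K w G"
  then obtain S where "compact S" and S: "S \<subseteq> interior K" "\<And>x. x \<notin> S \<Longrightarrow> w x = 0" "\<And>x. x \<notin> S \<Longrightarrow> G x = 0"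
    by (rule test_function_vanishes) blast
  have sub: "S \<subseteq> K" "S \<subseteq> D" using S(1) int interior_subset by blast+
  have "l2_inner D u G = - l2_inner D g w"
    using wd test_function_mono[OF t int] by (simp add: has_weak_div_def)
  moreover have "l2_inner D u G = l2_inner K u G" "l2_inner D g w = l2_inner K g w"
    unfolding l2_inner_def
    by (rule integral_lebesgue_on_support[OF D K]; use S sub in fastforce)+
  ultimately show "l2_inner K u G = - l2_inner K g w" by simp
qed

text \<open>Cells share faces and may reach beyond the open domain, so a partition means here that
  the indicators add up almost everywhere.\<close>

lemma integral_lebesgue_on_partition:
  fixes h :: "real^'d \<Rightarrow> real"
  assumes D: "D \<in> sets lebesgue" and fin: "finite \<T>" and \<T>: "\<And>K. K \<in> \<T> \<Longrightarrow> K \<in> sets lebesgue"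
    and part: "negligible {x. indicator D x \<noteq> (\<Sum>K\<in>\<T>. indicator K x :: real)}"
    and h: "\<And>K. K \<in> \<T> \<Longrightarrow> integrable (lebesgue_on K) h"
  shows "integrable (lebesgue_on D) h" "(LINT x|lebesgue_on D. h x) = (\<Sum>K\<in>\<T>. LINT x|lebesgue_on K. h x)"
proof -
  let ?f = "\<lambda>K x. if x \<in> K then h x else 0"
  have int: "integrable lebesgue (?f K)" if "K \<in> \<T>" for K
    using h[OF that] \<T>[OF that] by (simp add: Lebesgue_Measure.integrable_restrict_UNIV)
  have ae: "AE x in lebesgue. (\<Sum>K\<in>\<T>. ?f K x) = ?f D x"
    unfolding AE_lebesgue_iff_negligible
  proof (rule negligible_subset[OF part], safe)
    fix x assume ne: "(\<Sum>K\<in>\<T>. ?f K x) \<noteq> ?f D x" and eq: "indicator D x = (\<Sum>K\<in>\<T>. indicator K x :: real)"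
    have "(\<Sum>K\<in>\<T>. ?f K x) = (\<Sum>K\<in>\<T>. indicator K x) * h x"
      unfolding sum_distrib_right by (rule sum.cong) auto
    also have "\<dots> = ?f D x" using eq[symmetric] by simp
    finally show False using ne by simp
  qed
  have intS: "integrable lebesgue (\<lambda>x. \<Sum>K\<in>\<T>. ?f K x)" using int by simp
  have m: "?f D \<in> borel_measurable lebesgue"
    by (rule borel_measurable_AE[OF borel_measurable_integrable[OF intS] ae])
  have "integrable lebesgue (?f D)"
    using integrable_cong_AE[OF borel_measurable_integrable[OF intS] m ae] intS by simp
  then show "integrable (lebesgue_on D) h" using D by (simp add: Lebesgue_Measure.integrable_restrict_UNIV)
  have "(LINT x|lebesgue_on D. h x) = (LINT x|lebesgue. ?f D x)"
    by (rule Lebesgue_Measure.integral_restrict_UNIV[OF D, symmetric])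
  also have "\<dots> = (LINT x|lebesgue. (\<Sum>K\<in>\<T>. ?f K x))"
    by (rule integral_cong_AE[OF m borel_measurable_integrable[OF intS]]) (use ae in eventually_elim, simp)
  also have "\<dots> = (\<Sum>K\<in>\<T>. LINT x|lebesgue. ?f K x)"
    using int by (intro Bochner_Integration.integral_sum) auto
  also have "\<dots> = (\<Sum>K\<in>\<T>. LINT x|lebesgue_on K. h x)"
    by (rule sum.cong[OF refl]) (rule Lebesgue_Measure.integral_restrict_UNIV[OF \<T>])
  finally show "(LINT x|lebesgue_on D. h x) = (\<Sum>K\<in>\<T>. LINT x|lebesgue_on K. h x)" .
qed

subsection \<open>Facets of polytopes and surface measures\<close>


text \<open>A facet with its unit outward normal and the level of its hyperplane. The condition on
  the affine hull encodes dimension d - 1, which determines the normal up to sign.\<close>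

definition flat_facet :: "(real^'d) set \<Rightarrow> (real^'d) set \<Rightarrow> real^'d \<Rightarrow> real \<Rightarrow> bool" where
  "flat_facet K e n c \<longleftrightarrow> norm n = 1 \<and> K \<subseteq> {x. n \<bullet> x \<le> c} \<and> e = K \<inter> {x. n \<bullet> x = c} \<and>
     affine hull e = {x. n \<bullet> x = c} \<and> e \<noteq> {}"

text \<open>The supporting hyperplane that cuts out the facet is its whole affine hull, since both
  have dimension d - 1.\<close>

lemma facet_imp_flat_facet:
  fixes K :: "(real^'d) set"
  assumes K: "polytope K" "interior K \<noteq> {}" and e: "e facet_of K"
  obtains n c where "flat_facet K e n c"
proof -
  obtain a b where ab: "a \<noteq> 0" "K \<subseteq> {x. a \<bullet> x \<le> b}" "e = K \<inter> {x. a \<bullet> x = b}"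
    by (rule facet_of_polyhedron[OF polytope_imp_polyhedron[OF K(1)] e]) blast
  define n where "n = a /\<^sub>R norm a"
  define c where "c = b / norm a"
  have na: "norm a > 0" using ab(1) by simp
  have iff: "n \<bullet> x \<le> c \<longleftrightarrow> a \<bullet> x \<le> b" "n \<bullet> x = c \<longleftrightarrow> a \<bullet> x = b" for x
    using na by (auto simp: n_def c_def field_simps)
  have "aff_dim e = aff_dim K - 1" "e \<noteq> {}" using e by (auto simp: facet_of_def)
  then have dim: "aff_dim e = int (DIM(real^'d)) - 1"
    using aff_dim_nonempty_interior[OF K(2)] by simp
  have "affine hull e = {x. a \<bullet> x = b}"
  proof (rule affine_dim_equal)
    show "affine hull e \<subseteq> {x. a \<bullet> x = b}"
      by (rule hull_minimal) (auto simp: ab(3) affine_hyperplane)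
    show "aff_dim (affine hull e) = aff_dim {x. a \<bullet> x = b}"
      using dim ab(1) by (simp add: aff_dim_hyperplane)
  qed (use \<open>e \<noteq> {}\<close> in \<open>auto simp: affine_hyperplane\<close>)
  moreover have "norm n = 1" using na by (simp add: n_def)
  ultimately have "flat_facet K e n c"
    unfolding flat_facet_def iff using ab \<open>e \<noteq> {}\<close> by simp
  then show thesis by (rule that)
qed

lemma flat_facet_interior:
  assumes "flat_facet K e n c" "z \<in> interior K"
  shows "n \<bullet> z < c"
proof -
  obtain r where r: "r > 0" "cball z r \<subseteq> K"
    using assms(2) by (meson mem_interior_cball)
  have n: "norm n = 1" "K \<subseteq> {x. n \<bullet> x \<le> c}" using assms(1) by (auto simp: flat_facet_def)
  have "z + r *\<^sub>R n \<in> cball z r" using r n by (simp add: dist_norm)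
  then have "n \<bullet> (z + r *\<^sub>R n) \<le> c" using r n by blast
  moreover have "n \<bullet> n = 1" using n(1) by (simp add: norm_eq_1)
  ultimately have "n \<bullet> z + r \<le> c" by (simp add: inner_add_right)
  with r show ?thesis by simp
qed

text \<open>The component of \<open>m\<close> orthogonal to \<open>n\<close> is orthogonal to both
  vectors, hence to itself.\<close>

lemma unit_normal_parallel:
  fixes n m :: "'a::real_inner"
  assumes "norm n = 1" "norm m = 1" and orth: "\<And>v. n \<bullet> v = 0 \<Longrightarrow> m \<bullet> v = 0"
  shows "m = (n \<bullet> m) *\<^sub>R n \<and> \<bar>n \<bullet> m\<bar> = 1"
proof -
  have nn: "n \<bullet> n = 1" using assms by (simp add: norm_eq_1)
  define v where "v = m - (n \<bullet> m) *\<^sub>R n"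
  have "n \<bullet> v = 0" by (simp add: v_def inner_diff_right nn)
  then have "m \<bullet> v = 0" by (rule orth)
  then have "v \<bullet> v = 0" using \<open>n \<bullet> v = 0\<close>
    by (simp add: v_def inner_diff_left)
  then have m: "m = (n \<bullet> m) *\<^sub>R n" by (simp add: v_def)
  then have "norm m = \<bar>n \<bullet> m\<bar> * norm n" by (metis norm_scaleR)
  with assms m show ?thesis by simp
qed

lemma unit_normal_parallel_of_hyperplane:
  assumes "norm n = 1" "norm m = 1" "affine hull e = {x. n \<bullet> x = c}" "y0 \<in> e"
    and const: "\<And>x y. x \<in> e \<Longrightarrow> y \<in> e \<Longrightarrow> m \<bullet> x = m \<bullet> y"
  shows "m = (n \<bullet> m) *\<^sub>R n \<and> \<bar>n \<bullet> m\<bar> = 1"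
proof (rule unit_normal_parallel[OF assms(1,2)])
  fix v assume v: "n \<bullet> v = 0"
  have "e \<subseteq> {x. m \<bullet> x = m \<bullet> y0}" using const assms(4) by blast
  then have sub: "affine hull e \<subseteq> {x. m \<bullet> x = m \<bullet> y0}"
    by (rule hull_minimal) (rule affine_hyperplane)
  have "n \<bullet> y0 = c" using hull_inc[OF assms(4), of affine] assms(3) by blast
  then have "y0 + v \<in> affine hull e" using assms(3) v by (simp add: inner_add_right)
  then have "m \<bullet> (y0 + v) = m \<bullet> y0" using sub by blast
  then show "m \<bullet> v = 0" by (simp add: inner_add_right)
qed

text \<open>Any other candidate is constant on \<open>e\<close>, hence \<open>n\<close> or
  \<open>- n\<close>; an interior point of \<open>K\<close> excludes \<open>- n\<close>.\<close>

lemma outward_normal_eq: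
  assumes f: "flat_facet K e n c" and int: "interior K \<noteq> {}"
  shows "outward_normal K e = n"
  unfolding outward_normal_def
proof (rule the_equality)
  have n: "norm n = 1" "K \<subseteq> {x. n \<bullet> x \<le> c}" "e = K \<inter> {x. n \<bullet> x = c}" "affine hull e = {x. n \<bullet> x = c}" "e \<noteq> {}"
    using f by (auto simp: flat_facet_def)
  show "norm n = 1 \<and> (\<forall>x\<in>K. \<forall>y\<in>e. n \<bullet> x \<le> n \<bullet> y)" using n by auto
  fix m assume m: "norm m = 1 \<and> (\<forall>x\<in>K. \<forall>y\<in>e. m \<bullet> x \<le> m \<bullet> y)"
  obtain y0 where y0: "y0 \<in> e" using n by blast
  obtain z where z: "z \<in> interior K" using int by blast
  have "e \<subseteq> K" using n by blast
  then have "m \<bullet> x = m \<bullet> y" if "x \<in> e" "y \<in> e" for x y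
    using m that by (meson order_antisym subsetD)
  then have p: "m = (n \<bullet> m) *\<^sub>R n" "\<bar>n \<bullet> m\<bar> = 1"
    using unit_normal_parallel_of_hyperplane[OF n(1) _ n(4) y0, of m] m by blast+
  have "n \<bullet> z < n \<bullet> y0" using flat_facet_interior[OF f z] y0 n(3) by auto
  moreover have "m \<bullet> z \<le> m \<bullet> y0" using m y0 z interior_subset by blast
  then have "(n \<bullet> m) * (n \<bullet> z) \<le> (n \<bullet> m) * (n \<bullet> y0)"
    using p(1) by (metis inner_scaleR_left)
  ultimately have "n \<bullet> m \<ge> 0" by (metis linorder_not_le mult_le_cancel_left_neg)
  with p show "m = n" by simp
qed

text \<open>A point \<open>x\<close> near \<open>y\<close> lies on a segment from a fixed interior
  point \<open>z\<close> of \<open>K\<close> to a point \<open>w\<close> of the hyperplane. This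
  \<open>w\<close> is still close to \<open>y\<close>, hence in \<open>e\<close>, and convexity puts
  \<open>x\<close> into \<open>K\<close>.\<close>

lemma half_ball_subset:
  assumes f: "flat_facet K e n c" and K: "convex K" "interior K \<noteq> {}" and y: "y \<in> rel_interior e"
  obtains r where "r > 0" "\<And>x. dist x y < r \<Longrightarrow> n \<bullet> x \<le> c \<Longrightarrow> x \<in> K"
proof -
  have n: "norm n = 1" "K \<subseteq> {x. n \<bullet> x \<le> c}" "e = K \<inter> {x. n \<bullet> x = c}" "affine hull e = {x. n \<bullet> x = c}"
    using f by (auto simp: flat_facet_def)
  obtain s where s: "s > 0" "ball y s \<inter> affine hull e \<subseteq> e" "y \<in> e"
    using y by (auto simp: mem_rel_interior_ball)
  obtain z where z: "z \<in> interior K" using K(2) by blast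
  then have zK: "z \<in> K" using interior_subset by blast
  define h where "h = c - n \<bullet> z"
  have h: "h > 0" using flat_facet_interior[OF f z] by (simp add: h_def)
  have ny: "n \<bullet> y = c" using s(3) n(3) by blast
  \<comment> \<open>\<open>q\<close> controls how much projecting from \<open>z\<close> magnifies
    distances: the distance from \<open>w\<close> to \<open>y\<close> is at most
    \<open>2 * q\<close> times that from \<open>x\<close> to \<open>y\<close>. The two bounds in
    \<open>r\<close> yield \<open>t \<le> 1 / 2\<close> and \<open>norm (w - y) < s\<close>.\<close>
  define q where "q = 1 + norm (z - y) / h"
  have q: "q > 0" using h by (simp add: q_def add_pos_nonneg)
  define r where "r = min (h / 2) (s / (2 * q))"
  have r: "r > 0" using h s q by (simp add: r_def)
  have "x \<in> K" if x: "dist x y < r" "n \<bullet> x \<le> c" for x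
  proof -
    \<comment> \<open>The depth of \<open>x\<close> below the hyperplane relative to the depth
      \<open>h\<close> of \<open>z\<close>; this is the weight of \<open>z\<close> in
      \<open>x\<close>.\<close>
    define t where "t = (c - n \<bullet> x) / h"
    have t0: "t \<ge> 0" using x(2) h by (simp add: t_def)
    have "c - n \<bullet> x = n \<bullet> (y - x)" using ny by (simp add: inner_diff_right)
    also have "\<dots> \<le> norm n * norm (y - x)" by (rule norm_cauchy_schwarz)
    finally have cx: "c - n \<bullet> x \<le> norm (x - y)" using n(1) by (simp add: norm_minus_commute)
    then have tle: "t \<le> norm (x - y) / h" using h by (simp add: t_def divide_right_mono)
    also have "norm (x - y) / h \<le> 1 / 2"
      using x(1) h by (simp add: r_def dist_norm field_simps)
    finally have t1: "t \<le> 1 / 2" .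
    define w where "w = (x - t *\<^sub>R z) /\<^sub>R (1 - t)"
    have xw: "x = (1 - t) *\<^sub>R w + t *\<^sub>R z" using t1 by (simp add: w_def)
    have "t * h = c - n \<bullet> x" using h by (simp add: t_def)
    then have "n \<bullet> x - t * (n \<bullet> z) = (1 - t) * c" by (simp add: h_def algebra_simps)
    then have nw: "n \<bullet> w = c" using t1 by (simp add: w_def inner_diff_right)
    have wy: "w - y = ((x - y) - t *\<^sub>R (z - y)) /\<^sub>R (1 - t)"
    proof -
      have "(1 - t) *\<^sub>R (w - y) = (x - y) - t *\<^sub>R (z - y)"
        using xw by (simp add: algebra_simps)
      moreover have "w - y = ((1 - t) *\<^sub>R (w - y)) /\<^sub>R (1 - t)" using t1 by simp
      ultimately show ?thesis by simp
    qed
    have "\<bar>inverse (1 - t)\<bar> = inverse (1 - t)" using t1 by simp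
    then have "norm (w - y) = norm ((x - y) - t *\<^sub>R (z - y)) / (1 - t)"
      unfolding wy norm_scaleR by (simp only: divide_inverse_commute)
    also have "\<dots> \<le> (norm (x - y) + t * norm (z - y)) / (1 - t)"
      using norm_triangle_ineq4[of "x - y" "t *\<^sub>R (z - y)"] t0 t1 by (intro divide_right_mono) auto
    also have "\<dots> \<le> (norm (x - y) + t * norm (z - y)) / (1 / 2)"
      using t0 t1 by (intro divide_left_mono) auto
    also have "\<dots> = 2 * (norm (x - y) + t * norm (z - y))" by simp
    also have "\<dots> \<le> 2 * (norm (x - y) * q)"
      using mult_right_mono[OF tle, of "norm (z - y)"] by (simp add: q_def distrib_left)
    also have "\<dots> < s"
      using x(1) q by (simp add: r_def dist_norm field_simps)
    finally have "w \<in> ball y s" by (simp add: dist_norm norm_minus_commute)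
    then have "w \<in> e" using s(2) nw n(4) by blast
    then have "w \<in> K" using n(3) by blast
    then show ?thesis
      unfolding xw using K(1) zK t0 t1 by (intro convexD) auto
  qed
  with r show thesis by (rule that)
qed

lemma frontier_polytope:
  fixes K :: "(real^'d) set"
  assumes "polytope K" "interior K \<noteq> {}"
  shows "frontier K = \<Union>(facets K)"
  using rel_frontier_of_polyhedron[OF polytope_imp_polyhedron[OF assms(1)]]
    rel_interior_nonempty_interior[OF assms(2)]
  by (simp add: rel_frontier_def frontier_def facets_def)

section \<open>The surface measure of a flat face\<close>

lemma closest_point_hyperplane:
  fixes n :: "'a::euclidean_space"
  assumes n: "norm n = 1"
  shows "closest_point {x. n \<bullet> x = c} x = x - (n \<bullet> x - c) *\<^sub>R n"
proof (rule closest_point_unique[symmetric])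
  have nn: "n \<bullet> n = 1" using n by (simp add: norm_eq_1)
  show "convex {x. n \<bullet> x = c}" "closed {x. n \<bullet> x = c}"
    by (rule convex_hyperplane, rule closed_hyperplane)
  show "x - (n \<bullet> x - c) *\<^sub>R n \<in> {x. n \<bullet> x = c}" by (simp add: inner_diff_right nn)
  show "\<forall>z\<in>{x. n \<bullet> x = c}. dist x (x - (n \<bullet> x - c) *\<^sub>R n) \<le> dist x z"
  proof
    fix z assume z: "z \<in> {x. n \<bullet> x = c}"
    have "dist x (x - (n \<bullet> x - c) *\<^sub>R n) = \<bar>n \<bullet> (x - z)\<bar>"
      using n z by (simp add: dist_norm inner_diff_right)
    also have "\<dots> \<le> norm n * norm (x - z)" by (rule Cauchy_Schwarz_ineq2)
    finally show "dist x (x - (n \<bullet> x - c) *\<^sub>R n) \<le> dist x z" using n by (simp add: dist_norm)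
  qed
qed

text \<open>Surface measure depends on the face alone and not on a cell that has it as a facet;
  accordingly \<open>n\<close> may be either of the two unit normals.\<close>

locale flat_face =
  fixes e :: "(real^'d) set" and n c
  assumes compact: "compact e" and convex: "convex e" and nonempty: "e \<noteq> {}"
    and unit: "norm n = 1" and hull: "affine hull e = {x. n \<bullet> x = c}"
begin

abbreviation "proj \<equiv> closest_point (affine hull e)"

lemma proj_eq: "proj x = x - (n \<bullet> x - c) *\<^sub>R n"
  unfolding hull by (rule closest_point_hyperplane[OF unit])

lemma proj_continuous: "continuous_on S proj"
  unfolding proj_eq[abs_def] by (intro continuous_intros)

lemma proj_inner: "n \<bullet> proj x = c"
  using unit by (simp add: proj_eq inner_diff_right norm_eq_1)

lemma proj_id: "n \<bullet> x = c \<Longrightarrow> proj x = x"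
  by (simp add: proj_eq)

lemma on_hyperplane: "y \<in> e \<Longrightarrow> n \<bullet> y = c"
  using hull_inc[of y e affine] hull by blast

lemma dist_proj: "dist (proj x) (proj y) \<le> dist x y"
  by (rule closest_point_lipschitz) (use nonempty in \<open>auto simp: affine_imp_convex closed_affine_hull\<close>)

lemma prism_compact: "compact (face_prism e)"
proof -
  have eq: "face_prism e = proj -` e \<inter> {x. \<bar>n \<bullet> x - c\<bar> \<le> 1 / 2}"
    unfolding face_prism_def using unit by (auto simp: proj_eq dist_norm)
  have "closed (proj -` e)"
    using continuous_closed_vimage[of e proj] proj_continuous[of UNIV] compact
    by (simp add: compact_imp_closed continuous_on_eq_continuous_at)
  moreover have "closed {x. \<bar>n \<bullet> x - c\<bar> \<le> 1 / 2}"
    by (intro closed_Collect_le continuous_intros)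
  ultimately have "closed (face_prism e)" unfolding eq by (rule closed_Int)
  moreover have "bounded (face_prism e)"
  proof -
    obtain B where B: "\<And>y. y \<in> e \<Longrightarrow> norm y \<le> B"
      using compact_imp_bounded[OF compact] by (auto simp: bounded_iff)
    have "norm x \<le> B + 1 / 2" if "x \<in> face_prism e" for x
    proof -
      have "norm x \<le> norm (proj x) + dist x (proj x)"
        by (simp add: dist_norm norm_triangle_sub add.commute)
      then show ?thesis using that B[of "proj x"] by (simp add: face_prism_def)
    qed
    then show ?thesis by (auto simp: bounded_iff)
  qed
  ultimately show ?thesis by (simp add: compact_eq_bounded_closed)
qed

lemma prism_sets: "face_prism e \<inter> space lborel \<in> sets lborel"
  using prism_compact by (simp add: borel_compact)

lemma proj_measurable:
  "proj \<in> restrict_space lborel (face_prism e) \<rightarrow>\<^sub>M restrict_space borel e"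
proof (rule measurable_restrict_space2)
  show "proj \<in> space (restrict_space lborel (face_prism e)) \<rightarrow> e"
    by (auto simp: space_restrict_space face_prism_def)
  show "proj \<in> restrict_space lborel (face_prism e) \<rightarrow>\<^sub>M borel"
    using borel_measurable_continuous_onI[OF proj_continuous] by (intro measurable_restrict_space1) simp
qed

lemma sets_face_measure: "sets (face_measure e) = sets (restrict_space borel e)"
  by (simp add: face_measure_def)

lemma space_face_measure: "space (face_measure e) = e"
  by (simp add: face_measure_def space_restrict_space)

lemma emeasure_face_measure:
  assumes "B \<in> sets borel"
  shows "emeasure (face_measure e) (B \<inter> e) = emeasure lborel (proj -` B \<inter> face_prism e)"
proof -
  have B: "B \<inter> e \<in> sets (restrict_space borel e)"
    using assms by (auto simp: sets_restrict_space)
  have "emeasure (face_measure e) (B \<inter> e) =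
      emeasure (restrict_space lborel (face_prism e)) (proj -` (B \<inter> e) \<inter> face_prism e)"
    unfolding face_measure_def
    by (subst emeasure_distr[OF proj_measurable B]) (simp add: space_restrict_space)
  also have "\<dots> = emeasure lborel (proj -` (B \<inter> e) \<inter> face_prism e)"
    by (rule emeasure_restrict_space[OF prism_sets]) auto
  also have "proj -` (B \<inter> e) \<inter> face_prism e = proj -` B \<inter> face_prism e"
    by (auto simp: face_prism_def)
  finally show ?thesis .
qed

lemma finite_face_measure: "finite_measure (face_measure e)"
proof
  have "emeasure (face_measure e) (space (face_measure e)) = emeasure lborel (face_prism e)"
    using emeasure_face_measure[of UNIV] by (simp add: space_face_measure)
  also have "\<dots> < \<infinity>"
    using emeasure_bounded_finite[OF compact_imp_bounded[OF prism_compact]] by simp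
  finally show "emeasure (face_measure e) (space (face_measure e)) \<noteq> \<infinity>" by simp
qed

lemma continuous_measurable:
  fixes w :: "real^'d \<Rightarrow> 'b::euclidean_space"
  assumes "continuous_on UNIV w"
  shows "w \<in> borel_measurable (face_measure e)"
proof -
  have "borel_measurable (face_measure e) = borel_measurable (restrict_space borel e)"
    by (rule measurable_cong_sets[OF sets_face_measure refl])
  then show ?thesis
    using borel_measurable_continuous_on_restrict[OF continuous_on_subset[OF assms subset_UNIV]] by blast
qed

lemma L2_continuous_face:
  fixes w :: "real^'d \<Rightarrow> 'b::euclidean_space"
  assumes w: "continuous_on UNIV w"
  shows "w \<in> L2 (face_measure e)"
proof -
  have "compact (w ` e)"
    by (rule compact_continuous_image[OF continuous_on_subset[OF w] compact]) simp
  then obtain B where "\<And>x. x \<in> e \<Longrightarrow> norm (w x) \<le> B"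
    by (meson bounded_iff compact_imp_bounded image_eqI)
  then show ?thesis
    by (intro L2_bounded[OF finite_face_measure continuous_measurable[OF w], of B])
      (simp add: space_face_measure)
qed

lemma rel_frontier_eq: "rel_frontier e = e - rel_interior e"
  using compact by (simp add: rel_frontier_def compact_imp_closed)

text \<open>Prism points that project to the relative boundary of \<open>e\<close> are frontier
  points of the convex cylinder over \<open>e\<close>, and frontiers of convex sets are null
  sets.\<close>

lemma AE_rel_interior: "AE y in face_measure e. y \<in> rel_interior e"
proof (rule AE_I')
  let ?P = "{x. proj x \<in> e}"
  have R: "rel_frontier e \<in> sets borel" by (simp add: closed_rel_frontier)
  have conv: "Convex.convex ?P"
  proof (rule convexI)
    fix x y and u v :: real
    assume *: "x \<in> ?P" "y \<in> ?P" "0 \<le> u" "0 \<le> v" "u + v = 1"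
    have "proj (u *\<^sub>R x + v *\<^sub>R y) = u *\<^sub>R proj x + v *\<^sub>R proj y + (c - (u + v) * c) *\<^sub>R n"
      unfolding proj_eq by (simp add: algebra_simps inner_add_right)
    then show "u *\<^sub>R x + v *\<^sub>R y \<in> ?P" using * convexD[OF convex] by simp
  qed
  have "proj -` rel_frontier e \<inter> face_prism e \<subseteq> frontier ?P"
  proof
    fix x assume "x \<in> proj -` rel_frontier e \<inter> face_prism e"
    then have x: "proj x \<in> e" "proj x \<notin> rel_interior e" unfolding rel_frontier_eq by auto
    have "x \<notin> interior ?P"
    proof
      assume "x \<in> interior ?P"
      then obtain s where s: "s > 0" "ball x s \<subseteq> ?P" by (meson mem_interior)
      have "ball (proj x) s \<inter> affine hull e \<subseteq> e"
      proof
        fix z assume z: "z \<in> ball (proj x) s \<inter> affine hull e"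
        \<comment> \<open>Translating \<open>x\<close> parallel to the hyperplane moves its
          projection by the same vector.\<close>
        define p where "p = x + (z - proj x)"
        have "p \<in> ball x s" using z by (simp add: p_def dist_norm norm_minus_commute)
        moreover have "proj p = z"
        proof -
          have nz: "n \<bullet> z = c" using z hull by blast
          have np: "n \<bullet> p = n \<bullet> x"
            unfolding p_def inner_add_right inner_diff_right proj_inner nz by simp
          have "x - proj x = (n \<bullet> x - c) *\<^sub>R n" unfolding proj_eq by simp
          then show ?thesis unfolding proj_eq[of p] np by (simp add: p_def algebra_simps)
        qed
        ultimately show "z \<in> e" using s(2) by blast
      qed
      then have "proj x \<in> rel_interior e" using x(1) s(1) by (auto simp: mem_rel_interior_ball)
      with x(2) show False by simp
    qed
    then show "x \<in> frontier ?P" using x(1) closure_subset[of ?P] by (auto simp: frontier_def)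
  qed
  then have neg: "negligible (proj -` rel_frontier e \<inter> face_prism e)"
    by (rule negligible_subset[OF negligible_convex_frontier[OF conv]])
  have m: "proj -` rel_frontier e \<inter> face_prism e \<in> sets borel"
  proof (rule sets.Int)
    show "proj -` rel_frontier e \<in> sets borel"
      using measurable_sets[OF borel_measurable_continuous_onI[OF proj_continuous] R] by simp
    show "face_prism e \<in> sets borel" using prism_sets by simp
  qed
  have "emeasure lborel (proj -` rel_frontier e \<inter> face_prism e) = 0"
    using neg m by (simp add: negligible_iff_null_sets null_sets_def)
  then have "emeasure (face_measure e) (rel_frontier e) = 0"
    using emeasure_face_measure[OF R] by (simp add: rel_frontier_eq Int_absorb2 Diff_subset)
  moreover have "rel_frontier e \<in> sets (face_measure e)"
    unfolding sets_face_measure sets_restrict_space using R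
    by (auto simp: rel_frontier_eq intro!: image_eqI[of _ _ "rel_frontier e"])
  ultimately show "rel_frontier e \<in> null_sets (face_measure e)" by (simp add: null_sets_def)
  show "{y \<in> space (face_measure e). y \<notin> rel_interior e} \<subseteq> rel_frontier e"
    by (auto simp: space_face_measure rel_frontier_eq)
qed

text \<open>The projection is 1-Lipschitz, so a small ball around \<open>y\<close>, of radius at
  most the half height 1/2 of the prism, lies in the prism over
  \<open>ball y r \<inter> e\<close>.\<close>

lemma face_measure_ball_pos:
  assumes y: "y \<in> rel_interior e" and r: "r > 0"
  shows "emeasure (face_measure e) (ball y r \<inter> e) > 0"
proof -
  obtain s where s: "s > 0" "ball y s \<inter> affine hull e \<subseteq> e" "y \<in> e"
    using y by (auto simp: mem_rel_interior_ball)
  define t where "t = min r (min s (1 / 2))"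
  have t: "t > 0" using r s by (simp add: t_def)
  have py: "proj y = y" using proj_id on_hyperplane[OF s(3)] by blast
  have "ball y t \<subseteq> proj -` ball y r \<inter> face_prism e"
  proof
    fix x assume x: "x \<in> ball y t"
    have d: "dist y (proj x) \<le> dist y x" using dist_proj[of y x] py by simp
    then have 1: "proj x \<in> ball y r" "proj x \<in> ball y s" using x by (auto simp: t_def)
    have "proj x \<in> affine hull e" using hull proj_inner by blast
    then have "proj x \<in> e" using s(2) 1 by blast
    moreover have "dist x (proj x) \<le> dist x y"
      by (rule closest_point_le) (auto simp: closed_affine_hull hull_inc s(3))
    ultimately show "x \<in> proj -` ball y r \<inter> face_prism e"
      using x 1 by (simp add: face_prism_def t_def dist_commute)
  qed
  moreover have "proj -` ball y r \<inter> face_prism e \<in> sets lborel"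
    using measurable_sets[OF borel_measurable_continuous_onI[OF proj_continuous], of "ball y r"] prism_sets
    by auto
  ultimately have "emeasure lborel (ball y t) \<le> emeasure lborel (proj -` ball y r \<inter> face_prism e)"
    by (rule emeasure_mono)
  moreover have "emeasure lborel (ball y t) > 0"
    using t by (simp add: emeasure_lborel_ball_finite emeasure_ball unit_ball_vol_pos)
  ultimately show ?thesis
    using emeasure_face_measure[of "ball y r"] by simp
qed

end

subsection \<open>Geometry of meshes\<close>


lemma mesh_cell_polytope:
  fixes K :: "(real^'d) set"
  assumes "mesh_cell K"
  shows "polytope K" "interior K \<noteq> {}"
proof -
  have "polytope K \<and> interior K \<noteq> {}"
    using assms unfolding mesh_cell_def
  proof
    assume s: "int CARD('d) simplex K"
    have "aff_dim K = int DIM(real^'d)" using aff_dim_simplex[OF s] by simp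
    then have h: "affine hull K = UNIV" using aff_dim_eq_full by blast
    then have "K \<noteq> {}" by auto
    then have "rel_interior K \<noteq> {}" using convex_simplex[OF s] by (simp add: rel_interior_eq_empty)
    then show ?thesis using rel_interior_interior[OF h] simplex_imp_polytope[OF s] by simp
  next
    assume "\<exists>a A. invertible A \<and> K = parallelotope_map a A ` cbox 0 1"
    then obtain a A where A: "invertible A" and K: "K = parallelotope_map a A ` cbox 0 1" by blast
    have K': "K = (+) a ` ((*v) A ` cbox 0 1)"
      unfolding K parallelotope_map_def by (simp add: image_image)
    have lin: "linear ((*v) A)" by simp
    have inj: "inj ((*v) A)"
    proof (rule injI)
      obtain B where B: "B ** A = mat 1" using A by (auto simp: invertible_def)
      fix x y assume "A *v x = A *v y"
      then have "(B ** A) *v x = (B ** A) *v y" by (simp flip: matrix_vector_mul_assoc)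
      then show "x = y" by (simp add: B)
    qed
    have "polytope K"
      unfolding K' polytope_translation_eq by (rule polytope_linear_image[OF lin polytope_interval])
    moreover have "interior K = (+) a ` ((*v) A ` box 0 1)"
      unfolding K' interior_translation interior_injective_linear_image[OF lin inj] interior_cbox ..
    moreover have "(\<chi> i. 1 / 2) \<in> box 0 (1 :: real^'d)" by (simp add: mem_box_cart)
    then have "box 0 (1 :: real^'d) \<noteq> {}" by blast
    ultimately show ?thesis by simp
  qed
  then show "polytope K" "interior K \<noteq> {}" by auto
qed

locale mesh =
  fixes \<Omega> :: "(real^'d) set" and \<T> :: "(real^'d) set set"
  assumes domain: "bounded_lipschitz_domain \<Omega>" and mesh: "is_mesh \<Omega> \<T>"
begin

lemma fin: "finite \<T>" and cover: "\<Union>\<T> = closure \<Omega>"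
  using mesh by (auto simp: is_mesh_def)

lemma cell: "K \<in> \<T> \<Longrightarrow> mesh_cell K"
  using mesh by (auto simp: is_mesh_def)

lemma cell_polytope: "K \<in> \<T> \<Longrightarrow> polytope K"
  and cell_interior: "K \<in> \<T> \<Longrightarrow> interior K \<noteq> {}"
  using cell mesh_cell_polytope by blast+

lemma cell_compact: "K \<in> \<T> \<Longrightarrow> compact K"
  and cell_convex: "K \<in> \<T> \<Longrightarrow> convex K"
  using cell_polytope polytope_imp_compact polytope_imp_convex by blast+

lemma cell_disjoint: "K \<in> \<T> \<Longrightarrow> J \<in> \<T> \<Longrightarrow> K \<noteq> J \<Longrightarrow> interior K \<inter> interior J = {}"
  using mesh by (simp add: is_mesh_def)

lemma cell_faces: "K \<in> \<T> \<Longrightarrow> J \<in> \<T> \<Longrightarrow> (K \<inter> J) face_of K \<and> (K \<inter> J) face_of J"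
  using mesh by (simp add: is_mesh_def)

lemma open_domain: "open \<Omega>"
  using domain by (simp add: bounded_lipschitz_domain_def)

lemma finite_facets: "K \<in> \<T> \<Longrightarrow> finite (facets K)"
  unfolding facets_def by (rule finite_polytope_facets[OF cell_polytope])

lemma frontier_domain: "frontier \<Omega> = closure \<Omega> - \<Omega>"
  using open_domain by (simp add: frontier_def interior_open)

text \<open>The epigraph description excludes slits: directly below a boundary point there are
  points outside the closure. This keeps the interiors of the cells inside \<Omega>.\<close>

lemma interior_closure_domain: "interior (closure \<Omega>) = \<Omega>"
proof (rule subset_antisym)
  show "\<Omega> \<subseteq> interior (closure \<Omega>)"
    using open_domain by (simp add: interior_maximal closure_subset)
  show "interior (closure \<Omega>) \<subseteq> \<Omega>"
  proof
    fix x assume x: "x \<in> interior (closure \<Omega>)"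
    show "x \<in> \<Omega>"
    proof (rule ccontr)
      assume nx: "x \<notin> \<Omega>"
      then have "x \<in> frontier \<Omega>" using x interior_subset frontier_domain by blast
      then obtain \<nu> \<gamma> L U where U: "norm \<nu> = 1" "L-lipschitz_on UNIV \<gamma>" "open U" "x \<in> U"
        and epi: "\<Omega> \<inter> U = {y \<in> U. \<gamma> (y - (y \<bullet> \<nu>) *\<^sub>R \<nu>) < y \<bullet> \<nu>}"
        using domain unfolding bounded_lipschitz_domain_def by blast
      have \<nu>\<nu>: "\<nu> \<bullet> \<nu> = 1" using U(1) by (simp add: norm_eq_1)
      have "open (U \<inter> interior (closure \<Omega>))" using U by blast
      then obtain r where r: "r > 0" "ball x r \<subseteq> U \<inter> interior (closure \<Omega>)"
        using x U(4) open_contains_ball by blast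
      \<comment> \<open>Moving against \<nu> leaves the component in the hyperplane unchanged, so
        \<open>z\<close> is strictly below the graph.\<close>
      define z where "z = x - (r / 2) *\<^sub>R \<nu>"
      have zb: "z \<in> ball x r" using r U(1) by (simp add: z_def dist_norm)
      \<comment> \<open>The part of \<open>U\<close> below the graph is open and misses \<Omega>,
        hence also its closure.\<close>
      define V where "V = U \<inter> {y. y \<bullet> \<nu> < \<gamma> (y - (y \<bullet> \<nu>) *\<^sub>R \<nu>)}"
      have cont: "continuous_on UNIV \<gamma>" using U(2) by (rule lipschitz_on_continuous_on)
      have "open {y. y \<bullet> \<nu> < \<gamma> (y - (y \<bullet> \<nu>) *\<^sub>R \<nu>)}"
        by (intro open_Collect_less continuous_intros continuous_on_compose2[OF cont]) auto
      then have "open V" using U(3) by (auto simp: V_def)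
      moreover have "V \<inter> \<Omega> = {}"
      proof -
        have "y \<notin> \<Omega>" if "y \<in> V" for y
        proof
          assume "y \<in> \<Omega>"
          then have "y \<in> \<Omega> \<inter> U" using that by (simp add: V_def)
          then have "\<gamma> (y - (y \<bullet> \<nu>) *\<^sub>R \<nu>) < y \<bullet> \<nu>" using epi by blast
          with that show False by (simp add: V_def)
        qed
        then show ?thesis by blast
      qed
      ultimately have "V \<inter> closure \<Omega> = {}" by (simp add: open_Int_closure_eq_empty)
      moreover have "z \<in> V"
      proof -
        have zz: "z - (z \<bullet> \<nu>) *\<^sub>R \<nu> = x - (x \<bullet> \<nu>) *\<^sub>R \<nu>"
          by (simp add: z_def inner_diff_left \<nu>\<nu> algebra_simps)
        have "\<not> \<gamma> (x - (x \<bullet> \<nu>) *\<^sub>R \<nu>) < x \<bullet> \<nu>" using epi U(4) nx by blast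
        moreover have "z \<bullet> \<nu> < x \<bullet> \<nu>" using r by (simp add: z_def inner_diff_left \<nu>\<nu>)
        ultimately have "z \<bullet> \<nu> < \<gamma> (z - (z \<bullet> \<nu>) *\<^sub>R \<nu>)" unfolding zz by simp
        then show ?thesis using zb r(2) by (auto simp: V_def)
      qed
      moreover have "z \<in> closure \<Omega>" using zb r(2) interior_subset by blast
      ultimately show False by blast
    qed
  qed
qed

lemma cell_subset_closure: "K \<in> \<T> \<Longrightarrow> K \<subseteq> closure \<Omega>"
  using cover by blast

lemma cell_interior_subset: "K \<in> \<T> \<Longrightarrow> interior K \<subseteq> \<Omega>"
  using interior_mono[OF cell_subset_closure] interior_closure_domain by blast

lemma negligible_frontier_cell: "K \<in> \<T> \<Longrightarrow> negligible (frontier K)"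
  by (rule negligible_convex_frontier[OF cell_convex])

lemma negligible_cell_diff_domain: "K \<in> \<T> \<Longrightarrow> negligible (K - \<Omega>)"
  by (rule negligible_subset[OF negligible_frontier_cell])
    (use cell_interior_subset closure_subset in \<open>auto simp: frontier_def\<close>)

lemma negligible_cell_diff_interior: "K \<in> \<T> \<Longrightarrow> negligible (K - interior K)"
  by (rule negligible_subset[OF negligible_frontier_cell])
    (use closure_subset in \<open>auto simp: frontier_def\<close>)

lemma lmeasurable_cell: "K \<in> \<T> \<Longrightarrow> K \<in> lmeasurable"
  by (rule lmeasurable_compact[OF cell_compact])

lemma lebesgue_cell: "K \<in> \<T> \<Longrightarrow> K \<in> sets lebesgue"
  using lmeasurable_cell by (rule fmeasurableD)

lemma lmeasurable_domain: "\<Omega> \<in> lmeasurable"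
  using domain open_domain by (intro bounded_set_imp_lmeasurable)
    (auto simp: bounded_lipschitz_domain_def)

lemma lebesgue_domain: "\<Omega> \<in> sets lebesgue"
  using lmeasurable_domain by (rule fmeasurableD)

text \<open>Off the cell frontiers, which form a null set, a point of a cell is interior to it.
  Hence it lies in \<Omega> and in no other cell.\<close>

lemma cells_partition_domain:
  "negligible {x. indicator \<Omega> x \<noteq> (\<Sum>K\<in>\<T>. indicator K x :: real)}"
proof (rule negligible_subset)
  show "negligible (\<Union>K\<in>\<T>. frontier K)"
    using fin negligible_frontier_cell by (intro negligible_Union) auto
  show "{x. indicator \<Omega> x \<noteq> (\<Sum>K\<in>\<T>. indicator K x :: real)} \<subseteq> (\<Union>K\<in>\<T>. frontier K)"
  proof
    fix x assume ne: "x \<in> {x. indicator \<Omega> x \<noteq> (\<Sum>K\<in>\<T>. indicator K x :: real)}"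
    show "x \<in> (\<Union>K\<in>\<T>. frontier K)"
    proof (rule ccontr)
      assume nf: "x \<notin> (\<Union>K\<in>\<T>. frontier K)"
      have int: "x \<in> interior K" if "K \<in> \<T>" "x \<in> K" for K
        using that nf closure_subset[of K] by (auto simp: frontier_def)
      show False
      proof (cases "x \<in> \<Omega>")
        case True
        then obtain K where K: "K \<in> \<T>" "x \<in> K" using cover closure_subset by blast
        have "indicator J x = (0 :: real)" if "J \<in> \<T> - {K}" for J
          using int[of J] int[OF K] cell_disjoint[of J K] that K by (auto simp: indicator_def)
        then have "(\<Sum>J\<in>\<T>. indicator J x :: real) = indicator K x"
          using K fin by (subst sum.remove[of _ K]) auto
        with ne True K show False by simp
      next
        case False
        then have "indicator K x = (0 :: real)" if "K \<in> \<T>" for K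
          using int[OF that] cell_interior_subset[OF that] by (auto simp: indicator_def)
        then have "(\<Sum>J\<in>\<T>. indicator J x :: real) = 0" by (intro sum.neutral) blast
        with ne False show False by simp
      qed
    qed
  qed
qed

lemma AE_domain_iff:
  "(AE x in lebesgue_on \<Omega>. P x) \<longleftrightarrow> (\<forall>K\<in>\<T>. AE x in lebesgue_on K. P x)"
proof
  assume "AE x in lebesgue_on \<Omega>. P x"
  then have *: "negligible {x \<in> \<Omega>. \<not> P x}"
    by (simp add: AE_lebesgue_on_iff_negligible lebesgue_domain)
  show "\<forall>K\<in>\<T>. AE x in lebesgue_on K. P x"
  proof
    fix K assume K: "K \<in> \<T>"
    have "negligible ({x \<in> \<Omega>. \<not> P x} \<union> (K - \<Omega>))"
      using * negligible_cell_diff_domain[OF K] by (rule negligible_Un)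
    then have "negligible {x \<in> K. \<not> P x}" by (rule negligible_subset) auto
    then show "AE x in lebesgue_on K. P x"
      by (simp add: AE_lebesgue_on_iff_negligible lebesgue_cell[OF K])
  qed
next
  assume *: "\<forall>K\<in>\<T>. AE x in lebesgue_on K. P x"
  have "negligible (\<Union>K\<in>\<T>. {x \<in> K. \<not> P x})"
    using fin * by (intro negligible_Union) (auto simp: AE_lebesgue_on_iff_negligible lebesgue_cell)
  then have "negligible {x \<in> \<Omega>. \<not> P x}"
    by (rule negligible_subset) (use cover closure_subset in blast)
  then show "AE x in lebesgue_on \<Omega>. P x"
    by (simp add: AE_lebesgue_on_iff_negligible lebesgue_domain)
qed

section \<open>Facets and the cells adjacent to them\<close>

lemma facetD:
  assumes "K \<in> \<T>" "e \<in> facets K"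
  shows "e facet_of K" "e face_of K" "polytope e" "compact e" "convex e" "e \<noteq> {}"
    "aff_dim e = int DIM(real^'d) - 1" "e \<subseteq> K"
proof -
  show f: "e facet_of K" using assms by (simp add: facets_def)
  then show fc: "e face_of K" by (rule facet_of_imp_face_of)
  then show "polytope e" by (rule face_of_polytope_polytope[OF cell_polytope[OF assms(1)]])
  then show "compact e" "convex e" by (auto intro: polytope_imp_compact polytope_imp_convex)
  show "e \<noteq> {}" using f by (simp add: facet_of_def)
  show "aff_dim e = int DIM(real^'d) - 1"
    using f aff_dim_nonempty_interior[OF cell_interior[OF assms(1)]] by (simp add: facet_of_def)
  show "e \<subseteq> K" using fc by (rule face_of_imp_subset)
qed

lemma facet_flat:
  assumes "K \<in> \<T>" "e \<in> facets K"
  obtains c where "flat_facet K e (outward_normal K e) c" "flat_face e (outward_normal K e) c"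
proof -
  obtain n c where f: "flat_facet K e n c"
    by (rule facet_imp_flat_facet[OF cell_polytope[OF assms(1)] cell_interior[OF assms(1)] facetD(1)[OF assms]])
  have n: "n = outward_normal K e" using outward_normal_eq[OF f cell_interior[OF assms(1)]] by simp
  have "flat_face e n c"
    using f facetD[OF assms] by unfold_locales (auto simp: flat_facet_def)
  with f that show thesis unfolding n by blast
qed

text \<open>This excludes hanging nodes. The intersection of two distinct cells is a face of
  \<open>K\<close> that meets the relative interior of \<open>e\<close> and so contains
  \<open>e\<close>; as a proper face it has no larger dimension, so it equals
  \<open>e\<close>.\<close>

lemma facet_of_other_cell:
  assumes K: "K \<in> \<T>" "e \<in> facets K" and J: "J \<in> \<T>" and y: "y \<in> rel_interior e" "y \<in> J"
  shows "e \<in> facets J"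
proof (cases "J = K")
  case False
  let ?F = "K \<inter> J"
  have F: "?F face_of K" "?F face_of J" using cell_faces[OF K(1) J] by auto
  have "e \<subseteq> ?F"
    using y facetD(8)[OF K] rel_interior_subset by (intro subset_of_face_of[OF F(1)]) auto
  have "?F \<noteq> K"
  proof
    assume "?F = K"
    then have "interior K \<subseteq> interior J" by (intro interior_mono) auto
    with cell_disjoint[OF K(1) J] False cell_interior[OF K(1)] show False by auto
  qed
  then have "aff_dim ?F < aff_dim K" by (intro face_of_aff_dim_lt cell_convex[OF K(1)] F)
  then have dF: "aff_dim ?F \<le> aff_dim e"
    using facetD(1)[OF K] by (simp add: facet_of_def)
  have "e face_of ?F"
    by (rule face_of_subset[OF facetD(2)[OF K] \<open>e \<subseteq> ?F\<close>]) auto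
  then have "e = ?F"
    using face_of_aff_dim_lt[of ?F e] dF cell_convex K J by (metis convex_Int not_less)
  then have "e face_of J" using F by simp
  then show ?thesis
    using facetD(6,7)[OF K] aff_dim_nonempty_interior[OF cell_interior[OF J]]
    by (simp add: facets_def facet_of_def)
qed (use K in simp)

text \<open>Both are facets of \<open>J\<close>, and a face that meets the relative interior of
  \<open>e\<close> contains \<open>e\<close>; the dimensions are equal.\<close>

lemma facet_unique:
  assumes K: "K \<in> \<T>" "e \<in> facets K" and J: "J \<in> \<T>" "e' \<in> facets J"
    and y: "y \<in> rel_interior e" "y \<in> e'"
  shows "e = e'"
proof -
  have "y \<in> J" using y facetD(8)[OF J] by blast
  then have eJ: "e \<in> facets J" by (rule facet_of_other_cell[OF K J(1) y(1)])
  have "e \<subseteq> e'"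
    using y by (intro subset_of_face_of[OF facetD(2)[OF J] facetD(8)[OF J(1) eJ]]) auto
  then have "e face_of e'"
    by (rule face_of_subset[OF facetD(2)[OF J(1) eJ] _ facetD(8)[OF J]])
  then show ?thesis
    using face_of_aff_dim_lt[OF facetD(5)[OF J]] facetD(7)[OF J(1) eJ] facetD(7)[OF J] by force
qed

text \<open>Unit normals of one hyperplane are equal or opposite. Equal ones would put the same half
  ball into both cells, whose interiors are disjoint.\<close>

lemma opposite_normals:
  assumes K: "K \<in> \<T>" "e \<in> facets K" and J: "J \<in> \<T>" "e \<in> facets J" and ne: "K \<noteq> J"
  shows "outward_normal J e = - outward_normal K e"
proof -
  let ?n = "outward_normal K e" and ?m = "outward_normal J e"
  obtain c where f: "flat_facet K e ?n c" by (rule facet_flat[OF K])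
  obtain c' where g: "flat_facet J e ?m c'" by (rule facet_flat[OF J])
  have n: "norm ?n = 1" "affine hull e = {x. ?n \<bullet> x = c}" "e \<subseteq> {x. ?n \<bullet> x = c}"
    using f by (auto simp: flat_facet_def)
  have m: "norm ?m = 1" "e \<subseteq> {x. ?m \<bullet> x = c'}" using g by (auto simp: flat_facet_def)
  have "rel_interior e \<noteq> {}" using facetD[OF K] by (simp add: rel_interior_eq_empty)
  then obtain y where y: "y \<in> rel_interior e" by blast
  then have ye: "y \<in> e" using rel_interior_subset by blast
  have ny: "?n \<bullet> y = c" using n(3) ye by blast
  have my: "?m \<bullet> y = c'" using m(2) ye by blast
  have "?m \<bullet> x = ?m \<bullet> y'" if "x \<in> e" "y' \<in> e" for x y'
    using m(2) that by auto
  then have p: "?m = (?n \<bullet> ?m) *\<^sub>R ?n" "\<bar>?n \<bullet> ?m\<bar> = 1"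
    using unit_normal_parallel_of_hyperplane[OF n(1) m(1) n(2) ye] by blast+
  have "?n \<bullet> ?m \<noteq> 1"
  proof
    assume "?n \<bullet> ?m = 1"
    then have mn: "?m = ?n" using p(1) by simp
    then have cc: "c' = c" using ny my by simp
    obtain r where r: "r > 0" "\<And>x. dist x y < r \<Longrightarrow> ?n \<bullet> x \<le> c \<Longrightarrow> x \<in> K"
      by (rule half_ball_subset[OF f cell_convex[OF K(1)] cell_interior[OF K(1)] y]) blast
    obtain s where s: "s > 0" "\<And>x. dist x y < s \<Longrightarrow> ?m \<bullet> x \<le> c' \<Longrightarrow> x \<in> J"
      by (rule half_ball_subset[OF g cell_convex[OF J(1)] cell_interior[OF J(1)] y]) blast
    define V where "V = ball y (min r s) \<inter> {x. ?n \<bullet> x < c}"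
    have "open V" unfolding V_def by (intro open_Int open_ball open_halfspace_lt)
    moreover have "V \<subseteq> K" "V \<subseteq> J"
      using r(2) s(2) unfolding V_def mn cc by (auto simp: dist_commute)
    ultimately have "V \<subseteq> interior K \<inter> interior J" by (simp add: interior_maximal)
    moreover have "y - (min r s / 2) *\<^sub>R ?n \<in> V"
    proof -
      have "?n \<bullet> ?n = 1" using n(1) by (simp add: norm_eq_1)
      then have "?n \<bullet> (y - (min r s / 2) *\<^sub>R ?n) < c"
        using ny r(1) s(1) by (simp add: inner_diff_right)
      then show ?thesis using n(1) r(1) s(1) by (auto simp: V_def dist_norm min_def)
    qed
    ultimately show False using cell_disjoint[OF K(1) J(1) ne] by blast
  qed
  then have "?n \<bullet> ?m = - 1" using p(2) by linarith
  then show ?thesis using p(1) by simp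
qed

lemma rel_interior_meets_domain:
  assumes K: "K \<in> \<T>" "e \<in> facets K" and int: "\<not> e \<subseteq> frontier \<Omega>"
  obtains y where "y \<in> rel_interior e" "y \<in> \<Omega>"
proof -
  obtain x where x: "x \<in> e" "x \<notin> frontier \<Omega>" using int by blast
  then have "x \<in> \<Omega>" using facetD(8)[OF K] cell_subset_closure[OF K(1)] frontier_domain by blast
  moreover have "x \<in> closure (rel_interior e)"
    using x(1) convex_closure_rel_interior[OF facetD(5)[OF K]] closure_subset by blast
  ultimately have "\<Omega> \<inter> rel_interior e \<noteq> {}"
    using open_Int_closure_eq_empty[OF open_domain] by blast
  then show thesis using that by blast
qed

text \<open>Crossing \<open>e\<close> at a point of the domain leads into a second cell, and a third
  one is impossible because three normals cannot be pairwise opposite. The set equation makes sums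
  over the cells adjacent to \<open>e\<close> explicit.\<close>

lemma two_cells:
  assumes K: "K \<in> \<T>" "e \<in> facets K" and int: "\<not> e \<subseteq> frontier \<Omega>"
  obtains J where "J \<in> \<T>" "J \<noteq> K" "{J \<in> \<T>. e \<in> facets J} = {K, J}"
    "outward_normal J e = - outward_normal K e"
proof -
  let ?n = "outward_normal K e"
  obtain y where y: "y \<in> rel_interior e" "y \<in> \<Omega>" by (rule rel_interior_meets_domain[OF K int])
  then have ye: "y \<in> e" using rel_interior_subset by blast
  obtain c where f: "flat_facet K e ?n c" by (rule facet_flat[OF K])
  have n: "norm ?n = 1" "K \<subseteq> {x. ?n \<bullet> x \<le> c}" "?n \<bullet> y = c" using f ye by (auto simp: flat_facet_def)
  have "\<exists>J\<in>\<T>. J \<noteq> K \<and> y \<in> J"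
  proof (rule ccontr)
    assume "\<not> (\<exists>J\<in>\<T>. J \<noteq> K \<and> y \<in> J)"
    then have yC: "y \<notin> \<Union>(\<T> - {K})" by blast
    have "closed (\<Union>(\<T> - {K}))"
      using fin cell_compact by (intro closed_Union) (auto intro: compact_imp_closed)
    then have "open (\<Omega> - \<Union>(\<T> - {K}))" using open_domain by blast
    then obtain r where r: "r > 0" "ball y r \<subseteq> \<Omega> - \<Union>(\<T> - {K})"
      using y(2) yC open_contains_ball by blast
    let ?x = "y + (r / 2) *\<^sub>R ?n"
    have "?x \<in> ball y r" using r n(1) by (simp add: dist_norm)
    then have "?x \<in> \<Omega>" "?x \<notin> \<Union>(\<T> - {K})" using r(2) by blast+
    then have "?x \<in> K" using cover closure_subset by blast
    then have "?n \<bullet> ?x \<le> c" using n(2) by blast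
    moreover have "?n \<bullet> ?n = 1" using n(1) by (simp add: norm_eq_1)
    ultimately show False using r(1) n(3) by (simp add: inner_add_right)
  qed
  then obtain J where J: "J \<in> \<T>" "J \<noteq> K" "y \<in> J" by blast
  have eJ: "e \<in> facets J" by (rule facet_of_other_cell[OF K J(1) y(1) J(3)])
  have oJ: "outward_normal J e = - ?n" using opposite_normals[OF K J(1) eJ] J(2) by simp
  have "I = K \<or> I = J" if I: "I \<in> \<T>" "e \<in> facets I" for I
  proof (rule ccontr)
    assume "\<not> (I = K \<or> I = J)"
    then have "outward_normal I e = - ?n" "outward_normal I e = - outward_normal J e"
      using opposite_normals[OF K I] opposite_normals[OF J(1) eJ I] by auto
    then have "?n = - ?n" using oJ by simp
    then have "?n \<bullet> ?n = (- ?n) \<bullet> ?n" by (rule arg_cong)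
    moreover have "?n \<bullet> ?n = 1" using n(1) by (simp add: norm_eq_1)
    ultimately show False by simp
  qed
  then have "{J \<in> \<T>. e \<in> facets J} = {K, J}" using K J(1) eJ by blast
  with J(1,2) oJ that show thesis by blast
qed

text \<open>Each cell fills one of the two half balls at \<open>y\<close>, and the normals are
  opposite.\<close>

lemma ball_subset_two_cells:
  assumes K: "K \<in> \<T>" "e \<in> facets K" and J: "J \<in> \<T>" "e \<in> facets J" and ne: "K \<noteq> J"
    and y: "y \<in> rel_interior e"
  obtains r where "r > 0" "ball y r \<subseteq> K \<union> J"
proof -
  let ?n = "outward_normal K e"
  have ye: "y \<in> e" using y rel_interior_subset by blast
  obtain c where f: "flat_facet K e ?n c" by (rule facet_flat[OF K])
  obtain c' where g: "flat_facet J e (- ?n) c'"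
    using facet_flat[OF J] opposite_normals[OF K J ne] by metis
  have "?n \<bullet> y = c" "(- ?n) \<bullet> y = c'" using f g ye by (auto simp: flat_facet_def)
  then have c': "c' = - c" by simp
  obtain r where r: "r > 0" "\<And>x. dist x y < r \<Longrightarrow> ?n \<bullet> x \<le> c \<Longrightarrow> x \<in> K"
    by (rule half_ball_subset[OF f cell_convex[OF K(1)] cell_interior[OF K(1)] y]) blast
  obtain s where s: "s > 0" "\<And>x. dist x y < s \<Longrightarrow> (- ?n) \<bullet> x \<le> c' \<Longrightarrow> x \<in> J"
    by (rule half_ball_subset[OF g cell_convex[OF J(1)] cell_interior[OF J(1)] y]) blast
  have "ball y (min r s) \<subseteq> K \<union> J"
  proof
    fix x assume "x \<in> ball y (min r s)"
    then have d: "dist x y < r" "dist x y < s" by (auto simp: dist_commute)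
    show "x \<in> K \<union> J"
    proof (cases "?n \<bullet> x \<le> c")
      case False
      then have "(- ?n) \<bullet> x \<le> c'" by (simp add: c')
      then show ?thesis using s(2)[OF d(2)] by simp
    qed (use r(2)[OF d(1)] in simp)
  qed
  with r(1) s(1) that show thesis by (metis min_less_iff_conj)
qed

text \<open>The swept set lies in the affine hull of \<open>F\<close> and one translated point,
  whose dimension is at most d - 1.\<close>

lemma negligible_sweep:
  fixes F :: "(real^'d) set"
  assumes "aff_dim F \<le> int DIM(real^'d) - 2"
  shows "negligible {s + t *\<^sub>R \<nu> |s t. s \<in> F}"
proof (cases "F = {}")
  case False
  then obtain f where f: "f \<in> F" by blast
  let ?H = "affine hull (insert (f + \<nu>) F)"
  have "{s + t *\<^sub>R \<nu> |s t. s \<in> F} \<subseteq> ?H"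
  proof safe
    fix s t assume "s \<in> F"
    then have "s + t *\<^sub>R ((f + \<nu>) - f) \<in> ?H"
      by (intro mem_affine_3_minus) (auto intro: hull_inc f)
    then show "s + t *\<^sub>R \<nu> \<in> ?H" by simp
  qed
  moreover have "negligible ?H"
  proof -
    have "aff_dim ?H < int DIM(real^'d)" using assms by (simp add: aff_dim_insert)
    then have "interior ?H = {}" by (intro low_dim_interior) simp
    then show ?thesis by (simp add: negligible_convex_interior affine_imp_convex)
  qed
  ultimately show ?thesis by (rule negligible_subset[rotated])
qed simp

text \<open>A generic line through a cell of \<open>M\<close> misses all faces of codimension two, so at the last point
  of \<open>\<Union>M\<close> on it the line crosses a facet; the cell on the other side would have to belong to \<open>M\<close>.\<close>

lemma neighbour_closed_reaches_boundary:
  assumes M: "M \<subseteq> \<T>" "M \<noteq> {}"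
    and int: "\<And>K e. K \<in> M \<Longrightarrow> e \<in> facets K \<Longrightarrow> \<not> e \<subseteq> frontier \<Omega>"
    and closed: "\<And>K J e. K \<in> M \<Longrightarrow> J \<in> \<T> \<Longrightarrow> e \<in> facets K \<Longrightarrow> e \<in> facets J \<Longrightarrow> J \<in> M"
  shows False
proof -
  \<comment> \<open>The direction is arbitrary; genericity comes from the starting point
    \<open>x0\<close>, chosen outside the null set \<open>N\<close> of points whose line meets a
    face of codimension two.\<close>
  obtain \<nu> :: "real^'d" where \<nu>: "norm \<nu> = 1" using vector_choose_size[of 1] by auto
  define Sk where "Sk = (\<Union>K\<in>M. \<Union>e\<in>facets K. {F. F facet_of e})"
  define N where "N = (\<Union>F\<in>Sk. {s + t *\<^sub>R \<nu> |s t. s \<in> F})"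
  have "finite Sk" unfolding Sk_def
  proof (intro finite_UN_I)
    show "finite M" using M(1) fin by (rule finite_subset)
    show "finite (facets K)" if "K \<in> M" for K using finite_facets that M(1) by blast
    show "finite {F. F facet_of e}" if "K \<in> M" "e \<in> facets K" for K e
      using that M(1) by (intro finite_polytope_facets facetD(3)[of K]) auto
  qed
  have negN: "negligible N"
    unfolding N_def
  proof (intro negligible_Union finite_imageI \<open>finite Sk\<close>, safe)
    fix F assume "F \<in> Sk"
    then obtain K e where Ke: "K \<in> M" "e \<in> facets K" "F facet_of e" by (auto simp: Sk_def)
    then have "aff_dim F = aff_dim e - 1" by (simp add: facet_of_def)
    also have "aff_dim e = int DIM(real^'d) - 1" using Ke M(1) by (intro facetD(7)) auto
    finally show "negligible {s + t *\<^sub>R \<nu> |s t. s \<in> F}" by (intro negligible_sweep) simp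
  qed
  obtain K0 where K0: "K0 \<in> M" using M(2) by blast
  have "\<not> negligible (interior K0)"
    using open_not_negligible[of "interior K0"] cell_interior[of K0] K0 M(1) by auto
  then obtain x0 where x0: "x0 \<in> interior K0" "x0 \<notin> N"
    using negligible_subset[OF negN] by blast
  define U where "U = \<Union>M"
  have "compact U" unfolding U_def
    using M(1) fin cell_compact by (intro compact_Union) (auto intro: finite_subset)
  define A where "A = {t. x0 + t *\<^sub>R \<nu> \<in> U}"
  have A0: "0 \<in> A" using x0(1) K0 interior_subset by (auto simp: A_def U_def)
  have "compact A"
    unfolding compact_eq_bounded_closed
  proof
    obtain B where B: "\<And>x. x \<in> U \<Longrightarrow> norm x \<le> B"
      using compact_imp_bounded[OF \<open>compact U\<close>] by (auto simp: bounded_iff)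
    have "\<bar>t\<bar> \<le> B + norm x0" if "t \<in> A" for t
    proof -
      have "\<bar>t\<bar> = norm (t *\<^sub>R \<nu>)" using \<nu> by simp
      also have "\<dots> \<le> norm (x0 + t *\<^sub>R \<nu>) + norm x0"
        using norm_triangle_ineq4[of "x0 + t *\<^sub>R \<nu>" x0] by simp
      finally show ?thesis using B[of "x0 + t *\<^sub>R \<nu>"] that by (simp add: A_def)
    qed
    then show "bounded A" by (auto simp: bounded_iff)
    have "continuous_on UNIV (\<lambda>t. x0 + t *\<^sub>R \<nu>)" by (intro continuous_intros)
    then have "closed ((\<lambda>t. x0 + t *\<^sub>R \<nu>) -` U)"
      by (rule closed_vimage[OF compact_imp_closed[OF \<open>compact U\<close>]])
    then show "closed A" by (simp add: A_def vimage_def)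
  qed
  then obtain t where t: "t \<in> A" "\<And>s. s \<in> A \<Longrightarrow> s \<le> t"
    using compact_attains_sup[of A] A0 by blast
  define y where "y = x0 + t *\<^sub>R \<nu>"
  \<comment> \<open>\<open>y\<close> is the last point of the line in \<open>U\<close>, so no ball
    around it fits into \<open>U\<close>.\<close>
  have beyond: "r \<le> 0" if "ball y r \<subseteq> U" for r
  proof (rule ccontr)
    assume r: "\<not> r \<le> 0"
    have "y + (r / 2) *\<^sub>R \<nu> \<in> ball y r" using r \<nu> by (simp add: dist_norm)
    then have "y + (r / 2) *\<^sub>R \<nu> \<in> U" using that by blast
    moreover have "y + (r / 2) *\<^sub>R \<nu> = x0 + (t + r / 2) *\<^sub>R \<nu>"
      by (simp add: y_def algebra_simps)
    ultimately have "t + r / 2 \<in> A" by (simp add: A_def)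
    then have "t + r / 2 \<le> t" by (rule t(2))
    with r show False by simp
  qed
  obtain K where K: "K \<in> M" "y \<in> K" using t(1) by (auto simp: A_def U_def y_def)
  then have KT: "K \<in> \<T>" using M(1) by blast
  have "y \<notin> interior K"
  proof
    assume "y \<in> interior K"
    then obtain r where "r > 0" "ball y r \<subseteq> K" by (meson mem_interior)
    then show False using beyond[of r] K(1) by (force simp: U_def)
  qed
  then have "y \<in> frontier K" using K(2) closure_subset by (auto simp: frontier_def)
  then obtain e where e: "e \<in> facets K" "y \<in> e"
    using frontier_polytope[OF cell_polytope[OF KT] cell_interior[OF KT]] by auto
  \<comment> \<open>Otherwise \<open>y\<close> is on a facet of \<open>e\<close>, and following the
    line back puts \<open>x0\<close> into \<open>N\<close>.\<close>
  have ye: "y \<in> rel_interior e"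
  proof (rule ccontr)
    assume "y \<notin> rel_interior e"
    then obtain F where F: "F facet_of e" "y \<in> F"
      using e(2) rel_boundary_of_polyhedron[OF polytope_imp_polyhedron[OF facetD(3)[OF KT e(1)]]] by blast
    then have "F \<in> Sk" using K(1) e(1) by (auto simp: Sk_def)
    moreover have "x0 = y + (- t) *\<^sub>R \<nu>" by (simp add: y_def)
    ultimately have "x0 \<in> N" unfolding N_def using F(2) by blast
    with x0(2) show False ..
  qed
  obtain J where J: "J \<in> \<T>" "J \<noteq> K" "{J \<in> \<T>. e \<in> facets J} = {K, J}"
    by (rule two_cells[OF KT e(1) int[OF K(1) e(1)]]) blast
  then have eJ: "e \<in> facets J" by blast
  obtain r where r: "r > 0" "ball y r \<subseteq> K \<union> J"
    by (rule ball_subset_two_cells[OF KT e(1) J(1) eJ J(2)[symmetric] ye]) blast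
  have "J \<in> M" by (rule closed[OF K(1) J(1) e(1) eJ])
  then have "ball y r \<subseteq> U" using r(2) K(1) by (auto simp: U_def)
  then show False using beyond r(1) by force
qed

end

subsection \<open>Normal traces and multiscale basis functions\<close>


lemma L2_extend_zero:
  fixes u :: "real^'d \<Rightarrow> 'b::euclidean_space"
  assumes K: "K \<in> sets lebesgue" and D: "D \<in> sets lebesgue" and u: "u \<in> L2 (lebesgue_on K)"
  shows "(\<lambda>x. if x \<in> K then u x else 0) \<in> L2 (lebesgue_on D)"
proof -
  let ?v = "\<lambda>x. if x \<in> K then u x else 0"
  have "?v \<in> borel_measurable lebesgue"
    using u K by (simp add: L2_def borel_measurable_if)
  moreover have "(\<lambda>x. (norm (?v x))\<^sup>2) = (\<lambda>x. if x \<in> K then (norm (u x))\<^sup>2 else 0)" by auto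
  then have "integrable lebesgue (\<lambda>x. (norm (?v x))\<^sup>2)"
    using u K by (simp add: L2_def Lebesgue_Measure.integrable_restrict_UNIV)
  ultimately have "?v \<in> L2 (lebesgue_on UNIV)" by (simp add: L2_def lebesgue_on_UNIV_eq)
  then show ?thesis by (rule L2_subset_AE[rotated -1]) (use D in auto)
qed

context mesh
begin

definition faces :: "(real^'d) set set" where
  "faces = (\<Union>K\<in>\<T>. facets K)"

lemma finite_faces: "finite faces"
  unfolding faces_def using fin finite_facets by blast

lemma AE_unique_cell: "J \<in> \<T> \<Longrightarrow> AE x in lebesgue_on J. \<forall>K\<in>\<T>. x \<in> K \<longleftrightarrow> K = J"
proof -
  assume J: "J \<in> \<T>"
  have "negligible (\<Union>K\<in>\<T>. frontier K)"
    using fin negligible_frontier_cell by (intro negligible_Union) auto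
  then have "negligible {x \<in> J. \<not> (\<forall>K\<in>\<T>. x \<in> K \<longleftrightarrow> K = J)}"
  proof (rule negligible_subset)
    show "{x \<in> J. \<not> (\<forall>K\<in>\<T>. x \<in> K \<longleftrightarrow> K = J)} \<subseteq> (\<Union>K\<in>\<T>. frontier K)"
    proof
      fix x assume "x \<in> {x \<in> J. \<not> (\<forall>K\<in>\<T>. x \<in> K \<longleftrightarrow> K = J)}"
      then obtain K where x: "x \<in> J" "K \<in> \<T>" "x \<in> K" "K \<noteq> J" by auto
      then have "x \<notin> interior K \<or> x \<notin> interior J" using cell_disjoint[OF x(2) J x(4)] by blast
      then show "x \<in> (\<Union>K\<in>\<T>. frontier K)"
        using x J closure_subset by (auto simp: frontier_def)
    qed
  qed
  then show ?thesis by (simp add: AE_lebesgue_on_iff_negligible lebesgue_cell[OF J])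
qed

text \<open>The zero extensions are simply added; where cells overlap the sum is wrong, but only on
  a null set.\<close>

lemma glue_cells:
  fixes u :: "(real^'d) set \<Rightarrow> real^'d \<Rightarrow> 'b::euclidean_space"
  assumes "\<And>K. K \<in> \<T> \<Longrightarrow> u K \<in> L2 (lebesgue_on K)"
  shows "\<exists>v\<in>L2 (lebesgue_on \<Omega>). \<forall>K\<in>\<T>. AE x in lebesgue_on K. v x = u K x"
proof -
  define v where "v x = (\<Sum>K\<in>\<T>. if x \<in> K then u K x else 0)" for x
  have "v \<in> L2 (lebesgue_on \<Omega>)"
    unfolding v_def by (intro L2_sum L2_extend_zero lebesgue_cell lebesgue_domain assms)
  moreover have "AE x in lebesgue_on J. v x = u J x" if J: "J \<in> \<T>" for J
  proof -
    have "AE x in lebesgue_on J. \<forall>K\<in>\<T>. x \<in> K \<longleftrightarrow> K = J" by (rule AE_unique_cell[OF J])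
    then show ?thesis
    proof eventually_elim
      case (elim x)
      have "v x = (\<Sum>K\<in>\<T>. if K = J then u J x else 0)"
        unfolding v_def by (rule sum.cong) (use elim in auto)
      then show ?case using J fin by simp
    qed
  qed
  ultimately show ?thesis by blast
qed

lemma L2_cell:
  fixes u :: "real^'d \<Rightarrow> 'b::euclidean_space"
  assumes "u \<in> L2 (lebesgue_on \<Omega>)" "K \<in> \<T>"
  shows "u \<in> L2 (lebesgue_on K)"
  using L2_subset_AE[OF lebesgue_domain lebesgue_cell negligible_cell_diff_domain] assms by blast

lemma l2_inner_cells:
  fixes u v :: "real^'d \<Rightarrow> 'b::euclidean_space"
  assumes "\<And>K. K \<in> \<T> \<Longrightarrow> u \<in> L2 (lebesgue_on K)" "\<And>K. K \<in> \<T> \<Longrightarrow> v \<in> L2 (lebesgue_on K)"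
  shows "l2_inner \<Omega> u v = (\<Sum>K\<in>\<T>. l2_inner K u v)"
  unfolding l2_inner_def
  by (rule integral_lebesgue_on_partition(2)[OF lebesgue_domain fin lebesgue_cell cells_partition_domain])
    (use assms in \<open>auto intro!: L2_inner_integrable\<close>)

lemma measure_cell_pos: "K \<in> \<T> \<Longrightarrow> 0 < measure lebesgue K"
  using negligible_iff_measure0[OF lmeasurable_cell] negligible_convex_interior[OF cell_convex]
    cell_interior zero_less_measure_iff by blast

lemma C1_L2_cell:
  assumes "C1_with_gradient w G" "K \<in> \<T>"
  shows "w \<in> L2 (lebesgue_on K)" "G \<in> L2 (lebesgue_on K)"
  using L2_continuous[OF C1_continuous(1)[OF assms(1)] cell_compact[OF assms(2)]]
    L2_continuous[OF C1_continuous(2)[OF assms(1)] cell_compact[OF assms(2)]] by auto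

lemma facet_flat_face:
  assumes "K \<in> \<T>" "e \<in> facets K"
  obtains n c where "flat_face e n c"
  by (rule facet_flat[OF assms]) blast

lemma cell_weak_div_unique:
  "K \<in> \<T> \<Longrightarrow> has_weak_div K u g \<Longrightarrow> has_weak_div K u g' \<Longrightarrow> AE x in lebesgue_on K. g x = g' x"
  by (rule has_weak_div_unique[OF lmeasurable_cell negligible_cell_diff_interior])

text \<open>Green's formula mixes all facets. Test functions with a polynomial factor that vanishes
  on the other facets isolate \<open>e\<close>, so all polynomial moments of the weighted difference
  vanish on \<open>e\<close>; the weight is nonzero almost everywhere there.\<close>

lemma normal_trace_unique:
  assumes K: "K \<in> \<T>" and g: "has_normal_trace K u g" and h: "has_normal_trace K u h"
    and e: "e \<in> facets K"
  shows "AE y in face_measure e. g e y = h e y"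
proof -
  obtain n0 c0 where "flat_face e n0 c0" by (rule facet_flat_face[OF K e])
  then interpret flat_face e n0 c0 .
  have L2: "g e' \<in> L2 (face_measure e')" "h e' \<in> L2 (face_measure e')" if "e' \<in> facets K" for e'
    using g h that by (auto simp: has_normal_trace_def)
  have intg: "integrable (face_measure e) (\<lambda>y. g e y * w y)" "integrable (face_measure e) (\<lambda>y. h e y * w y)"
    if "continuous_on UNIV w" for w
    using L2_inner_integrable[OF L2(1)[OF e] L2_continuous_face[OF that]]
      L2_inner_integrable[OF L2(2)[OF e] L2_continuous_face[OF that]] by auto
  obtain dv dv' where dv: "has_weak_div K u dv" "has_weak_div K u dv'"
    and gr: "\<And>w G. C1_with_gradient w G \<Longrightarrow> l2_inner K u G + l2_inner K dv w =
        (\<Sum>e\<in>facets K. LINT y|face_measure e. g e y * w y)"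
      "\<And>w G. C1_with_gradient w G \<Longrightarrow> l2_inner K u G + l2_inner K dv' w =
        (\<Sum>e\<in>facets K. LINT y|face_measure e. h e y * w y)"
    using g h unfolding has_normal_trace_def by blast
  have eq: "(\<Sum>e\<in>facets K. LINT y|face_measure e. g e y * w y) =
      (\<Sum>e\<in>facets K. LINT y|face_measure e. h e y * w y)" if "C1_with_gradient w G" for w G
  proof -
    have "l2_inner K dv w = l2_inner K dv' w"
      by (rule l2_inner_cong_AE[OF lebesgue_cell[OF K] _ C1_L2_cell(1)[OF that K] cell_weak_div_unique[OF K dv]])
        (use dv in \<open>auto simp: has_weak_div_def\<close>)
    then show ?thesis using gr[OF that] by simp
  qed
  have "\<exists>c. flat_facet K e' (outward_normal K e') c" if "e' \<in> facets K" for e'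
    by (rule facet_flat[OF K that]) blast
  then obtain c where c: "\<And>e'. e' \<in> facets K \<Longrightarrow> flat_facet K e' (outward_normal K e') (c e')" by metis
  \<comment> \<open>Each factor vanishes on the hyperplane of one other facet, and no such
    hyperplane meets the relative interior of \<open>e\<close>.\<close>
  define w0 where "w0 y = (\<Prod>e'\<in>facets K - {e}. outward_normal K e' \<bullet> y - c e')" for y
  have w0_poly: "real_polynomial_function w0"
    unfolding w0_def
  proof (rule real_polynomial_function_prod)
    fix e' assume "e' \<in> facets K - {e}"
    show "real_polynomial_function (\<lambda>y. outward_normal K e' \<bullet> y - c e')"
      by (intro real_polynomial_function_diff real_polynomial_function.intros(1,2) bounded_linear_inner_right)
  qed (use finite_facets[OF K] in simp)
  have w0_zero: "w0 y = 0" if "e' \<in> facets K" "e' \<noteq> e" "y \<in> e'" for e' y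
    unfolding w0_def
    by (rule prod_zero[OF _ bexI[of _ e']])
      (use that c[OF that(1)] finite_facets[OF K] in \<open>auto simp: flat_facet_def\<close>)
  have w0_nz: "w0 y \<noteq> 0" if y: "y \<in> rel_interior e" for y
  proof
    assume "w0 y = 0"
    then obtain e' where e': "e' \<in> facets K" "e' \<noteq> e" "outward_normal K e' \<bullet> y = c e'"
      using finite_facets[OF K] by (auto simp: w0_def)
    have "y \<in> K" using y rel_interior_subset facetD(8)[OF K e] by blast
    then have "y \<in> e'" using e'(3) c[OF e'(1)] by (auto simp: flat_facet_def)
    then show False using facet_unique[OF K e K e'(1) y] e'(2) by simp
  qed
  have contw0: "continuous_on UNIV w0"
    using C1_real_polynomial_function[OF w0_poly] C1_continuous by blast
  have "AE y in face_measure e. (g e y - h e y) * w0 y = 0"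
  proof (rule AE_zero_if_polynomial_moments_zero[OF compact sets_face_measure])
    show "integrable (face_measure e) (\<lambda>y. (g e y - h e y) * w0 y)"
      unfolding left_diff_distrib using intg[OF contw0] by (rule Bochner_Integration.integrable_diff)
    fix P :: "real^'d \<Rightarrow> real" assume P: "real_polynomial_function P"
    have wP: "real_polynomial_function (\<lambda>y. w0 y * P y)"
      by (rule real_polynomial_function.intros(4)[OF w0_poly P])
    then obtain G where G: "C1_with_gradient (\<lambda>y. w0 y * P y) G"
      using C1_real_polynomial_function by blast
    have only_e: "(\<Sum>e\<in>facets K. LINT y|face_measure e. k e y * (w0 y * P y)) =
        (LINT y|face_measure e. k e y * (w0 y * P y))" for k :: "(real^'d) set \<Rightarrow> real^'d \<Rightarrow> real"
    proof -
      have "(LINT y|face_measure e'. k e' y * (w0 y * P y)) = 0" if e': "e' \<in> facets K - {e}" for e'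
      proof -
        obtain n c where "flat_face e' n c" by (rule facet_flat_face[OF K DiffD1[OF e']])
        then have "space (face_measure e') = e'" by (rule flat_face.space_face_measure)
        then have "(LINT y|face_measure e'. k e' y * (w0 y * P y)) = (LINT y|face_measure e'. 0)"
          using w0_zero e' by (intro Bochner_Integration.integral_cong) auto
        then show ?thesis by simp
      qed
      then show ?thesis using finite_facets[OF K] e by (subst sum.remove[of _ e]) auto
    qed
    have i: "integrable (face_measure e) (\<lambda>y. g e y * (w0 y * P y))"
      "integrable (face_measure e) (\<lambda>y. h e y * (w0 y * P y))"
      by (rule intg[OF C1_continuous(1)[OF G]])+
    have "(LINT y|face_measure e. (g e y - h e y) * w0 y * P y) =
        (LINT y|face_measure e. g e y * (w0 y * P y) - h e y * (w0 y * P y))"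
      by (simp add: algebra_simps)
    also have "\<dots> = 0"
      using eq[OF G] i unfolding only_e by simp
    finally show "(LINT y|face_measure e. (g e y - h e y) * w0 y * P y) = 0" .
  qed
  with AE_rel_interior show ?thesis
    by eventually_elim (use w0_nz in auto)
qed

lemma normal_trace_eq:
  assumes "K \<in> \<T>" "has_normal_trace K u g"
  shows "has_normal_trace K u (normal_trace K u)"
    "\<And>e. e \<in> facets K \<Longrightarrow> AE y in face_measure e. normal_trace K u e y = g e y"
proof -
  show *: "has_normal_trace K u (normal_trace K u)"
    unfolding normal_trace_def by (rule someI[of "has_normal_trace K u", OF assms(2)])
  show "\<And>e. e \<in> facets K \<Longrightarrow> AE y in face_measure e. normal_trace K u e y = g e y"
    by (rule normal_trace_unique[OF assms(1) * assms(2)])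
qed

lemma has_normal_trace_cong_AE:
  assumes K: "K \<in> \<T>" and t: "has_normal_trace K u g" and ae: "AE x in lebesgue_on K. u x = u' x"
  shows "has_normal_trace K u' g"
proof -
  obtain dv where dv: "has_weak_div K u dv" and gr: "\<And>w G. C1_with_gradient w G \<Longrightarrow>
      l2_inner K u G + l2_inner K dv w = (\<Sum>e\<in>facets K. LINT y|face_measure e. g e y * w y)"
    using t unfolding has_normal_trace_def by blast
  show ?thesis
    unfolding has_normal_trace_def
  proof (intro conjI exI[of _ dv] allI impI)
    show "\<forall>e\<in>facets K. g e \<in> L2 (face_measure e)" using t by (simp add: has_normal_trace_def)
    show "has_weak_div K u' dv"
      by (rule has_weak_div_cong_AE[OF lmeasurable_cell[OF K] dv ae]) simp
    fix w :: "real^'d \<Rightarrow> real" and G assume C1: "C1_with_gradient w G"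
    have "l2_inner K u G = l2_inner K u' G"
      by (rule l2_inner_cong_AE[OF lebesgue_cell[OF K] _ C1_L2_cell(2)[OF C1 K] ae])
        (use dv in \<open>auto simp: has_weak_div_def\<close>)
    then show "l2_inner K u' G + l2_inner K dv w = (\<Sum>e\<in>facets K. LINT y|face_measure e. g e y * w y)"
      using gr[OF C1] by simp
  qed
qed

end

section \<open>Multiscale fields on one cell\<close>

locale multiscale_mesh = mesh \<Omega> \<T>
  for \<Omega> :: "(real^'d) set" and \<T> +
  fixes k :: "real^'d \<Rightarrow> real^'d^'d" and kmin :: real
    and basis \<eta> \<psi> :: "(real^'d) set \<Rightarrow> (real^'d) set \<Rightarrow> real^'d \<Rightarrow> real^'d"
    and \<phi> :: "(real^'d) set \<Rightarrow> (real^'d) set \<Rightarrow> real^'d \<Rightarrow> real"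
  assumes kmin: "0 < kmin"
    and coercive: "\<And>x \<zeta>. x \<in> \<Omega> \<Longrightarrow> kmin * (norm \<zeta>)\<^sup>2 \<le> \<zeta> \<bullet> (k x *v \<zeta>)"
    and basis: "\<And>K e. K \<in> \<T> \<Longrightarrow> e \<in> facets K \<Longrightarrow> RT0_basis K e (basis K e)"
    and local: "\<And>K e. K \<in> \<T> \<Longrightarrow> e \<in> facets K \<Longrightarrow>
           local_solution k K (basis K e) (\<eta> K e) (\<psi> K e) (\<phi> K e)"
begin

abbreviation \<psi>comb :: "(real^'d) set \<Rightarrow> ((real^'d) set \<Rightarrow> real) \<Rightarrow> real^'d \<Rightarrow> real^'d" where
  "\<psi>comb K c \<equiv> \<lambda>x. \<Sum>e\<in>facets K. c e *\<^sub>R \<psi> K e x"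

abbreviation \<eta>comb :: "(real^'d) set \<Rightarrow> ((real^'d) set \<Rightarrow> real) \<Rightarrow> real^'d \<Rightarrow> real^'d" where
  "\<eta>comb K c \<equiv> \<lambda>x. \<Sum>e\<in>facets K. c e *\<^sub>R \<eta> K e x"

abbreviation vol :: "(real^'d) set \<Rightarrow> real" where
  "vol K \<equiv> measure lebesgue K"

lemma \<psi>_L2: "K \<in> \<T> \<Longrightarrow> e \<in> facets K \<Longrightarrow> \<psi> K e \<in> L2 (lebesgue_on K)"
  and \<eta>_L2: "K \<in> \<T> \<Longrightarrow> e \<in> facets K \<Longrightarrow> \<eta> K e \<in> L2 (lebesgue_on K)"
  and \<psi>_k\<eta>: "K \<in> \<T> \<Longrightarrow> e \<in> facets K \<Longrightarrow> AE x in lebesgue_on K. \<psi> K e x + k x *v \<eta> K e x = 0"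
  using local unfolding local_solution_def by blast+

lemma comb_L2:
  assumes "K \<in> \<T>"
  shows "\<psi>comb K c \<in> L2 (lebesgue_on K)" "\<eta>comb K c \<in> L2 (lebesgue_on K)"
  by (intro L2_sum L2_scaleR \<psi>_L2 \<eta>_L2 assms; assumption)+

lemma comb_k:
  assumes K: "K \<in> \<T>"
  shows "AE x in lebesgue_on K. k x *v \<eta>comb K c x = - \<psi>comb K c x"
proof -
  have "AE x in lebesgue_on K. \<forall>e\<in>facets K. \<psi> K e x + k x *v \<eta> K e x = 0"
    using \<psi>_k\<eta>[OF K] finite_facets[OF K] by (simp add: AE_finite_all)
  then show ?thesis
  proof eventually_elim
    case (elim x)
    have "k x *v \<eta>comb K c x = (\<Sum>e\<in>facets K. c e *\<^sub>R (k x *v \<eta> K e x))"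
      by (simp add: linear_sum[OF matrix_vector_mul_linear] matrix_vector_mult_scaleR)
    also have "\<dots> = (\<Sum>e\<in>facets K. c e *\<^sub>R (- \<psi> K e x))"
      using elim by (intro sum.cong refl) (metis add_eq_0_iff)
    finally show ?case by (simp add: sum_negf)
  qed
qed

text \<open>The divergence shared with \<open>basis K e\<close> must agree a.e. with the constant
  prescribed for the Raviart-Thomas function.\<close>

lemma \<psi>_div:
  assumes "K \<in> \<T>" "e \<in> facets K"
  shows "has_weak_div K (\<psi> K e) (\<lambda>_. 1 / vol K)"
proof -
  obtain g where g: "has_weak_div K (basis K e) g" "has_weak_div K (\<psi> K e) g"
    using local[OF assms] unfolding local_solution_def by blast
  have "AE x in lebesgue_on K. g x = 1 / vol K"
    by (rule cell_weak_div_unique[OF assms(1) g(1)]) (use basis[OF assms] in \<open>simp add: RT0_basis_def\<close>)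
  then show ?thesis
    by (intro has_weak_div_cong_AE[OF lmeasurable_cell[OF assms(1)] g(2)]) simp
qed

text \<open>Divergence and traces are inherited from the Raviart-Thomas function, where they are
  constants, so the coefficient k enters only through the first term.\<close>

lemma green_basis:
  assumes K: "K \<in> \<T>" and e: "e \<in> facets K" and C1: "C1_with_gradient w G"
  shows "l2_inner K (\<psi> K e) G + 1 / vol K * (LINT x|lebesgue_on K. w x) =
    1 / face_area e * (LINT y|face_measure e. w y)"
proof -
  let ?g = "\<lambda>e' y. basis K e y \<bullet> outward_normal K e'"
  have b: "?g e' y = (if e' = e then 1 / face_area e else 0)" if "e' \<in> facets K" "y \<in> e'" for e' y
    using basis[OF K e] that by (simp add: RT0_basis_def)
  have "has_normal_trace K (\<psi> K e) ?g" using local[OF K e] by (simp add: local_solution_def)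
  then obtain dv where dv: "has_weak_div K (\<psi> K e) dv"
    and gr: "l2_inner K (\<psi> K e) G + l2_inner K dv w = (\<Sum>e'\<in>facets K. LINT y|face_measure e'. ?g e' y * w y)"
    using C1 unfolding has_normal_trace_def by blast
  have "l2_inner K dv w = l2_inner K (\<lambda>_. 1 / vol K) w"
    by (rule l2_inner_cong_AE[OF lebesgue_cell[OF K] _ C1_L2_cell(1)[OF C1 K] cell_weak_div_unique[OF K dv \<psi>_div[OF K e]]])
      (use dv in \<open>auto simp: has_weak_div_def\<close>)
  also have "\<dots> = 1 / vol K * (LINT x|lebesgue_on K. w x)" by (simp add: l2_inner_def)
  finally have lhs: "l2_inner K dv w = 1 / vol K * (LINT x|lebesgue_on K. w x)" .
  have "(LINT y|face_measure e'. ?g e' y * w y) =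
      (if e' = e then 1 / face_area e * (LINT y|face_measure e. w y) else 0)" if e': "e' \<in> facets K" for e'
  proof -
    obtain n c where "flat_face e' n c" by (rule facet_flat_face[OF K e'])
    then have "space (face_measure e') = e'" by (rule flat_face.space_face_measure)
    then have "(LINT y|face_measure e'. ?g e' y * w y) =
        (LINT y|face_measure e'. (if e' = e then 1 / face_area e else 0) * w y)"
      using b[OF e'] by (intro Bochner_Integration.integral_cong) auto
    then show ?thesis by simp
  qed
  then have "(\<Sum>e'\<in>facets K. LINT y|face_measure e'. ?g e' y * w y) =
      1 / face_area e * (LINT y|face_measure e. w y)"
    using finite_facets[OF K] e by simp
  with gr lhs show ?thesis by simp
qed

text \<open>The constant test function turns Green's formula into \<open>1 = |e| / |e|\<close>, which would fail for
  \<open>|e| = 0\<close>.\<close>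

lemma face_area_pos:
  assumes "K \<in> \<T>" "e \<in> facets K"
  shows "0 < face_area e"
proof -
  have "1 / vol K * (LINT x|lebesgue_on K. (1::real)) = 1 / face_area e * (LINT y|face_measure e. 1)"
    using green_basis[OF assms C1_const[of 1]] by (simp add: l2_inner_def)
  moreover have "(LINT x|lebesgue_on K. (1::real)) = vol K"
    using lebesgue_cell[OF assms(1)] by (simp add: measure_restrict_space)
  ultimately have "face_area e \<noteq> 0" using measure_cell_pos[OF assms(1)] by auto
  then show ?thesis by (simp add: face_area_def zero_less_measure_iff)
qed

lemma comb_div:
  assumes K: "K \<in> \<T>"
  shows "has_weak_div K (\<psi>comb K c) (\<lambda>_. (\<Sum>e\<in>facets K. c e) / vol K)"
  using has_weak_div_sum[OF lmeasurable_cell[OF K] \<psi>_div[OF K], of "facets K" "\<lambda>e. e" c]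
  by (simp add: sum_divide_distrib)

lemma green_comb:
  assumes K: "K \<in> \<T>" and C1: "C1_with_gradient w G"
  shows "l2_inner K (\<psi>comb K c) G + (\<Sum>e\<in>facets K. c e) / vol K * (LINT x|lebesgue_on K. w x) =
    (\<Sum>e\<in>facets K. c e / face_area e * (LINT y|face_measure e. w y))"
proof -
  have "l2_inner K (\<psi>comb K c) G = (\<Sum>e\<in>facets K. c e * l2_inner K (\<psi> K e) G)"
    by (rule l2_inner_sum_left[OF \<psi>_L2[OF K] C1_L2_cell(2)[OF C1 K]])
  also have "\<dots> = (\<Sum>e\<in>facets K. c e / face_area e * (LINT y|face_measure e. w y) -
      c e / vol K * (LINT x|lebesgue_on K. w x))"
  proof (rule sum.cong[OF refl])
    fix e assume e: "e \<in> facets K"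
    have "l2_inner K (\<psi> K e) G = 1 / face_area e * (LINT y|face_measure e. w y) - 1 / vol K * (LINT x|lebesgue_on K. w x)"
      using green_basis[OF K e C1] by linarith
    then show "c e * l2_inner K (\<psi> K e) G = c e / face_area e * (LINT y|face_measure e. w y) -
      c e / vol K * (LINT x|lebesgue_on K. w x)" by (simp add: right_diff_distrib)
  qed
  finally show ?thesis
    by (simp add: sum_subtractf sum_distrib_right sum_divide_distrib)
qed

text \<open>Here \<open>c e\<close> appears as the total outward flux through \<open>e\<close>,
  spread evenly over the area of \<open>e\<close>.\<close>

lemma comb_trace:
  assumes K: "K \<in> \<T>" and ae: "AE x in lebesgue_on K. u x = \<psi>comb K c x"
  shows "has_normal_trace K u (\<lambda>e y. c e / face_area e)"
proof -
  have "has_normal_trace K (\<psi>comb K c) (\<lambda>e y. c e / face_area e)"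
    unfolding has_normal_trace_def
  proof (intro conjI ballI exI[of _ "\<lambda>_. (\<Sum>e\<in>facets K. c e) / vol K"] allI impI)
    fix e assume e: "e \<in> facets K"
    obtain n a where "flat_face e n a" by (rule facet_flat_face[OF K e])
    then show "(\<lambda>y. c e / face_area e) \<in> L2 (face_measure e)"
      by (rule flat_face.L2_continuous_face) (rule continuous_on_const)
  next
    fix w :: "real^'d \<Rightarrow> real" and G assume C1: "C1_with_gradient w G"
    show "l2_inner K (\<psi>comb K c) G + l2_inner K (\<lambda>_. (\<Sum>e\<in>facets K. c e) / vol K) w =
        (\<Sum>e\<in>facets K. LINT y|face_measure e. c e / face_area e * w y)"
      using green_comb[OF K C1, of c] by (simp add: l2_inner_def)
  qed (rule comb_div[OF K])
  then show ?thesis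
    by (rule has_normal_trace_cong_AE[OF K]) (use ae in eventually_elim, simp)
qed

text \<open>Faces have positive surface measure, so an a.e. statement about constants is not
  vacuous.\<close>

lemma AE_face_const_imp_eq:
  assumes "K \<in> \<T>" "e \<in> facets K" "AE y in face_measure e. a = (b::'z)"
  shows "a = b"
proof (rule ccontr)
  assume "a \<noteq> b"
  with assms(3) have "AE y in face_measure e. False" by simp
  then have "emeasure (face_measure e) (space (face_measure e)) = 0"
    using emeasure_eq_0_AE[of "\<lambda>_. True" "face_measure e"] by simp
  moreover obtain n c where "flat_face e n c" by (rule facet_flat_face[OF assms(1,2)])
  then have "space (face_measure e) = e" by (rule flat_face.space_face_measure)
  ultimately show False using face_area_pos[OF assms(1,2)] by (simp add: face_area_def measure_def)
qed

text \<open>Linear independence of the \<psi> in a cell: the zero field has the traces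
  \<open>c e / face_area e\<close> as well as zero, and traces are unique.\<close>

lemma comb_eq_zero:
  assumes K: "K \<in> \<T>" and ae: "AE x in lebesgue_on K. \<psi>comb K c x = 0" and e: "e \<in> facets K"
  shows "c e = 0"
proof -
  have 1: "has_normal_trace K (\<lambda>_. 0) (\<lambda>e y. c e / face_area e)"
    by (rule comb_trace[OF K]) (use ae in eventually_elim, simp)
  have 2: "has_normal_trace K (\<lambda>_. 0) (\<lambda>e y. (\<lambda>_. 0) e / face_area e)"
    by (rule comb_trace[OF K]) simp
  have "AE y in face_measure e. c e / face_area e = 0 / face_area e"
    using normal_trace_unique[OF K 1 2 e] by simp
  then have "c e / face_area e = 0 / face_area e" by (rule AE_face_const_imp_eq[OF K e])
  then show ?thesis using face_area_pos[OF K e] by simp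
qed

end

subsection \<open>Conformity\<close>


context multiscale_mesh
begin

text \<open>Coefficients are indexed by cell and facet, so an interior face carries two, one from
  each side. The family \<open>b\<close> is a parameter so that an \<eta>-field and a \<psi>-field
  can share coefficients.\<close>

definition represents ::
    "((real^'d) set \<Rightarrow> (real^'d) set \<Rightarrow> real^'d \<Rightarrow> real^'d) \<Rightarrow>
     ((real^'d) set \<Rightarrow> (real^'d) set \<Rightarrow> real) \<Rightarrow> (real^'d \<Rightarrow> real^'d) \<Rightarrow> bool" where
  "represents b c v \<longleftrightarrow> v \<in> L2 (lebesgue_on \<Omega>) \<and>
     (\<forall>K\<in>\<T>. AE x in lebesgue_on K. v x = (\<Sum>e\<in>facets K. c K e *\<^sub>R b K e x))"

lemma multiscale_space_iff: "v \<in> multiscale_space \<Omega> \<T> b \<longleftrightarrow> (\<exists>c. represents b c v)"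
proof
  assume v: "v \<in> multiscale_space \<Omega> \<T> b"
  then have "\<forall>K\<in>\<T>. \<exists>c. AE x in lebesgue_on K. v x = (\<Sum>e\<in>facets K. c e *\<^sub>R b K e x)"
    by (simp add: multiscale_space_def)
  from bchoice[OF this] show "\<exists>c. represents b c v"
    using v by (auto simp: represents_def multiscale_space_def)
qed (auto simp: represents_def multiscale_space_def)

lemma representsD:
  assumes "represents b c v"
  shows "v \<in> L2 (lebesgue_on \<Omega>)"
    "K \<in> \<T> \<Longrightarrow> AE x in lebesgue_on K. v x = (\<Sum>e\<in>facets K. c K e *\<^sub>R b K e x)"
  using assms by (auto simp: represents_def)

lemma represents_cong:
  assumes "represents b c v" "\<And>K e. K \<in> \<T> \<Longrightarrow> e \<in> facets K \<Longrightarrow> c K e = c' K e"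
  shows "represents b c' v"
  unfolding represents_def
proof (intro conjI ballI)
  fix K assume K: "K \<in> \<T>"
  have "(\<Sum>e\<in>facets K. c K e *\<^sub>R b K e x) = (\<Sum>e\<in>facets K. c' K e *\<^sub>R b K e x)" for x
    by (rule sum.cong) (simp_all add: assms(2)[OF K])
  with representsD(2)[OF assms(1) K]
  show "AE x in lebesgue_on K. v x = (\<Sum>e\<in>facets K. c' K e *\<^sub>R b K e x)" by simp
qed (rule representsD(1)[OF assms(1)])

lemma represents_AE_eq:
  assumes "represents b c v" "represents b c' v'"
    and "\<And>K e. K \<in> \<T> \<Longrightarrow> e \<in> facets K \<Longrightarrow> c K e = c' K e"
  shows "AE x in lebesgue_on \<Omega>. v x = v' x"
  unfolding AE_domain_iff
proof
  have v: "represents b c' v" by (rule represents_cong[OF assms(1)]) (rule assms(3))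
  fix K assume K: "K \<in> \<T>"
  show "AE x in lebesgue_on K. v x = v' x"
    using representsD(2)[OF v K] representsD(2)[OF assms(2) K] by eventually_elim simp
qed

lemma represents_exists:
  obtains \<theta> u where "represents \<eta> c \<theta>" "represents \<psi> c u"
proof -
  have "\<exists>u\<in>L2 (lebesgue_on \<Omega>). \<forall>K\<in>\<T>. AE x in lebesgue_on K. u x = \<psi>comb K (c K) x"
    by (rule glue_cells) (rule comb_L2(1))
  moreover have "\<exists>\<theta>\<in>L2 (lebesgue_on \<Omega>). \<forall>K\<in>\<T>. AE x in lebesgue_on K. \<theta> x = \<eta>comb K (c K) x"
    by (rule glue_cells) (rule comb_L2(2))
  ultimately show thesis using that unfolding represents_def by blast
qed

text \<open>As \<open>c K e\<close> is an outward flux, summing over the adjacent cells gives the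
  jump of the normal flux across an interior face; on a boundary face it is the flux leaving the
  domain.\<close>

definition flux :: "((real^'d) set \<Rightarrow> (real^'d) set \<Rightarrow> real) \<Rightarrow> (real^'d) set \<Rightarrow> real" where
  "flux c e = (\<Sum>K | K \<in> \<T> \<and> e \<in> facets K. c K e)"

definition balanced :: "((real^'d) set \<Rightarrow> (real^'d) set \<Rightarrow> real) \<Rightarrow> bool" where
  "balanced c \<longleftrightarrow> (\<forall>e\<in>interior_faces \<Omega> \<T>. flux c e = 0)"

lemma sum_faces:
  "(\<Sum>K\<in>\<T>. \<Sum>e\<in>facets K. c K e * m e) = (\<Sum>e\<in>faces. flux c e * m e)"
proof -
  have "(\<Sum>K\<in>\<T>. \<Sum>e\<in>facets K. c K e * m e) = (\<Sum>K\<in>\<T>. \<Sum>e | e \<in> faces \<and> e \<in> facets K. c K e * m e)"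
    by (intro sum.cong refl) (auto simp: faces_def)
  also have "\<dots> = (\<Sum>e\<in>faces. \<Sum>K | K \<in> \<T> \<and> e \<in> facets K. c K e * m e)"
    by (rule sum.swap_restrict[OF fin finite_faces])
  finally show ?thesis by (simp add: flux_def sum_distrib_right)
qed

lemma faces_cases:
  assumes "e \<in> faces"
  obtains "e \<in> interior_faces \<Omega> \<T>" "\<not> e \<subseteq> frontier \<Omega>"
    | "e \<in> boundary_faces \<Omega> \<T>" "e \<subseteq> frontier \<Omega>"
  using assms by (auto simp: faces_def interior_faces_def boundary_faces_def)

lemma interior_face_in_faces: "e \<in> interior_faces \<Omega> \<T> \<Longrightarrow> e \<in> faces"
  by (simp add: interior_faces_def faces_def)

lemma finite_interior_faces: "finite (interior_faces \<Omega> \<T>)"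
  by (rule finite_subset[OF _ finite_faces]) (auto dest: interior_face_in_faces)

lemma interior_faceE:
  assumes "e \<in> interior_faces \<Omega> \<T>"
  obtains K where "K \<in> \<T>" "e \<in> facets K" "\<not> e \<subseteq> frontier \<Omega>"
  using assms by (auto simp: interior_faces_def)

text \<open>When the cellwise formulas are added, the contributions from the two sides of a face
  combine into its flux jump, weighted by the mean of \<open>w\<close> on the face.\<close>

lemma green_domain:
  assumes u: "represents \<psi> c u" and C1: "C1_with_gradient w G"
  shows "l2_inner \<Omega> u G + (\<Sum>K\<in>\<T>. (\<Sum>e\<in>facets K. c K e) / vol K * (LINT x|lebesgue_on K. w x)) =
    (\<Sum>e\<in>faces. flux c e * ((LINT y|face_measure e. w y) / face_area e))"
proof -
  have "l2_inner \<Omega> u G = (\<Sum>K\<in>\<T>. l2_inner K u G)"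
    by (intro l2_inner_cells L2_cell[OF representsD(1)[OF u]] C1_L2_cell(2)[OF C1])
  also have "\<dots> = (\<Sum>K\<in>\<T>. l2_inner K (\<psi>comb K (c K)) G)"
    by (intro sum.cong refl l2_inner_cong_AE lebesgue_cell L2_cell[OF representsD(1)[OF u]]
        C1_L2_cell(2)[OF C1] representsD(2)[OF u]) simp_all
  finally have "l2_inner \<Omega> u G + (\<Sum>K\<in>\<T>. (\<Sum>e\<in>facets K. c K e) / vol K * (LINT x|lebesgue_on K. w x)) =
      (\<Sum>K\<in>\<T>. l2_inner K (\<psi>comb K (c K)) G + (\<Sum>e\<in>facets K. c K e) / vol K * (LINT x|lebesgue_on K. w x))"
    by (simp only: sum.distrib)
  also have "\<dots> = (\<Sum>K\<in>\<T>. \<Sum>e\<in>facets K. c K e / face_area e * (LINT y|face_measure e. w y))"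
    by (rule sum.cong[OF refl green_comb[OF _ C1]])
  also have "\<dots> = (\<Sum>K\<in>\<T>. \<Sum>e\<in>facets K. c K e * ((LINT y|face_measure e. w y) / face_area e))"
    by (simp add: mult.commute)
  finally show ?thesis by (simp only: sum_faces)
qed

text \<open>Test functions vanish on boundary faces, and balance removes the interior ones. No
  surface term is left, so the cellwise divergences glue to a global one.\<close>

lemma balanced_imp_Hdiv:
  assumes u: "represents \<psi> c u" and c: "balanced c"
  shows "u \<in> Hdiv \<Omega>"
proof -
  let ?d = "\<lambda>K. (\<Sum>e\<in>facets K. c K e) / vol K"
  have "\<exists>g\<in>L2 (lebesgue_on \<Omega>). \<forall>K\<in>\<T>. AE x in lebesgue_on K. g x = ?d K"
    by (rule glue_cells) (rule L2_continuous[OF continuous_on_const cell_compact])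
  then obtain g where g: "g \<in> L2 (lebesgue_on \<Omega>)" "\<And>K. K \<in> \<T> \<Longrightarrow> AE x in lebesgue_on K. g x = ?d K"
    by blast
  have "has_weak_div \<Omega> u g"
    unfolding has_weak_div_def
  proof (intro conjI allI impI representsD(1)[OF u] g(1))
    fix w G assume t: "test_function \<Omega> w G"
    then have C1: "C1_with_gradient w G" by (simp add: test_function_def)
    obtain S where S: "compact S" "S \<subseteq> interior \<Omega>" "\<And>x. x \<notin> S \<Longrightarrow> w x = 0" "\<And>x. x \<notin> S \<Longrightarrow> G x = 0"
      by (rule test_function_vanishes[OF t]) blast
    have "flux c e * ((LINT y|face_measure e. w y) / face_area e) = 0" if e: "e \<in> faces" for e
    proof (cases rule: faces_cases[OF e])
      case 1
      then show ?thesis using c by (simp add: balanced_def)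
    next
      case 2
      obtain K where K: "K \<in> \<T>" "e \<in> facets K" using e by (auto simp: faces_def)
      obtain n a where "flat_face e n a" by (rule facet_flat_face[OF K])
      then have sp: "space (face_measure e) = e" by (rule flat_face.space_face_measure)
      have "w y = 0" if "y \<in> e" for y
        using S(2,3) that 2 frontier_domain interior_subset by blast
      then have "(LINT y|face_measure e. w y) = (LINT y|face_measure e. 0)"
        using sp by (intro Bochner_Integration.integral_cong) auto
      then show ?thesis by simp
    qed
    then have "(\<Sum>e\<in>faces. flux c e * ((LINT y|face_measure e. w y) / face_area e)) = 0"
      by (intro sum.neutral) blast
    then have "l2_inner \<Omega> u G = - (\<Sum>K\<in>\<T>. ?d K * (LINT x|lebesgue_on K. w x))"
      using green_domain[OF u C1] by simp
    also have "(\<Sum>K\<in>\<T>. ?d K * (LINT x|lebesgue_on K. w x)) = (\<Sum>K\<in>\<T>. l2_inner K g w)"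
    proof (rule sum.cong[OF refl])
      fix K assume K: "K \<in> \<T>"
      have "l2_inner K g w = l2_inner K (\<lambda>_. ?d K) w"
        by (rule l2_inner_cong_AE[OF lebesgue_cell[OF K] L2_cell[OF g(1) K] C1_L2_cell(1)[OF C1 K] g(2)[OF K]]) simp
      then show "?d K * (LINT x|lebesgue_on K. w x) = l2_inner K g w" by (simp add: l2_inner_def)
    qed
    also have "\<dots> = l2_inner \<Omega> g w"
      by (intro l2_inner_cells[symmetric] L2_cell[OF g(1)] C1_L2_cell(1)[OF C1])
    finally show "l2_inner \<Omega> u G = - l2_inner \<Omega> g w" .
  qed
  then show ?thesis by (auto simp: Hdiv_def)
qed

lemma weak_div_cell:
  assumes u: "represents \<psi> c u" and K: "K \<in> \<T>"
  shows "has_weak_div K u (\<lambda>_. (\<Sum>e\<in>facets K. c K e) / vol K)"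
    "weak_div K u \<in> L2 (lebesgue_on K)"
    "AE x in lebesgue_on K. weak_div K u x = (\<Sum>e\<in>facets K. c K e) / vol K"
proof -
  have "AE x in lebesgue_on K. \<psi>comb K (c K) x = u x"
    using representsD(2)[OF u K] by eventually_elim simp
  then show w: "has_weak_div K u (\<lambda>_. (\<Sum>e\<in>facets K. c K e) / vol K)"
    by (rule has_weak_div_cong_AE[OF lmeasurable_cell[OF K] comb_div[OF K]]) simp
  note * = weak_div_eq[OF lmeasurable_cell[OF K] negligible_cell_diff_interior[OF K] w]
  show "weak_div K u \<in> L2 (lebesgue_on K)" using *(1) by (simp add: has_weak_div_def)
  show "AE x in lebesgue_on K. weak_div K u x = (\<Sum>e\<in>facets K. c K e) / vol K" by (rule *(2))
qed

lemma weak_div_domain: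
  assumes u: "represents \<psi> c u" and d: "has_weak_div \<Omega> u g" and K: "K \<in> \<T>"
  shows "AE x in lebesgue_on K. g x = (\<Sum>e\<in>facets K. c K e) / vol K"
proof (rule cell_weak_div_unique[OF K _ weak_div_cell(1)[OF u K]])
  show "has_weak_div K u g"
    by (rule has_weak_div_subset[OF lebesgue_domain lebesgue_cell[OF K] negligible_cell_diff_domain[OF K] _ d])
      (simp add: interior_maximal cell_interior_subset[OF K] interior_open open_domain)
qed

lemma integral_bump_face_pos:
  assumes K: "K \<in> \<T>" "e \<in> facets K" and y: "y \<in> rel_interior e" and r: "r > 0"
  shows "0 < (LINT x|face_measure e. bump y r x)"
proof -
  obtain n a where "flat_face e n a" by (rule facet_flat_face[OF K])
  then interpret flat_face e n a .
  have int: "integrable (face_measure e) (bump y r)"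
    by (rule L2_imp_integrable[OF finite_face_measure L2_continuous_face[OF C1_continuous(1)[OF C1_bump]]])
  have "(LINT x|face_measure e. bump y r x) \<noteq> 0"
  proof
    assume "(LINT x|face_measure e. bump y r x) = 0"
    then have "AE x in face_measure e. bump y r x = 0"
      using integral_nonneg_eq_0_iff_AE[OF int AE_I2[OF bump_nonneg]] by simp
    then have "AE x in face_measure e. \<not> x \<in> ball y r"
      by eventually_elim (use bump_pos[of _ y r] in force)
    then have "emeasure (face_measure e) {x \<in> space (face_measure e). x \<in> ball y r} = 0"
      by (rule emeasure_eq_0_AE)
    moreover have "{x \<in> space (face_measure e). x \<in> ball y r} = ball y r \<inter> e"
      by (auto simp: space_face_measure)
    ultimately show False using face_measure_ball_pos[OF y r] by simp
  qed
  moreover have "0 \<le> (LINT x|face_measure e. bump y r x)"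
    by (intro integral_nonneg_AE AE_I2 bump_nonneg)
  ultimately show ?thesis by simp
qed

text \<open>A bump around a relative interior point of \<open>e\<close> that misses all other faces
  isolates \<open>flux c e\<close> in Green's formula, where the existence of a divergence makes the
  volume terms cancel.\<close>

lemma Hdiv_imp_balanced:
  assumes u: "represents \<psi> c u" and d: "u \<in> Hdiv \<Omega>"
  shows "balanced c"
  unfolding balanced_def
proof
  fix e assume e: "e \<in> interior_faces \<Omega> \<T>"
  then obtain K where K: "K \<in> \<T>" "e \<in> facets K" "\<not> e \<subseteq> frontier \<Omega>" by (rule interior_faceE)
  obtain g where g: "has_weak_div \<Omega> u g" using d by (auto simp: Hdiv_def)
  obtain y where y: "y \<in> rel_interior e" "y \<in> \<Omega>" by (rule rel_interior_meets_domain[OF K])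
  have other: "y \<notin> e'" if e': "e' \<in> faces - {e}" for e'
  proof
    assume "y \<in> e'"
    moreover obtain J where "J \<in> \<T>" "e' \<in> facets J" using e' by (auto simp: faces_def)
    ultimately have "e = e'" using facet_unique[OF K(1,2) _ _ y(1)] by blast
    with e' show False by blast
  qed
  have "closed (\<Union>(faces - {e}))"
  proof (intro closed_Union ballI)
    fix e' assume "e' \<in> faces - {e}"
    then obtain J where "J \<in> \<T>" "e' \<in> facets J" by (auto simp: faces_def)
    then show "closed e'" using facetD(4) compact_imp_closed by blast
  qed (use finite_faces in simp)
  then have "open (\<Omega> - \<Union>(faces - {e}))" using open_domain by blast
  moreover have "y \<in> \<Omega> - \<Union>(faces - {e})" using y(2) other by blast
  ultimately obtain r where r: "r > 0" "cball y r \<subseteq> \<Omega> - \<Union>(faces - {e})"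
    using open_contains_cball by blast
  obtain G where "test_function \<Omega> (\<lambda>x. bump y r x * 1) G"
    using test_function_bump_mult[OF C1_const r(1), of y \<Omega>] r(2) interior_open[OF open_domain] by blast
  then have t: "test_function \<Omega> (bump y r) G" by simp
  then have C1: "C1_with_gradient (bump y r) G" by (simp add: test_function_def)
  have gL2: "g \<in> L2 (lebesgue_on \<Omega>)" using g by (simp add: has_weak_div_def)
  have "l2_inner \<Omega> g (bump y r) = (\<Sum>K\<in>\<T>. l2_inner K g (bump y r))"
    by (intro l2_inner_cells L2_cell[OF gL2] C1_L2_cell(1)[OF C1])
  also have "\<dots> = (\<Sum>K\<in>\<T>. (\<Sum>e\<in>facets K. c K e) / vol K * (LINT x|lebesgue_on K. bump y r x))"
  proof (rule sum.cong[OF refl])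
    fix K assume K: "K \<in> \<T>"
    have "l2_inner K g (bump y r) = l2_inner K (\<lambda>_. (\<Sum>e\<in>facets K. c K e) / vol K) (bump y r)"
      by (rule l2_inner_cong_AE[OF lebesgue_cell[OF K] L2_cell[OF gL2 K] C1_L2_cell(1)[OF C1 K]
            weak_div_domain[OF u g K]]) simp
    then show "l2_inner K g (bump y r) = (\<Sum>e\<in>facets K. c K e) / vol K * (LINT x|lebesgue_on K. bump y r x)"
      by (simp add: l2_inner_def)
  qed
  finally have total: "(\<Sum>e\<in>faces. flux c e * ((LINT y'|face_measure e. bump y r y') / face_area e)) = 0"
    using green_domain[OF u C1] g t by (simp add: has_weak_div_def)
  have others: "flux c e' * ((LINT y'|face_measure e'. bump y r y') / face_area e') = 0"
    if e': "e' \<in> faces - {e}" for e'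
  proof -
    obtain J where J: "J \<in> \<T>" "e' \<in> facets J" using e' by (auto simp: faces_def)
    obtain n a where "flat_face e' n a" by (rule facet_flat_face[OF J])
    then have sp: "space (face_measure e') = e'" by (rule flat_face.space_face_measure)
    have "bump y r x = 0" if "x \<in> e'" for x
    proof (rule bump_zero[OF _ r(1)])
      have "x \<notin> cball y r" using r(2) that e' by blast
      then show "x \<notin> ball y r" by simp
    qed
    then have "(LINT y'|face_measure e'. bump y r y') = (LINT y'|face_measure e'. 0)"
      using sp by (intro Bochner_Integration.integral_cong) auto
    then show ?thesis by simp
  qed
  have "(\<Sum>e'\<in>faces - {e}. flux c e' * ((LINT y'|face_measure e'. bump y r y') / face_area e')) = 0"
    by (rule sum.neutral) (blast intro: others)
  with total have "flux c e * ((LINT y'|face_measure e. bump y r y') / face_area e) = 0"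
    unfolding sum.remove[OF finite_faces interior_face_in_faces[OF e]] by simp
  moreover have "(LINT y'|face_measure e. bump y r y') / face_area e > 0"
    using integral_bump_face_pos[OF K(1,2) y(1) r(1)] face_area_pos[OF K(1,2)] by simp
  ultimately show "flux c e = 0" by (metis less_irrefl mult_eq_0_iff)
qed

lemma Hdiv_iff_balanced: "represents \<psi> c u \<Longrightarrow> u \<in> Hdiv \<Omega> \<longleftrightarrow> balanced c"
  using balanced_imp_Hdiv Hdiv_imp_balanced by blast

end

subsection \<open>The discrete spaces in coordinates\<close>


context multiscale_mesh
begin

text \<open>As \<psi> = - k \<eta>, this matrix represents the form - (k \<eta>, \<eta>) on the cell
  and is negative definite.\<close>

definition gram :: "(real^'d) set \<Rightarrow> (real^'d) set \<Rightarrow> (real^'d) set \<Rightarrow> real" where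
  "gram K e e' = l2_inner K (\<eta> K e) (\<psi> K e')"

definition pairing ::
    "((real^'d) set \<Rightarrow> (real^'d) set \<Rightarrow> real) \<Rightarrow> ((real^'d) set \<Rightarrow> (real^'d) set \<Rightarrow> real) \<Rightarrow> real" where
  "pairing a b = (\<Sum>K\<in>\<T>. \<Sum>e\<in>facets K. a K e * (\<Sum>e'\<in>facets K. b K e' * gram K e e'))"

text \<open>The total flux out of \<open>K\<close>, which is the integral of the divergence over
  \<open>K\<close>.\<close>

definition outflow :: "((real^'d) set \<Rightarrow> (real^'d) set \<Rightarrow> real) \<Rightarrow> (real^'d) set \<Rightarrow> real" where
  "outflow c K = (\<Sum>e\<in>facets K. c K e)"

lemma outflow_diff: "outflow (\<lambda>K e. a K e - b K e) K = outflow a K - outflow b K"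
  by (simp add: outflow_def sum_subtractf)

lemma flux_diff: "flux (\<lambda>K e. a K e - b K e) e = flux a e - flux b e"
  by (simp add: flux_def sum_subtractf)

lemma pairing_diff_left: "pairing (\<lambda>K e. a K e - a' K e) b = pairing a b - pairing a' b"
  by (simp add: pairing_def sum_subtractf left_diff_distrib)

lemma pairing_diff_right: "pairing a (\<lambda>K e. b K e - b' K e) = pairing a b - pairing a b'"
  by (simp add: pairing_def sum_subtractf left_diff_distrib right_diff_distrib)

lemma l2_inner_comb:
  assumes K: "K \<in> \<T>"
  shows "l2_inner K (\<eta>comb K a) (\<psi>comb K b) = (\<Sum>e\<in>facets K. a e * (\<Sum>e'\<in>facets K. b e' * gram K e e'))"
proof -
  have "l2_inner K (\<eta>comb K a) (\<psi>comb K b) = (\<Sum>e\<in>facets K. a e * l2_inner K (\<eta> K e) (\<psi>comb K b))"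
    by (rule l2_inner_sum_left[OF \<eta>_L2[OF K] comb_L2(1)[OF K]])
  also have "\<dots> = (\<Sum>e\<in>facets K. a e * (\<Sum>e'\<in>facets K. b e' * gram K e e'))"
    unfolding gram_def
    by (intro sum.cong refl arg_cong2[of _ _ _ _ "(*)"] l2_inner_sum_right \<psi>_L2[OF K] \<eta>_L2[OF K]; assumption)
  finally show ?thesis .
qed

lemma l2_inner_represents:
  assumes \<theta>: "represents \<eta> a \<theta>" and \<tau>: "represents \<psi> b \<tau>"
  shows "l2_inner \<Omega> \<theta> \<tau> = pairing a b"
proof -
  have "l2_inner \<Omega> \<theta> \<tau> = (\<Sum>K\<in>\<T>. l2_inner K \<theta> \<tau>)"
    by (intro l2_inner_cells L2_cell[OF representsD(1)[OF \<theta>]] L2_cell[OF representsD(1)[OF \<tau>]])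
  also have "\<dots> = (\<Sum>K\<in>\<T>. l2_inner K (\<eta>comb K (a K)) (\<psi>comb K (b K)))"
    by (intro sum.cong refl l2_inner_cong_AE lebesgue_cell L2_cell[OF representsD(1)[OF \<theta>]]
        L2_cell[OF representsD(1)[OF \<tau>]] representsD(2)[OF \<theta>] representsD(2)[OF \<tau>])
  finally show ?thesis by (simp add: pairing_def l2_inner_comb)
qed

text \<open>By \<psi> = - k \<eta>, the field k \<theta> is minus the \<psi>-field with the
  coefficients of \<theta>. This yields its square integrability and explains the reversed arguments
  of \<open>pairing\<close>.\<close>

lemma l2_inner_k_represents:
  assumes \<theta>: "represents \<eta> a \<theta>" and \<xi>: "represents \<eta> b \<xi>"
  shows "l2_inner \<Omega> (\<lambda>x. k x *v \<theta> x) \<xi> = - pairing b a"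
proof -
  have k: "AE x in lebesgue_on K. - \<psi>comb K (a K) x = k x *v \<theta> x" if K: "K \<in> \<T>" for K
    using representsD(2)[OF \<theta> K] comb_k[OF K, of "a K"] by eventually_elim simp
  have neg: "(\<lambda>x. - \<psi>comb K (a K) x) \<in> L2 (lebesgue_on K)" if K: "K \<in> \<T>" for K
    using L2_scaleR[OF comb_L2(1)[OF K, of "a K"], of "-1"] by simp
  have kL2: "(\<lambda>x. k x *v \<theta> x) \<in> L2 (lebesgue_on K)" if K: "K \<in> \<T>" for K
    by (rule L2_AE_cong[OF lebesgue_cell[OF K] neg[OF K] k[OF K]])
  have "l2_inner \<Omega> (\<lambda>x. k x *v \<theta> x) \<xi> = (\<Sum>K\<in>\<T>. l2_inner K (\<lambda>x. k x *v \<theta> x) \<xi>)"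
    by (intro l2_inner_cells kL2 L2_cell[OF representsD(1)[OF \<xi>]])
  also have "\<dots> = (\<Sum>K\<in>\<T>. - l2_inner K (\<eta>comb K (b K)) (\<psi>comb K (a K)))"
  proof (rule sum.cong[OF refl])
    fix K assume K: "K \<in> \<T>"
    have "l2_inner K (\<lambda>x. - \<psi>comb K (a K) x) (\<eta>comb K (b K)) = l2_inner K (\<lambda>x. k x *v \<theta> x) \<xi>"
    proof (rule l2_inner_cong_AE[OF lebesgue_cell[OF K] neg[OF K] comb_L2(2)[OF K] k[OF K]])
      show "AE x in lebesgue_on K. \<eta>comb K (b K) x = \<xi> x"
        using representsD(2)[OF \<xi> K] by eventually_elim simp
    qed
    moreover have "l2_inner K (\<lambda>x. - \<psi>comb K (a K) x) (\<eta>comb K (b K)) =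
        - l2_inner K (\<eta>comb K (b K)) (\<psi>comb K (a K))"
      unfolding l2_inner_def inner_minus_left by (simp only: inner_commute integral_minus)
    ultimately show "l2_inner K (\<lambda>x. k x *v \<theta> x) \<xi> = - l2_inner K (\<eta>comb K (b K)) (\<psi>comb K (a K))" by simp
  qed
  finally show ?thesis by (simp add: pairing_def l2_inner_comb sum_negf)
qed

lemma comb_pairing_bound:
  assumes K: "K \<in> \<T>"
  shows "kmin * (LINT x|lebesgue_on K. (norm (\<eta>comb K c x))\<^sup>2) \<le> - l2_inner K (\<eta>comb K c) (\<psi>comb K c)"
proof -
  have "AE x in lebesgue_on K. x \<in> \<Omega>"
    using negligible_cell_diff_domain[OF K]
    by (simp add: AE_lebesgue_on_iff_negligible[OF lebesgue_cell[OF K]] set_diff_eq)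
  with comb_k[OF K, of c]
  have "AE x in lebesgue_on K. kmin * (norm (\<eta>comb K c x))\<^sup>2 \<le> - (\<eta>comb K c x \<bullet> \<psi>comb K c x)"
  proof eventually_elim
    case (elim x)
    have "\<eta>comb K c x \<bullet> (k x *v \<eta>comb K c x) = - (\<eta>comb K c x \<bullet> \<psi>comb K c x)"
      unfolding elim(1) by (rule inner_minus_right)
    with coercive[OF elim(2), of "\<eta>comb K c x"] show ?case by simp
  qed
  moreover have "integrable (lebesgue_on K) (\<lambda>x. kmin * (norm (\<eta>comb K c x))\<^sup>2)"
    using comb_L2(2)[OF K, of c] by (simp add: L2_def)
  moreover have "integrable (lebesgue_on K) (\<lambda>x. - (\<eta>comb K c x \<bullet> \<psi>comb K c x))"
    by (intro Bochner_Integration.integrable_minus L2_inner_integrable comb_L2[OF K])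
  ultimately have "(LINT x|lebesgue_on K. kmin * (norm (\<eta>comb K c x))\<^sup>2) \<le>
      (LINT x|lebesgue_on K. - (\<eta>comb K c x \<bullet> \<psi>comb K c x))"
    by (intro integral_mono_AE)
  then show ?thesis by (simp add: l2_inner_def)
qed

text \<open>By coercivity the \<eta>-combination vanishes in every cell, hence so does the
  \<psi>-combination, whose coefficients are determined by its traces.\<close>

lemma pairing_definite:
  assumes z: "pairing c c = 0" and K: "K \<in> \<T>" and e: "e \<in> facets K"
  shows "c K e = 0"
proof -
  let ?n = "\<lambda>J. LINT x|lebesgue_on J. (norm (\<eta>comb J (c J) x))\<^sup>2"
  have n0: "0 \<le> ?n J" for J by (rule integral_nonneg_AE) simp
  have le: "kmin * ?n J \<le> - l2_inner J (\<eta>comb J (c J)) (\<psi>comb J (c J))" if "J \<in> \<T>" for J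
    by (rule comb_pairing_bound[OF that])
  have "(\<Sum>J\<in>\<T>. kmin * ?n J) \<le> (\<Sum>J\<in>\<T>. - l2_inner J (\<eta>comb J (c J)) (\<psi>comb J (c J)))"
    by (rule sum_mono) (rule le)
  also have "\<dots> = - pairing c c" by (simp add: pairing_def l2_inner_comb sum_negf)
  finally have "(\<Sum>J\<in>\<T>. kmin * ?n J) \<le> 0" using z by simp
  moreover have "kmin * ?n K \<le> (\<Sum>J\<in>\<T>. kmin * ?n J)"
    using kmin n0 by (intro member_le_sum K fin) simp
  ultimately have "kmin * ?n K \<le> 0" by linarith
  then have "?n K = 0" using kmin n0[of K] by (simp add: mult_le_0_iff)
  then have "AE x in lebesgue_on K. (norm (\<eta>comb K (c K) x))\<^sup>2 = 0"
    using integral_nonneg_eq_0_iff_AE[of "lebesgue_on K" "\<lambda>x. (norm (\<eta>comb K (c K) x))\<^sup>2"]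
      comb_L2(2)[OF K, of "c K"] by (simp add: L2_def)
  with comb_k[OF K, of "c K"] have "AE x in lebesgue_on K. \<psi>comb K (c K) x = 0"
  proof eventually_elim
    case (elim x)
    then have "\<eta>comb K (c K) x = 0" by simp
    with elim(1) show ?case by simp
  qed
  then show ?thesis by (rule comb_eq_zero[OF K _ e])
qed

section \<open>Pressures and multipliers in coordinates\<close>

definition piecewise :: "((real^'d) set \<Rightarrow> real) \<Rightarrow> (real^'d \<Rightarrow> real) \<Rightarrow> bool" where
  "piecewise P q \<longleftrightarrow> q \<in> L2 (lebesgue_on \<Omega>) \<and> (\<forall>K\<in>\<T>. AE x in lebesgue_on K. q x = P K)"

lemma piecewiseD:
  assumes "piecewise P q"
  shows "q \<in> L2 (lebesgue_on \<Omega>)" "K \<in> \<T> \<Longrightarrow> AE x in lebesgue_on K. q x = P K"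
  using assms by (auto simp: piecewise_def)

lemma Qh_iff: "q \<in> Qh \<Omega> \<T> \<longleftrightarrow> (\<exists>P. piecewise P q)"
proof
  assume q: "q \<in> Qh \<Omega> \<T>"
  then have "\<forall>K\<in>\<T>. \<exists>c. AE x in lebesgue_on K. q x = c" by (simp add: Qh_def)
  from bchoice[OF this] show "\<exists>P. piecewise P q" using q by (auto simp: piecewise_def Qh_def)
qed (auto simp: piecewise_def Qh_def)

lemma const_L2_cell: "K \<in> \<T> \<Longrightarrow> (\<lambda>_. a) \<in> L2 (lebesgue_on K)" for a :: real
  by (rule L2_continuous[OF continuous_on_const cell_compact])

lemma piecewise_exists: "\<exists>q. piecewise P q"
proof -
  have "\<exists>q\<in>L2 (lebesgue_on \<Omega>). \<forall>K\<in>\<T>. AE x in lebesgue_on K. q x = P K"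
    by (rule glue_cells) (rule const_L2_cell)
  then show ?thesis by (auto simp: piecewise_def)
qed

text \<open>The volume cancels, so testing a divergence with a cellwise constant gives the bare
  outflow.\<close>

lemma l2_inner_const_cell:
  assumes K: "K \<in> \<T>" and q: "q \<in> L2 (lebesgue_on K)" "AE x in lebesgue_on K. q x = a"
    and g: "g \<in> L2 (lebesgue_on K)" "AE x in lebesgue_on K. g x = b / vol K"
  shows "l2_inner K q g = a * b"
proof -
  have "l2_inner K q g = l2_inner K (\<lambda>_. a) (\<lambda>_. b / vol K)"
    by (rule l2_inner_cong_AE[OF lebesgue_cell[OF K] q(1) g(1) q(2) g(2)])
  also have "\<dots> = a * b"
    using measure_cell_pos[OF K] lebesgue_cell[OF K] by (simp add: l2_inner_def measure_restrict_space)
  finally show ?thesis .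
qed

lemma div_cell:
  assumes q: "piecewise P q" and u: "represents \<psi> c u" and K: "K \<in> \<T>"
  shows "l2_inner K q (weak_div K u) = P K * outflow c K"
  unfolding outflow_def
  by (rule l2_inner_const_cell[OF K L2_cell[OF piecewiseD(1)[OF q] K] piecewiseD(2)[OF q K]
        weak_div_cell(2,3)[OF u K]])

lemma div_domain:
  assumes q: "piecewise P q" and u: "represents \<psi> c u" and d: "u \<in> Hdiv \<Omega>"
  shows "l2_inner \<Omega> q (weak_div \<Omega> u) = (\<Sum>K\<in>\<T>. P K * outflow c K)"
proof -
  obtain g where "has_weak_div \<Omega> u g" using d by (auto simp: Hdiv_def)
  then have wd: "has_weak_div \<Omega> u (weak_div \<Omega> u)"
    unfolding weak_div_def by (rule someI[of "has_weak_div \<Omega> u"])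
  then have L2: "weak_div \<Omega> u \<in> L2 (lebesgue_on \<Omega>)" by (simp add: has_weak_div_def)
  have "l2_inner \<Omega> q (weak_div \<Omega> u) = (\<Sum>K\<in>\<T>. l2_inner K q (weak_div \<Omega> u))"
    by (intro l2_inner_cells L2_cell[OF L2] L2_cell[OF piecewiseD(1)[OF q]])
  also have "\<dots> = (\<Sum>K\<in>\<T>. P K * outflow c K)"
    unfolding outflow_def
    by (intro sum.cong refl l2_inner_const_cell L2_cell[OF L2] L2_cell[OF piecewiseD(1)[OF q]]
        piecewiseD(2)[OF q] weak_div_domain[OF u wd])
  finally show ?thesis .
qed

lemma l2_inner_load:
  assumes q: "piecewise P q" and f: "f \<in> L2 (lebesgue_on \<Omega>)"
  shows "l2_inner \<Omega> f q = (\<Sum>K\<in>\<T>. P K * (LINT x|lebesgue_on K. f x))"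
proof -
  have "l2_inner \<Omega> f q = (\<Sum>K\<in>\<T>. l2_inner K f q)"
    by (intro l2_inner_cells L2_cell[OF f] L2_cell[OF piecewiseD(1)[OF q]])
  also have "\<dots> = (\<Sum>K\<in>\<T>. P K * (LINT x|lebesgue_on K. f x))"
  proof (rule sum.cong[OF refl])
    fix K assume K: "K \<in> \<T>"
    have "l2_inner K f q = l2_inner K f (\<lambda>_. P K)"
      by (rule l2_inner_cong_AE[OF lebesgue_cell[OF K] L2_cell[OF f K] L2_cell[OF piecewiseD(1)[OF q] K] _ piecewiseD(2)[OF q K]]) simp
    then show "l2_inner K f q = P K * (LINT x|lebesgue_on K. f x)" by (simp add: l2_inner_def)
  qed
  finally show ?thesis .
qed

text \<open>The two unit normals are parallel, so their product is 1 or -1, and squaring removes the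
  arbitrary orientation of \<open>face_normal\<close>.\<close>

lemma face_normal_dot:
  assumes K: "K \<in> \<T>" "e \<in> facets K"
  shows "(face_normal e \<bullet> outward_normal K e) * (face_normal e \<bullet> outward_normal K e) = 1"
proof -
  let ?n = "outward_normal K e"
  obtain c where f: "flat_facet K e ?n c" by (rule facet_flat[OF K])
  have n: "norm ?n = 1" "affine hull e = {x. ?n \<bullet> x = c}" "e \<subseteq> {x. ?n \<bullet> x = c}"
    using f by (auto simp: flat_facet_def)
  obtain y where y: "y \<in> e" using facetD(6)[OF K] by blast
  have "norm ?n = 1 \<and> (\<forall>x\<in>e. \<forall>y\<in>e. ?n \<bullet> (x - y) = 0)"
    using n(1,3) by (auto simp: inner_diff_right subset_iff)
  then have m: "norm (face_normal e) = 1 \<and> (\<forall>x\<in>e. \<forall>y\<in>e. face_normal e \<bullet> (x - y) = 0)"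
    unfolding face_normal_def by (rule someI)
  have mc: "face_normal e \<bullet> x = face_normal e \<bullet> z" if "x \<in> e" "z \<in> e" for x z
  proof -
    have "face_normal e \<bullet> (x - z) = 0" using m that by blast
    then show ?thesis by (simp add: inner_diff_right)
  qed
  have "\<bar>?n \<bullet> face_normal e\<bar> = 1"
    using unit_normal_parallel_of_hyperplane[OF n(1) conjunct1[OF m] n(2) y mc] by blast
  then have "(?n \<bullet> face_normal e) * (?n \<bullet> face_normal e) = 1"
    using abs_mult_self_eq[of "?n \<bullet> face_normal e"] by simp
  then show ?thesis by (simp only: inner_commute)
qed

definition skeleton :: "((real^'d) set \<Rightarrow> real) \<Rightarrow> (real^'d \<Rightarrow> real) \<Rightarrow> bool" where
  "skeleton \<Lambda> \<pi> \<longleftrightarrow>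
     (\<forall>e\<in>interior_faces \<Omega> \<T>. \<pi> \<in> L2 (face_measure e) \<and> (AE y in face_measure e. \<pi> y = \<Lambda> e)) \<and>
     (\<forall>e\<in>boundary_faces \<Omega> \<T>. AE y in face_measure e. \<pi> y = 0)"

text \<open>One function must serve all faces at once. Each constant is placed on the relative
  interior of its face; these sets are disjoint, and what they omit is null.\<close>

lemma skeleton_exists: "\<exists>\<pi>. skeleton \<Lambda> \<pi>"
proof -
  define \<pi> where "\<pi> y = (\<Sum>e\<in>interior_faces \<Omega> \<T>. \<Lambda> e * indicator (rel_interior e) y)" for y
  have meas: "\<pi> \<in> borel_measurable borel"
    unfolding \<pi>_def
  proof (intro borel_measurable_sum borel_measurable_times borel_measurable_const borel_measurable_indicator)
    fix e assume "e \<in> interior_faces \<Omega> \<T>"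
    then obtain K where K: "K \<in> \<T>" "e \<in> facets K" "\<not> e \<subseteq> frontier \<Omega>" by (rule interior_faceE)
    have "rel_interior e = e - rel_frontier e"
      using facetD(4)[OF K(1,2)] rel_interior_subset[of e]
      by (auto simp: rel_frontier_def compact_imp_closed)
    moreover have "e \<in> sets borel" "rel_frontier e \<in> sets borel"
      using facetD(4)[OF K(1,2)] by (auto intro: borel_compact borel_closed closed_rel_frontier)
    ultimately show "rel_interior e \<in> sets borel" by auto
  qed
  have bound: "norm (\<pi> y) \<le> (\<Sum>e\<in>interior_faces \<Omega> \<T>. \<bar>\<Lambda> e\<bar>)" for y
    unfolding \<pi>_def
    by (rule order_trans[OF norm_sum]) (auto intro!: sum_mono simp: indicator_def)
  have *: "\<pi> \<in> L2 (face_measure e) \<and>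
      (AE y in face_measure e. \<pi> y = (if e \<in> interior_faces \<Omega> \<T> then \<Lambda> e else 0))" if e: "e \<in> faces" for e
  proof -
    obtain K where K: "K \<in> \<T>" "e \<in> facets K" using e by (auto simp: faces_def)
    obtain n a where "flat_face e n a" by (rule facet_flat_face[OF K])
    then interpret flat_face e n a .
    have "borel_measurable (face_measure e) = borel_measurable (restrict_space borel e)"
      by (rule measurable_cong_sets[OF sets_face_measure refl])
    then have "\<pi> \<in> borel_measurable (face_measure e)"
      using measurable_restrict_space1[OF meas] by blast
    then have "\<pi> \<in> L2 (face_measure e)"
      by (rule L2_bounded[OF finite_face_measure]) (rule bound)
    moreover have "AE y in face_measure e. \<pi> y = (if e \<in> interior_faces \<Omega> \<T> then \<Lambda> e else 0)"
      using AE_rel_interior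
    proof eventually_elim
      case (elim y)
      have ind: "indicator (rel_interior e') y = (if e' = e then 1 else (0::real))"
        if e': "e' \<in> interior_faces \<Omega> \<T>" for e'
      proof -
        obtain J where J: "J \<in> \<T>" "e' \<in> facets J" "\<not> e' \<subseteq> frontier \<Omega>" using e' by (rule interior_faceE)
        show ?thesis
          using facet_unique[OF K J(1,2) elim] elim rel_interior_subset[of e']
          by (auto simp: indicator_def)
      qed
      have "\<pi> y = (\<Sum>e'\<in>interior_faces \<Omega> \<T>. if e' = e then \<Lambda> e' else 0)"
        unfolding \<pi>_def by (rule sum.cong[OF refl]) (simp add: ind)
      then show ?case using finite_interior_faces by simp
    qed
    ultimately show ?thesis by blast
  qed
  have "skeleton \<Lambda> \<pi>"
    unfolding skeleton_def
  proof (intro conjI ballI)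
    fix e assume e: "e \<in> interior_faces \<Omega> \<T>"
    show "\<pi> \<in> L2 (face_measure e)" "AE y in face_measure e. \<pi> y = \<Lambda> e"
      using *[OF interior_face_in_faces[OF e]] e by simp_all
  next
    fix e assume e: "e \<in> boundary_faces \<Omega> \<T>"
    then have "e \<in> faces" "e \<notin> interior_faces \<Omega> \<T>"
      by (auto simp: boundary_faces_def faces_def interior_faces_def)
    then show "AE y in face_measure e. \<pi> y = 0" using *[of e] by simp
  qed
  then show ?thesis by blast
qed

lemma trace_represents:
  assumes u: "represents \<psi> c u" and K: "K \<in> \<T>" "e \<in> facets K"
  shows "normal_trace K u e \<in> L2 (face_measure e)"
    "AE y in face_measure e. normal_trace K u e y = c K e / face_area e"
proof -
  note t = normal_trace_eq[OF K(1) comb_trace[OF K(1) representsD(2)[OF u K(1)]]]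
  show "normal_trace K u e \<in> L2 (face_measure e)"
    using t(1) K(2) by (simp add: has_normal_trace_def)
  show "AE y in face_measure e. normal_trace K u e y = c K e / face_area e" by (rule t(2)[OF K(2)])
qed

text \<open>Traces of conforming fields are constant on each face. Conversely every constant occurs:
  a flux leaving one neighbour and entering the other is balanced, and \<open>Pih\<close> allows a
  different field for each face.\<close>

lemma Pih_iff: "\<pi> \<in> Pih \<Omega> \<T> \<psi> \<longleftrightarrow> (\<exists>\<Lambda>. skeleton \<Lambda> \<pi>)"
proof
  assume \<pi>: "\<pi> \<in> Pih \<Omega> \<T> \<psi>"
  have "\<forall>e\<in>interior_faces \<Omega> \<T>. \<exists>\<Lambda>. AE y in face_measure e. \<pi> y = \<Lambda>"
  proof
    fix e assume e: "e \<in> interior_faces \<Omega> \<T>"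
    then obtain K where K: "K \<in> \<T>" "e \<in> facets K" "\<not> e \<subseteq> frontier \<Omega>" by (rule interior_faceE)
    have "\<exists>u\<in>X2 \<Omega> \<T> \<psi>. \<forall>K\<in>\<T>. e \<in> facets K \<longrightarrow> (AE y in face_measure e.
        \<pi> y = (face_normal e \<bullet> outward_normal K e) * normal_trace K u e y)"
      using \<pi> e by (simp add: Pih_def)
    then obtain u where u: "u \<in> X2 \<Omega> \<T> \<psi>"
      "AE y in face_measure e. \<pi> y = (face_normal e \<bullet> outward_normal K e) * normal_trace K u e y"
      using K by blast
    obtain c where c: "represents \<psi> c u" using u(1) by (auto simp: X2_def multiscale_space_iff)
    have "AE y in face_measure e. \<pi> y = (face_normal e \<bullet> outward_normal K e) * (c K e / face_area e)"
      using u(2) trace_represents(2)[OF c K(1,2)] by eventually_elim simp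
    then show "\<exists>\<Lambda>. AE y in face_measure e. \<pi> y = \<Lambda>" by blast
  qed
  from bchoice[OF this] show "\<exists>\<Lambda>. skeleton \<Lambda> \<pi>" using \<pi> by (auto simp: skeleton_def Pih_def)
next
  assume "\<exists>\<Lambda>. skeleton \<Lambda> \<pi>"
  then obtain \<Lambda> where \<Lambda>: "skeleton \<Lambda> \<pi>" by blast
  have "\<exists>u\<in>X2 \<Omega> \<T> \<psi>. \<forall>K\<in>\<T>. e \<in> facets K \<longrightarrow> (AE y in face_measure e.
      \<pi> y = (face_normal e \<bullet> outward_normal K e) * normal_trace K u e y)"
    if e: "e \<in> interior_faces \<Omega> \<T>" for e
  proof -
    obtain K where K: "K \<in> \<T>" "e \<in> facets K" "\<not> e \<subseteq> frontier \<Omega>" using e by (rule interior_faceE)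
    obtain J where J: "J \<in> \<T>" "J \<noteq> K" "{J \<in> \<T>. e \<in> facets J} = {K, J}"
      "outward_normal J e = - outward_normal K e" by (rule two_cells[OF K])
    \<comment> \<open>The area cancels the division in the trace. The orientation factor changes
      sign across \<open>e\<close>, so the flux is zero; with the same factor in \<open>Pih\<close>
      it squares to 1.\<close>
    define c where "c M f = (if f = e then \<Lambda> e * face_area e * (face_normal e \<bullet> outward_normal M e) else 0)"
      for M and f :: "(real^'d) set"
    have "flux c e = 0" using J by (simp add: flux_def c_def)
    moreover have "flux c f = 0" if "f \<noteq> e" for f using that by (simp add: flux_def c_def)
    ultimately have "balanced c" unfolding balanced_def by metis
    obtain \<theta> u where u: "represents \<eta> c \<theta>" "represents \<psi> c u" by (rule represents_exists)
    have "u \<in> X2 \<Omega> \<T> \<psi>"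
      using u(2) Hdiv_iff_balanced[OF u(2)] \<open>balanced c\<close> by (auto simp: X2_def multiscale_space_iff)
    moreover have "AE y in face_measure e. \<pi> y = (face_normal e \<bullet> outward_normal M e) * normal_trace M u e y"
      if M: "M \<in> \<T>" "e \<in> facets M" for M
    proof -
      have "AE y in face_measure e. \<pi> y = \<Lambda> e" using \<Lambda> e by (simp add: skeleton_def)
      then show ?thesis
        using trace_represents(2)[OF u(2) M]
      proof eventually_elim
        case (elim y)
        have "(face_normal e \<bullet> outward_normal M e) * normal_trace M u e y =
            \<Lambda> e * ((face_normal e \<bullet> outward_normal M e) * (face_normal e \<bullet> outward_normal M e))"
          unfolding elim(2) c_def using face_area_pos[OF M] by simp
        then show ?case using elim(1) face_normal_dot[OF M] by simp
      qed
    qed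
    ultimately show ?thesis by blast
  qed
  then show "\<pi> \<in> Pih \<Omega> \<T> \<psi>" using \<Lambda> by (simp add: Pih_def skeleton_def)
qed

lemma sum_interior_faces:
  "(\<Sum>K\<in>\<T>. \<Sum>e\<in>facets K. c K e * (if e \<in> interior_faces \<Omega> \<T> then \<Lambda> e else 0)) =
   (\<Sum>e\<in>interior_faces \<Omega> \<T>. \<Lambda> e * flux c e)"
proof -
  have "(\<Sum>K\<in>\<T>. \<Sum>e\<in>facets K. c K e * (if e \<in> interior_faces \<Omega> \<T> then \<Lambda> e else 0)) =
      (\<Sum>e\<in>faces. if e \<in> interior_faces \<Omega> \<T> then \<Lambda> e * flux c e else 0)"
    unfolding sum_faces by (rule sum.cong) auto
  also have "\<dots> = (\<Sum>e\<in>faces \<inter> interior_faces \<Omega> \<T>. \<Lambda> e * flux c e)"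
    using finite_faces by (rule sum.inter_restrict[symmetric])
  also have "faces \<inter> interior_faces \<Omega> \<T> = interior_faces \<Omega> \<T>"
    using interior_face_in_faces by blast
  finally show ?thesis .
qed

text \<open>Integrating the trace \<open>c K e / face_area e\<close> over the face cancels the area,
  and the two sides add up to the flux jump. Boundary faces drop out because the multiplier vanishes
  there.\<close>

lemma Ch_eq:
  assumes u: "represents \<psi> c u" and \<pi>: "skeleton \<Lambda> \<pi>"
  shows "Ch \<T> u \<pi> = (\<Sum>e\<in>interior_faces \<Omega> \<T>. \<Lambda> e * flux c e)"
proof -
  have "(LINT y|face_measure e. normal_trace K u e y * \<pi> y) =
      c K e * (if e \<in> interior_faces \<Omega> \<T> then \<Lambda> e else 0)" if K: "K \<in> \<T>" "e \<in> facets K" for K e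
  proof -
    have "e \<in> faces" using K by (auto simp: faces_def)
    then show ?thesis
    proof (cases rule: faces_cases)
      case 1
      obtain n a where "flat_face e n a" by (rule facet_flat_face[OF K])
      then have sp: "space (face_measure e) = e" by (rule flat_face.space_face_measure)
      have \<pi>e: "\<pi> \<in> L2 (face_measure e)" "AE y in face_measure e. \<pi> y = \<Lambda> e"
        using \<pi> 1 by (auto simp: skeleton_def)
      have "(LINT y|face_measure e. normal_trace K u e y * \<pi> y) =
          (LINT y|face_measure e. c K e / face_area e * \<Lambda> e)"
      proof (rule integral_cong_AE)
        show "(\<lambda>y. normal_trace K u e y * \<pi> y) \<in> borel_measurable (face_measure e)"
          by (intro borel_measurable_times L2_measurable trace_represents(1)[OF u K] \<pi>e(1))
        show "AE y in face_measure e. normal_trace K u e y * \<pi> y = c K e / face_area e * \<Lambda> e"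
          using trace_represents(2)[OF u K] \<pi>e(2) by eventually_elim simp
      qed simp
      also have "\<dots> = c K e * \<Lambda> e"
        using face_area_pos[OF K] sp by (simp add: face_area_def)
      finally show ?thesis using 1 by simp
    next
      case 2
      then have "AE y in face_measure e. \<pi> y = 0" using \<pi> by (simp add: skeleton_def)
      then have "AE y in face_measure e. normal_trace K u e y * \<pi> y = 0" by eventually_elim simp
      then have "(LINT y|face_measure e. normal_trace K u e y * \<pi> y) = 0"
        by (rule integral_eq_zero_AE)
      moreover have "e \<notin> interior_faces \<Omega> \<T>" using 2 by (simp add: interior_faces_def)
      ultimately show ?thesis by simp
    qed
  qed
  then have "Ch \<T> u \<pi> = (\<Sum>K\<in>\<T>. \<Sum>e\<in>facets K. c K e * (if e \<in> interior_faces \<Omega> \<T> then \<Lambda> e else 0))"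
    unfolding Ch_def by (intro sum.cong refl) blast
  then show ?thesis by (simp only: sum_interior_faces)
qed

end

subsection \<open>The discrete problems\<close>


context multiscale_mesh
begin

text \<open>The cells with nonzero value are closed under passing to facet neighbours and have no
  boundary facet, so there are none.\<close>

lemma constants_propagate:
  assumes bd: "\<And>K e. K \<in> \<T> \<Longrightarrow> e \<in> facets K \<Longrightarrow> e \<notin> interior_faces \<Omega> \<T> \<Longrightarrow> P K = 0"
    and nb: "\<And>K J e. K \<in> \<T> \<Longrightarrow> J \<in> \<T> \<Longrightarrow> e \<in> facets K \<Longrightarrow> e \<in> facets J \<Longrightarrow> P K = (P J :: real)"
    and K: "K \<in> \<T>"
  shows "P K = 0"
proof (rule ccontr)
  assume "P K \<noteq> 0"
  show False
  proof (rule neighbour_closed_reaches_boundary[of "{K \<in> \<T>. P K \<noteq> 0}"])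
    show "{K \<in> \<T>. P K \<noteq> 0} \<noteq> {}" using K \<open>P K \<noteq> 0\<close> by blast
    show "\<not> e \<subseteq> frontier \<Omega>" if "J \<in> {K \<in> \<T>. P K \<noteq> 0}" "e \<in> facets J" for J e
      using bd[of J e] that by (auto simp: interior_faces_def)
    show "I \<in> {K \<in> \<T>. P K \<noteq> 0}"
      if "J \<in> {K \<in> \<T>. P K \<noteq> 0}" "I \<in> \<T>" "e \<in> facets J" "e \<in> facets I" for I J e
      using nb[of J I e] that by auto
  qed blast
qed

text \<open>The value on an interior face equals those of both adjacent cells, so cell values agree
  across faces and vanish next to the boundary.\<close>

lemma multipliers_zero:
  assumes "\<And>K e. K \<in> \<T> \<Longrightarrow> e \<in> facets K \<Longrightarrow> P K = (if e \<in> interior_faces \<Omega> \<T> then \<Lambda> e else (0::real))"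
  shows "K \<in> \<T> \<Longrightarrow> P K = 0" "e \<in> interior_faces \<Omega> \<T> \<Longrightarrow> \<Lambda> e = 0"
proof -
  show P: "P K = 0" if "K \<in> \<T>" for K
    by (rule constants_propagate[OF _ _ that, of P]) (use assms in force)+
  show "e \<in> interior_faces \<Omega> \<T> \<Longrightarrow> \<Lambda> e = 0"
    using interior_faceE assms P by metis
qed

text \<open>Unit outward flux through one facet of one cell; used as a test, it extracts a single
  unknown.\<close>

definition unit_coeff :: "(real^'d) set \<Rightarrow> (real^'d) set \<Rightarrow> (real^'d) set \<Rightarrow> (real^'d) set \<Rightarrow> real" where
  "unit_coeff K e = (\<lambda>J f. if J = K \<and> f = e then 1 else 0)"

lemma outflow_unit: "K \<in> \<T> \<Longrightarrow> e \<in> facets K \<Longrightarrow> outflow (unit_coeff K e) J = (if J = K then 1 else 0)"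
  using finite_facets[of K] by (simp add: outflow_def unit_coeff_def)

lemma flux_unit:
  assumes "K \<in> \<T>" "e \<in> facets K"
  shows "flux (unit_coeff K e) f = (if f = e then 1 else 0)"
proof (cases "f = e")
  case True
  have "flux (unit_coeff K e) f = (\<Sum>J | J \<in> \<T> \<and> e \<in> facets J. if J = K then 1 else 0)"
    unfolding flux_def True by (rule sum.cong) (auto simp: unit_coeff_def)
  also have "\<dots> = 1" using assms fin by simp
  finally show ?thesis using True by simp
qed (simp add: flux_def unit_coeff_def)

lemma sum_unit:
  assumes "K \<in> \<T>" "e \<in> facets K"
  shows "(\<Sum>J\<in>\<T>. P J * outflow (unit_coeff K e) J) = P K"
    "(\<Sum>f\<in>interior_faces \<Omega> \<T>. \<Lambda> f * flux (unit_coeff K e) f) = (if e \<in> interior_faces \<Omega> \<T> then \<Lambda> e else 0)"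
  using assms fin finite_interior_faces
  by (simp_all add: outflow_unit flux_unit if_distrib[of "(*) _"] cong: if_cong)

section \<open>The linear systems for the coefficients\<close>

text \<open>Problem (L) in coordinates. Its first equation is already used up: \<theta> and u share
  the coefficients \<open>c\<close>.\<close>

definition L_system where
  "L_system F c P \<longleftrightarrow> balanced c \<and>
     (\<forall>b. balanced b \<longrightarrow> pairing c b + (\<Sum>K\<in>\<T>. P K * outflow b K) = 0) \<and>
     (\<forall>K\<in>\<T>. outflow c K = F K)"

text \<open>Here the test coefficients are unrestricted, and \<open>balanced c\<close> is the
  constraint enforced by the multipliers.\<close>

definition HL_system where
  "HL_system F c P \<Lambda> \<longleftrightarrow> balanced c \<and>
     (\<forall>b. pairing c b + (\<Sum>K\<in>\<T>. P K * outflow b K) = (\<Sum>e\<in>interior_faces \<Omega> \<T>. \<Lambda> e * flux b e)) \<and>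
     (\<forall>K\<in>\<T>. outflow c K = F K)"

lemma HL_system_imp_L_system: "HL_system F c P \<Lambda> \<Longrightarrow> L_system F c P"
  by (simp add: HL_system_def L_system_def balanced_def)

lemma balanced_diff: "balanced a \<Longrightarrow> balanced b \<Longrightarrow> balanced (\<lambda>K e. a K e - b K e)"
  by (simp add: balanced_def flux_diff)

text \<open>Tested with itself, the difference \<open>?d\<close> has no outflow, so definiteness
  makes it zero. The pressure difference is then orthogonal to all outflows of balanced
  coefficients, which makes it vanish next to the boundary and agree across faces.\<close>

lemma L_system_unique:
  assumes s: "L_system F c P" and s': "L_system F c' P'" and K: "K \<in> \<T>"
  shows "e \<in> facets K \<Longrightarrow> c K e = c' K e" "P K = P' K"
proof -
  let ?d = "\<lambda>K e. c K e - c' K e" and ?Q = "\<lambda>K. P K - P' K"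
  have bal: "balanced ?d" using s s' by (simp add: L_system_def balanced_diff)
  have eq: "pairing ?d b + (\<Sum>K\<in>\<T>. ?Q K * outflow b K) = 0" if "balanced b" for b
  proof -
    have "pairing c b + (\<Sum>K\<in>\<T>. P K * outflow b K) = 0" "pairing c' b + (\<Sum>K\<in>\<T>. P' K * outflow b K) = 0"
      using s s' that by (auto simp: L_system_def)
    then show ?thesis by (simp add: pairing_diff_left left_diff_distrib sum_subtractf)
  qed
  have "outflow ?d K = 0" if "K \<in> \<T>" for K
    using s s' that by (simp add: L_system_def outflow_diff)
  then have "pairing ?d ?d = 0" using eq[OF bal] by simp
  then have d0: "?d K e = 0" if "K \<in> \<T>" "e \<in> facets K" for K e
    by (rule pairing_definite[of ?d, OF _ that])
  then show "e \<in> facets K \<Longrightarrow> c K e = c' K e" using K by simp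
  have "pairing ?d b = 0" for b
    unfolding pairing_def by (intro sum.neutral ballI) (simp add: d0)
  then have Q0: "(\<Sum>K\<in>\<T>. ?Q K * outflow b K) = 0" if "balanced b" for b
    using eq[OF that] by simp
  have "?Q K = 0"
  proof (rule constants_propagate[OF _ _ K, of ?Q])
    fix K e assume Ke: "K \<in> \<T>" "e \<in> facets K" "e \<notin> interior_faces \<Omega> \<T>"
    \<comment> \<open>Balance constrains interior faces only, so flux through a boundary facet is
      free.\<close>
    then have "balanced (unit_coeff K e)" by (auto simp: balanced_def flux_unit)
    from Q0[OF this] show "?Q K = 0" by (simp add: sum_unit(1)[OF Ke(1,2)])
  next
    fix K J e assume KJ: "K \<in> \<T>" "J \<in> \<T>" "e \<in> facets K" "e \<in> facets J"
    \<comment> \<open>Flux leaving \<open>K\<close> through \<open>e\<close> and entering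
      \<open>J\<close>.\<close>
    let ?b = "\<lambda>I f. unit_coeff K e I f - unit_coeff J e I f"
    have "balanced ?b"
      unfolding balanced_def flux_diff using KJ by (simp add: flux_unit)
    from Q0[OF this] have "(\<Sum>I\<in>\<T>. ?Q I * outflow (unit_coeff K e) I) - (\<Sum>I\<in>\<T>. ?Q I * outflow (unit_coeff J e) I) = 0"
      by (simp only: outflow_diff right_diff_distrib sum_subtractf)
    then show "?Q K = ?Q J" by (simp only: sum_unit(1)[OF KJ(1,3)] sum_unit(1)[OF KJ(2,4)])
  qed
  then show "P K = P' K" by simp
qed

lemma HL_system_multiplier_unique:
  assumes s: "HL_system F c P \<Lambda>" and s': "HL_system F c' P' \<Lambda>'" and e: "e \<in> interior_faces \<Omega> \<T>"
  shows "\<Lambda> e = \<Lambda>' e"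
proof -
  note L = HL_system_imp_L_system[OF s] HL_system_imp_L_system[OF s']
  obtain K where K: "K \<in> \<T>" "e \<in> facets K" "\<not> e \<subseteq> frontier \<Omega>" using e by (rule interior_faceE)
  have cc: "pairing c b = pairing c' b" for b
    unfolding pairing_def by (intro sum.cong refl) (simp add: L_system_unique(1)[OF L])
  have PP: "(\<Sum>K\<in>\<T>. P K * outflow b K) = (\<Sum>K\<in>\<T>. P' K * outflow b K)" for b
    by (intro sum.cong refl) (simp add: L_system_unique(2)[OF L])
  have "(\<Sum>f\<in>interior_faces \<Omega> \<T>. \<Lambda> f * flux b f) = (\<Sum>f\<in>interior_faces \<Omega> \<T>. \<Lambda>' f * flux b f)" for b
    using s s' cc[of b] PP[of b] by (simp add: HL_system_def) metis
  from this[of "unit_coeff K e"] show ?thesis using e by (simp add: sum_unit(2)[OF K(1,2)])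
qed

text \<open>An instance of the abstract saddle point problem, whose constraints prescribe the
  outflow of each cell and the flux jump of each interior face. Injectivity of the constraints is
  \<open>multipliers_zero\<close>.\<close>

lemma HL_system_exists: "\<exists>c P \<Lambda>. HL_system F c P \<Lambda>"
proof -
  define D where "D = Sigma \<T> facets"
  define I where "I = \<T> <+> interior_faces \<Omega> \<T>"
  \<comment> \<open>Block diagonal, because broken fields in different cells do not
    interact.\<close>
  define A where "A = (\<lambda>(K, e) (J, e'). if K = J then gram K e e' else 0)"
  \<comment> \<open>The entry -1 moves the face multipliers to the right-hand side, as in
    \<open>HL_system\<close>.\<close>
  define B :: "(real^'d) set + (real^'d) set \<Rightarrow> (real^'d) set \<times> (real^'d) set \<Rightarrow> real" where
    "B = (\<lambda>i (J, e). case i of Inl K \<Rightarrow> (if K = J then 1 else 0) | Inr f \<Rightarrow> (if f = e then - 1 else 0))"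
  have fD: "finite D" unfolding D_def using fin finite_facets by blast
  have fI: "finite I" unfolding I_def using fin finite_interior_faces by simp
  have sumD: "(\<Sum>\<alpha>\<in>D. g \<alpha>) = (\<Sum>K\<in>\<T>. \<Sum>e\<in>facets K. g (K, e))" for g :: "_ \<Rightarrow> real"
    unfolding D_def using fin finite_facets by (subst sum.Sigma) (auto simp: case_prod_unfold)
  have sumI: "(\<Sum>i\<in>I. \<mu> i * B i (J, e)) = \<mu> (Inl J) - (if e \<in> interior_faces \<Omega> \<T> then \<mu> (Inr e) else 0)"
    if "J \<in> \<T>" for J e and \<mu>
    unfolding I_def using that fin finite_interior_faces
    by (subst sum.Plus) (simp_all add: B_def if_distrib[of "(*) _"] sum_negf cong: if_cong)
  have row: "(\<Sum>\<alpha>\<in>D. c \<alpha> * A \<alpha> (J, e')) = (\<Sum>e\<in>facets J. c (J, e) * gram J e e')" if "J \<in> \<T>" for c J e'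
  proof -
    have "(\<Sum>\<alpha>\<in>D. c \<alpha> * A \<alpha> (J, e')) = (\<Sum>K\<in>\<T>. if K = J then (\<Sum>e\<in>facets J. c (J, e) * gram J e e') else 0)"
      unfolding sumD by (intro sum.cong refl) (auto simp: A_def)
    then show ?thesis using that fin by simp
  qed
  have pair: "(\<Sum>\<beta>\<in>D. b \<beta> * (\<Sum>\<alpha>\<in>D. c \<alpha> * A \<alpha> \<beta>)) = pairing (\<lambda>K e. c (K, e)) (\<lambda>K e. b (K, e))" for b c
  proof -
    have "(\<Sum>\<beta>\<in>D. b \<beta> * (\<Sum>\<alpha>\<in>D. c \<alpha> * A \<alpha> \<beta>)) =
        (\<Sum>J\<in>\<T>. \<Sum>e'\<in>facets J. b (J, e') * (\<Sum>e\<in>facets J. c (J, e) * gram J e e'))"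
      unfolding sumD[of "\<lambda>\<beta>. b \<beta> * _ \<beta>"] by (intro sum.cong refl) (simp add: row)
    also have "\<dots> = (\<Sum>J\<in>\<T>. \<Sum>e\<in>facets J. \<Sum>e'\<in>facets J. b (J, e') * (c (J, e) * gram J e e'))"
      unfolding sum_distrib_left by (rule sum.cong[OF refl], rule sum.swap)
    finally show ?thesis by (simp add: pairing_def sum_distrib_left mult_ac)
  qed
  have "\<exists>c \<mu>. (\<forall>\<beta>\<in>D. (\<Sum>\<alpha>\<in>D. c \<alpha> * A \<alpha> \<beta>) + (\<Sum>i\<in>I. \<mu> i * B i \<beta>) = 0) \<and>
      (\<forall>i\<in>I. (\<Sum>\<alpha>\<in>D. B i \<alpha> * c \<alpha>) = (case i of Inl K \<Rightarrow> F K | Inr e \<Rightarrow> 0))"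
  proof (rule saddle_point_exists[OF fD fI])
    fix c :: "(real^'d) set \<times> (real^'d) set \<Rightarrow> real"
    assume "(\<Sum>\<alpha>\<in>D. \<Sum>\<beta>\<in>D. c \<alpha> * c \<beta> * A \<alpha> \<beta>) = 0"
    also have "(\<Sum>\<alpha>\<in>D. \<Sum>\<beta>\<in>D. c \<alpha> * c \<beta> * A \<alpha> \<beta>) = (\<Sum>\<beta>\<in>D. c \<beta> * (\<Sum>\<alpha>\<in>D. c \<alpha> * A \<alpha> \<beta>))"
      by (subst sum.swap) (simp add: sum_distrib_left mult_ac)
    finally have "pairing (\<lambda>K e. c (K, e)) (\<lambda>K e. c (K, e)) = 0" by (simp only: pair)
    from pairing_definite[OF this] show "\<forall>\<alpha>\<in>D. c \<alpha> = 0" by (auto simp: D_def)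
  next
    fix \<mu> :: "(real^'d) set + (real^'d) set \<Rightarrow> real"
    assume *: "\<forall>\<alpha>\<in>D. (\<Sum>i\<in>I. \<mu> i * B i \<alpha>) = 0"
    have "\<mu> (Inl K) = (if e \<in> interior_faces \<Omega> \<T> then \<mu> (Inr e) else 0)" if "K \<in> \<T>" "e \<in> facets K" for K e
    proof -
      have "(K, e) \<in> D" using that by (simp add: D_def)
      then have "(\<Sum>i\<in>I. \<mu> i * B i (K, e)) = 0" using * by blast
      then show ?thesis using sumI[OF that(1), of \<mu> e] by simp
    qed
    note z = multipliers_zero[of "\<lambda>K. \<mu> (Inl K)" "\<lambda>e. \<mu> (Inr e)", OF this]
    show "\<forall>i\<in>I. \<mu> i = 0"
    proof
      fix i assume "i \<in> I"
      then show "\<mu> i = 0" unfolding I_def by (rule PlusE) (use z in auto)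
    qed
  qed
  then obtain c \<mu> where eq1: "\<And>\<beta>. \<beta> \<in> D \<Longrightarrow> (\<Sum>\<alpha>\<in>D. c \<alpha> * A \<alpha> \<beta>) + (\<Sum>i\<in>I. \<mu> i * B i \<beta>) = 0"
    and eq2: "\<And>i. i \<in> I \<Longrightarrow> (\<Sum>\<alpha>\<in>D. B i \<alpha> * c \<alpha>) = (case i of Inl K \<Rightarrow> F K | Inr e \<Rightarrow> 0)"
    by blast
  let ?c = "\<lambda>K e. c (K, e)"
  have "HL_system F ?c (\<lambda>K. \<mu> (Inl K)) (\<lambda>e. \<mu> (Inr e))"
    unfolding HL_system_def
  proof (intro conjI allI ballI)
    show "outflow ?c K = F K" if K: "K \<in> \<T>" for K
    proof -
      have "(\<Sum>\<alpha>\<in>D. B (Inl K) \<alpha> * c \<alpha>) = (\<Sum>J\<in>\<T>. if J = K then outflow ?c K else 0)"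
        unfolding sumD by (intro sum.cong refl) (auto simp: B_def outflow_def)
      then show ?thesis using eq2[of "Inl K"] K fin by (auto simp: I_def)
    qed
    show "balanced ?c"
      unfolding balanced_def
    proof
      fix f assume f: "f \<in> interior_faces \<Omega> \<T>"
      have "(\<Sum>\<alpha>\<in>D. B (Inr f) \<alpha> * c \<alpha>) = (\<Sum>J\<in>\<T>. \<Sum>e\<in>facets J. ?c J e * (if f = e then - 1 else 0))"
        unfolding sumD by (simp add: B_def mult.commute)
      also have "\<dots> = (\<Sum>e\<in>faces. flux ?c e * (if f = e then - 1 else 0))" by (rule sum_faces)
      also have "\<dots> = - flux ?c f"
        using interior_face_in_faces[OF f] finite_faces by (simp add: if_distrib[of "(*) _"] cong: if_cong)
      finally show "flux ?c f = 0" using eq2[of "Inr f"] f by (auto simp: I_def)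
    qed
    fix b
    have "0 = (\<Sum>\<beta>\<in>D. case_prod b \<beta> * ((\<Sum>\<alpha>\<in>D. c \<alpha> * A \<alpha> \<beta>) + (\<Sum>i\<in>I. \<mu> i * B i \<beta>)))"
      by (simp add: eq1)
    also have "\<dots> = pairing ?c b + (\<Sum>\<beta>\<in>D. case_prod b \<beta> * (\<Sum>i\<in>I. \<mu> i * B i \<beta>))"
      unfolding distrib_left sum.distrib pair by simp
    also have "(\<Sum>\<beta>\<in>D. case_prod b \<beta> * (\<Sum>i\<in>I. \<mu> i * B i \<beta>)) =
        (\<Sum>K\<in>\<T>. \<Sum>e\<in>facets K. b K e * (\<mu> (Inl K) - (if e \<in> interior_faces \<Omega> \<T> then \<mu> (Inr e) else 0)))"
      unfolding sumD[of "\<lambda>\<beta>. case_prod b \<beta> * _ \<beta>"] by (intro sum.cong refl) (simp add: sumI)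
    also have "\<dots> = (\<Sum>K\<in>\<T>. \<mu> (Inl K) * outflow b K) - (\<Sum>e\<in>interior_faces \<Omega> \<T>. \<mu> (Inr e) * flux b e)"
      unfolding right_diff_distrib sum_subtractf sum_interior_faces outflow_def
      by (simp add: sum_distrib_left mult.commute)
    finally show "pairing ?c b + (\<Sum>K\<in>\<T>. \<mu> (Inl K) * outflow b K) = (\<Sum>e\<in>interior_faces \<Omega> \<T>. \<mu> (Inr e) * flux b e)"
      by simp
  qed
  then show ?thesis by blast
qed

section \<open>From the variational problems to the linear systems\<close>

text \<open>Testing with the difference \<open>?d\<close> of the two coefficient families turns the
  equation into \<open>pairing ?d ?d = 0\<close>.\<close>

lemma flux_law_iff:
  assumes u: "represents \<psi> c u" and \<theta>: "\<theta> \<in> X1 \<Omega> \<T> \<eta>"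
  shows "(\<forall>\<xi>\<in>X1 \<Omega> \<T> \<eta>. l2_inner \<Omega> (\<lambda>x. k x *v \<theta> x) \<xi> + l2_inner \<Omega> u \<xi> = 0) \<longleftrightarrow> represents \<eta> c \<theta>"
proof
  assume eq: "\<forall>\<xi>\<in>X1 \<Omega> \<T> \<eta>. l2_inner \<Omega> (\<lambda>x. k x *v \<theta> x) \<xi> + l2_inner \<Omega> u \<xi> = 0"
  obtain a where a: "represents \<eta> a \<theta>" using \<theta> by (auto simp: multiscale_space_iff)
  let ?d = "\<lambda>K e. c K e - a K e"
  obtain \<xi> u' where \<xi>: "represents \<eta> ?d \<xi>" "represents \<psi> ?d u'" by (rule represents_exists)
  have "\<xi> \<in> X1 \<Omega> \<T> \<eta>" using \<xi>(1) by (auto simp: multiscale_space_iff)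
  with eq have "l2_inner \<Omega> (\<lambda>x. k x *v \<theta> x) \<xi> + l2_inner \<Omega> u \<xi> = 0" by (rule bspec)
  then have "- pairing ?d a + pairing ?d c = 0"
    unfolding l2_inner_k_represents[OF a \<xi>(1)] l2_inner_commute[of \<Omega> u]
      l2_inner_represents[OF \<xi>(1) u] .
  then have "pairing ?d ?d = 0" unfolding pairing_diff_right[of ?d c a] by linarith
  from pairing_definite[OF this] show "represents \<eta> c \<theta>"
    by (intro represents_cong[OF a]) simp
next
  assume r: "represents \<eta> c \<theta>"
  show "\<forall>\<xi>\<in>X1 \<Omega> \<T> \<eta>. l2_inner \<Omega> (\<lambda>x. k x *v \<theta> x) \<xi> + l2_inner \<Omega> u \<xi> = 0"
  proof
    fix \<xi> assume "\<xi> \<in> X1 \<Omega> \<T> \<eta>"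
    then obtain b where b: "represents \<eta> b \<xi>" by (auto simp: multiscale_space_iff)
    show "l2_inner \<Omega> (\<lambda>x. k x *v \<theta> x) \<xi> + l2_inner \<Omega> u \<xi> = 0"
      using l2_inner_k_represents[OF r b] l2_inner_represents[OF b u] by (simp add: l2_inner_commute[of \<Omega> u])
  qed
qed

text \<open>Common pattern of mass balance in both problems and of flux continuity in (HL).
  \<open>R Q q\<close> says that \<open>q\<close> has the coordinates \<open>Q\<close>; coordinate
  vectors as tests separate the equations.\<close>

lemma tested_equality_iff:
  fixes a F :: "'i \<Rightarrow> real"
  assumes fin: "finite S" and X: "\<And>q. q \<in> X \<longleftrightarrow> (\<exists>Q. R Q q)" and ex: "\<And>Q. \<exists>q. R Q q"
    and lhs: "\<And>Q q. R Q q \<Longrightarrow> l q = (\<Sum>i\<in>S. Q i * a i)"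
    and rhs: "\<And>Q q. R Q q \<Longrightarrow> r q = (\<Sum>i\<in>S. Q i * F i)"
  shows "(\<forall>q\<in>X. l q = r q) \<longleftrightarrow> (\<forall>i\<in>S. a i = F i)"
proof
  assume eq: "\<forall>q\<in>X. l q = r q"
  show "\<forall>i\<in>S. a i = F i"
  proof
    fix i assume i: "i \<in> S"
    let ?Q = "\<lambda>j. if j = i then 1 else 0 :: real"
    obtain q where q: "R ?Q q" using ex by blast
    then have "q \<in> X" using X by blast
    then have "(\<Sum>j\<in>S. ?Q j * a j) = (\<Sum>j\<in>S. ?Q j * F j)" using eq lhs[OF q] rhs[OF q] by simp
    moreover have "(\<Sum>j\<in>S. ?Q j * g j) = g i" for g :: "'i \<Rightarrow> real"
    proof -
      have "(\<Sum>j\<in>S. ?Q j * g j) = (\<Sum>j\<in>S. if j = i then g i else 0)" by (rule sum.cong) auto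
      then show ?thesis using i fin by simp
    qed
    ultimately show "a i = F i" by simp
  qed
next
  assume "\<forall>i\<in>S. a i = F i"
  then have "l q = r q" if "R Q q" for Q q
    unfolding lhs[OF that] rhs[OF that] by (intro sum.cong) auto
  then show "\<forall>q\<in>X. l q = r q" using X by blast
qed

lemma X2_iff: "u \<in> X2 \<Omega> \<T> \<psi> \<longleftrightarrow> (\<exists>c. represents \<psi> c u \<and> balanced c)"
  unfolding X2_def using Hdiv_iff_balanced by (auto simp: multiscale_space_iff)

context
  fixes f :: "real^'d \<Rightarrow> real"
  assumes f: "f \<in> L2 (lebesgue_on \<Omega>)"
begin

abbreviation load :: "(real^'d) set \<Rightarrow> real" where
  "load K \<equiv> LINT x|lebesgue_on K. f x"

text \<open>The equations are translated one by one: the flux law into common coefficients, the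
  second equation by balanced tests, mass conservation by cellwise constants.\<close>

lemma solves_L_iff:
  "solves_L \<Omega> \<T> k f \<eta> \<psi> \<theta> u p \<longleftrightarrow>
    (\<exists>c P. represents \<eta> c \<theta> \<and> represents \<psi> c u \<and> piecewise P p \<and> L_system load c P)"
proof -
  have momentum: "(\<forall>\<tau>\<in>X2 \<Omega> \<T> \<psi>. l2_inner \<Omega> \<theta> \<tau> + l2_inner \<Omega> p (weak_div \<Omega> \<tau>) = 0) \<longleftrightarrow>
      (\<forall>b. balanced b \<longrightarrow> pairing c b + (\<Sum>K\<in>\<T>. P K * outflow b K) = 0)" (is "?l = ?r")
    if \<theta>: "represents \<eta> c \<theta>" and p: "piecewise P p" for c P
  proof -
    have val: "l2_inner \<Omega> \<theta> \<tau> + l2_inner \<Omega> p (weak_div \<Omega> \<tau>) = pairing c b + (\<Sum>K\<in>\<T>. P K * outflow b K)"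
      if b: "represents \<psi> b \<tau>" "balanced b" for b \<tau>
      using l2_inner_represents[OF \<theta> b(1)] div_domain[OF p b(1) balanced_imp_Hdiv[OF b]] by simp
    show ?thesis
    proof
      assume l: ?l
      show ?r
      proof (intro allI impI)
        fix b assume b: "balanced b"
        obtain \<xi> \<tau> where \<tau>: "represents \<eta> b \<xi>" "represents \<psi> b \<tau>" by (rule represents_exists)
        then have "\<tau> \<in> X2 \<Omega> \<T> \<psi>" using b X2_iff by blast
        with l val[OF \<tau>(2) b] show "pairing c b + (\<Sum>K\<in>\<T>. P K * outflow b K) = 0" by simp
      qed
    next
      assume r: ?r
      show ?l
      proof
        fix \<tau> assume "\<tau> \<in> X2 \<Omega> \<T> \<psi>"
        then obtain b where b: "represents \<psi> b \<tau>" "balanced b" using X2_iff by blast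
        with r val[OF b] show "l2_inner \<Omega> \<theta> \<tau> + l2_inner \<Omega> p (weak_div \<Omega> \<tau>) = 0" by simp
      qed
    qed
  qed
  have mass: "(\<forall>q\<in>Qh \<Omega> \<T>. l2_inner \<Omega> (weak_div \<Omega> u) q = l2_inner \<Omega> f q) \<longleftrightarrow> (\<forall>K\<in>\<T>. outflow c K = load K)"
    if u: "represents \<psi> c u" "balanced c" for c
    by (rule tested_equality_iff[OF fin Qh_iff piecewise_exists])
      (simp_all add: l2_inner_commute[of \<Omega> "weak_div \<Omega> u"] div_domain[OF _ u(1) balanced_imp_Hdiv[OF u]]
        l2_inner_load[OF _ f])
  show ?thesis
  proof
    assume s: "solves_L \<Omega> \<T> k f \<eta> \<psi> \<theta> u p"
    then obtain c where c: "represents \<psi> c u" "balanced c" by (auto simp: solves_L_def X2_iff)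
    obtain P where P: "piecewise P p" using s by (auto simp: solves_L_def Qh_iff)
    have "\<theta> \<in> X1 \<Omega> \<T> \<eta>" "\<forall>\<xi>\<in>X1 \<Omega> \<T> \<eta>. l2_inner \<Omega> (\<lambda>x. k x *v \<theta> x) \<xi> + l2_inner \<Omega> u \<xi> = 0"
      using s unfolding solves_L_def by blast+
    then have \<theta>: "represents \<eta> c \<theta>" by (rule flux_law_iff[OF c(1), THEN iffD1])
    have "L_system load c P"
      using s momentum[OF \<theta> P] mass[OF c] c(2) by (simp add: solves_L_def L_system_def)
    with c \<theta> P show "\<exists>c P. represents \<eta> c \<theta> \<and> represents \<psi> c u \<and> piecewise P p \<and> L_system load c P" by blast
  next
    assume "\<exists>c P. represents \<eta> c \<theta> \<and> represents \<psi> c u \<and> piecewise P p \<and> L_system load c P"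
    then obtain c P where *: "represents \<eta> c \<theta>" "represents \<psi> c u" "piecewise P p" "L_system load c P" by blast
    have bal: "balanced c" using *(4) by (simp add: L_system_def)
    have \<theta>: "\<theta> \<in> X1 \<Omega> \<T> \<eta>" using *(1) by (auto simp: multiscale_space_iff)
    have "u \<in> X2 \<Omega> \<T> \<psi>" "p \<in> Qh \<Omega> \<T>" using * bal by (auto simp: X2_iff Qh_iff)
    with \<theta> show "solves_L \<Omega> \<T> k f \<eta> \<psi> \<theta> u p"
      using flux_law_iff[OF *(2) \<theta>] momentum[OF *(1,3)] mass[OF *(2) bal] *(1,4)
      by (simp add: solves_L_def L_system_def)
  qed
qed

lemma solves_HL_iff:
  "solves_HL \<Omega> \<T> k f \<eta> \<psi> \<theta> u p lam \<longleftrightarrow>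
    (\<exists>c P \<Lambda>. represents \<eta> c \<theta> \<and> represents \<psi> c u \<and> piecewise P p \<and> skeleton \<Lambda> lam \<and> HL_system load c P \<Lambda>)"
proof -
  have momentum: "(\<forall>\<tau>\<in>X2_broken \<Omega> \<T> \<psi>.
        l2_inner \<Omega> \<theta> \<tau> + (\<Sum>K\<in>\<T>. l2_inner K p (weak_div K \<tau>)) = Ch \<T> \<tau> lam) \<longleftrightarrow>
      (\<forall>b. pairing c b + (\<Sum>K\<in>\<T>. P K * outflow b K) = (\<Sum>e\<in>interior_faces \<Omega> \<T>. \<Lambda> e * flux b e))" (is "?l = ?r")
    if \<theta>: "represents \<eta> c \<theta>" and p: "piecewise P p" and \<Lambda>: "skeleton \<Lambda> lam" for c P \<Lambda>
  proof -
    have val: "l2_inner \<Omega> \<theta> \<tau> + (\<Sum>K\<in>\<T>. l2_inner K p (weak_div K \<tau>)) = pairing c b + (\<Sum>K\<in>\<T>. P K * outflow b K)"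
      "Ch \<T> \<tau> lam = (\<Sum>e\<in>interior_faces \<Omega> \<T>. \<Lambda> e * flux b e)"
      if b: "represents \<psi> b \<tau>" for b \<tau>
      using l2_inner_represents[OF \<theta> b] div_cell[OF p b] Ch_eq[OF b \<Lambda>] by simp_all
    show ?thesis
    proof
      assume l: ?l
      show ?r
      proof
        fix b
        obtain \<xi> \<tau> where \<tau>: "represents \<eta> b \<xi>" "represents \<psi> b \<tau>" by (rule represents_exists)
        then have "\<tau> \<in> X2_broken \<Omega> \<T> \<psi>" using multiscale_space_iff by blast
        with l val[OF \<tau>(2)]
        show "pairing c b + (\<Sum>K\<in>\<T>. P K * outflow b K) = (\<Sum>e\<in>interior_faces \<Omega> \<T>. \<Lambda> e * flux b e)" by simp
      qed
    next
      assume r: ?r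
      show ?l
      proof
        fix \<tau> assume "\<tau> \<in> X2_broken \<Omega> \<T> \<psi>"
        then obtain b where b: "represents \<psi> b \<tau>" using multiscale_space_iff by blast
        with r val[OF b] show "l2_inner \<Omega> \<theta> \<tau> + (\<Sum>K\<in>\<T>. l2_inner K p (weak_div K \<tau>)) = Ch \<T> \<tau> lam" by simp
      qed
    qed
  qed
  have mass: "(\<forall>q\<in>Qh \<Omega> \<T>. (\<Sum>K\<in>\<T>. l2_inner K (weak_div K u) q) = l2_inner \<Omega> f q) \<longleftrightarrow>
      (\<forall>K\<in>\<T>. outflow c K = load K)" if u: "represents \<psi> c u" for c
    by (rule tested_equality_iff[OF fin Qh_iff piecewise_exists])
      (simp_all add: l2_inner_commute[of _ "weak_div _ u"] div_cell[OF _ u] l2_inner_load[OF _ f])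
  have continuity: "(\<forall>\<pi>\<in>Pih \<Omega> \<T> \<psi>. Ch \<T> u \<pi> = 0) \<longleftrightarrow> balanced c" if u: "represents \<psi> c u" for c
    unfolding balanced_def
    by (rule tested_equality_iff[OF finite_interior_faces Pih_iff skeleton_exists])
      (simp_all add: Ch_eq[OF u])
  show ?thesis
  proof
    assume s: "solves_HL \<Omega> \<T> k f \<eta> \<psi> \<theta> u p lam"
    then obtain c where c: "represents \<psi> c u" by (auto simp: solves_HL_def multiscale_space_iff)
    obtain P where P: "piecewise P p" using s by (auto simp: solves_HL_def Qh_iff)
    obtain \<Lambda> where \<Lambda>: "skeleton \<Lambda> lam" using s by (auto simp: solves_HL_def Pih_iff)
    have "\<theta> \<in> X1 \<Omega> \<T> \<eta>" "\<forall>\<xi>\<in>X1 \<Omega> \<T> \<eta>. l2_inner \<Omega> (\<lambda>x. k x *v \<theta> x) \<xi> + l2_inner \<Omega> u \<xi> = 0"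
      using s unfolding solves_HL_def by blast+
    then have \<theta>: "represents \<eta> c \<theta>" by (rule flux_law_iff[OF c, THEN iffD1])
    have "HL_system load c P \<Lambda>"
      using s momentum[OF \<theta> P \<Lambda>] mass[OF c] continuity[OF c] by (simp add: solves_HL_def HL_system_def)
    with c \<theta> P \<Lambda> show "\<exists>c P \<Lambda>. represents \<eta> c \<theta> \<and> represents \<psi> c u \<and> piecewise P p \<and> skeleton \<Lambda> lam \<and>
        HL_system load c P \<Lambda>" by blast
  next
    assume "\<exists>c P \<Lambda>. represents \<eta> c \<theta> \<and> represents \<psi> c u \<and> piecewise P p \<and> skeleton \<Lambda> lam \<and>
        HL_system load c P \<Lambda>"
    then obtain c P \<Lambda> where *: "represents \<eta> c \<theta>" "represents \<psi> c u" "piecewise P p" "skeleton \<Lambda> lam"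
      "HL_system load c P \<Lambda>" by blast
    have \<theta>: "\<theta> \<in> X1 \<Omega> \<T> \<eta>" using *(1) by (auto simp: multiscale_space_iff)
    have "u \<in> X2_broken \<Omega> \<T> \<psi>" "p \<in> Qh \<Omega> \<T>" "lam \<in> Pih \<Omega> \<T> \<psi>"
      using * by (auto simp: multiscale_space_iff Qh_iff Pih_iff)
    with \<theta> show "solves_HL \<Omega> \<T> k f \<eta> \<psi> \<theta> u p lam"
      using flux_law_iff[OF *(2) \<theta>] momentum[OF *(1,3,4)] mass[OF *(2)] continuity[OF *(2)] *(1,5)
      by (simp add: solves_HL_def HL_system_def)
  qed
qed

lemma solves_HL_imp_solves_L:
  "solves_HL \<Omega> \<T> k f \<eta> \<psi> \<theta> u p lam \<Longrightarrow> solves_L \<Omega> \<T> k f \<eta> \<psi> \<theta> u p"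
  unfolding solves_L_iff solves_HL_iff using HL_system_imp_L_system by blast

lemma solves_L_unique:
  assumes "solves_L \<Omega> \<T> k f \<eta> \<psi> \<theta> u p" "solves_L \<Omega> \<T> k f \<eta> \<psi> \<theta>' u' p'"
  shows "AE x in lebesgue_on \<Omega>. \<theta> x = \<theta>' x \<and> u x = u' x \<and> p x = p' x"
proof -
  obtain c P where 1: "represents \<eta> c \<theta>" "represents \<psi> c u" "piecewise P p" "L_system load c P"
    using assms(1) unfolding solves_L_iff by blast
  obtain c' P' where 2: "represents \<eta> c' \<theta>'" "represents \<psi> c' u'" "piecewise P' p'" "L_system load c' P'"
    using assms(2) unfolding solves_L_iff by blast
  note eq = L_system_unique[OF 1(4) 2(4)]
  have "AE x in lebesgue_on \<Omega>. p x = p' x"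
    unfolding AE_domain_iff
  proof
    fix K assume K: "K \<in> \<T>"
    show "AE x in lebesgue_on K. p x = p' x"
      using piecewiseD(2)[OF 1(3) K] piecewiseD(2)[OF 2(3) K]
      by eventually_elim (simp add: eq(2)[OF K])
  qed
  moreover have "AE x in lebesgue_on \<Omega>. \<theta> x = \<theta>' x"
    by (rule represents_AE_eq[OF 1(1) 2(1)]) (rule eq(1))
  moreover have "AE x in lebesgue_on \<Omega>. u x = u' x"
    by (rule represents_AE_eq[OF 1(2) 2(2)]) (rule eq(1))
  ultimately show ?thesis by eventually_elim simp
qed

lemma solves_HL_exists: "\<exists>\<theta> u p lam. solves_HL \<Omega> \<T> k f \<eta> \<psi> \<theta> u p lam"
proof -
  obtain c P \<Lambda> where s: "HL_system load c P \<Lambda>" using HL_system_exists by blast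
  obtain \<theta> u where "represents \<eta> c \<theta>" "represents \<psi> c u" by (rule represents_exists)
  moreover obtain p where "piecewise P p" using piecewise_exists by blast
  moreover obtain lam where "skeleton \<Lambda> lam" using skeleton_exists by blast
  ultimately show ?thesis using s unfolding solves_HL_iff by blast
qed

lemma solves_HL_multiplier_unique:
  assumes "solves_HL \<Omega> \<T> k f \<eta> \<psi> \<theta> u p lam" "solves_HL \<Omega> \<T> k f \<eta> \<psi> \<theta>' u' p' lam'"
    and e: "e \<in> interior_faces \<Omega> \<T>"
  shows "AE y in face_measure e. lam y = lam' y"
proof -
  obtain c P \<Lambda> where 1: "skeleton \<Lambda> lam" "HL_system load c P \<Lambda>"
    using assms(1) unfolding solves_HL_iff by blast
  obtain c' P' \<Lambda>' where 2: "skeleton \<Lambda>' lam'" "HL_system load c' P' \<Lambda>'"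
    using assms(2) unfolding solves_HL_iff by blast
  have "AE y in face_measure e. lam y = \<Lambda> e" "AE y in face_measure e. lam' y = \<Lambda>' e"
    using 1(1) 2(1) e by (auto simp: skeleton_def)
  then show ?thesis
    by eventually_elim (simp add: HL_system_multiplier_unique[OF 1(2) 2(2) e])
qed

end

end

theorem theorem4p4:
  fixes \<Omega> :: "(real^'d) set"
    and \<T> :: "(real^'d) set set"
    and k :: "real^'d \<Rightarrow> real^'d^'d"
    and f :: "real^'d \<Rightarrow> real"
    and kmin kmax \<rho> :: real
    and basis \<eta> \<psi> :: "(real^'d) set \<Rightarrow> (real^'d) set \<Rightarrow> real^'d \<Rightarrow> real^'d"
    and \<phi> :: "(real^'d) set \<Rightarrow> (real^'d) set \<Rightarrow> real^'d \<Rightarrow> real"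
  assumes "CARD('d) = 2 \<or> CARD('d) = 3"
    and "bounded_lipschitz_domain \<Omega>"
    and "f \<in> L2 (lebesgue_on \<Omega>)"
    and "0 < kmin" and "kmin \<le> kmax"
    and "k \<in> borel_measurable (lebesgue_on \<Omega>)"
    and "\<And>x. x \<in> \<Omega> \<Longrightarrow> transpose (k x) = k x"
    and "\<And>x \<zeta>. x \<in> \<Omega> \<Longrightarrow>
           kmin * (norm \<zeta>)\<^sup>2 \<le> \<zeta> \<bullet> (k x *v \<zeta>) \<and> \<zeta> \<bullet> (k x *v \<zeta>) \<le> kmax * (norm \<zeta>)\<^sup>2"
    and "is_mesh \<Omega> \<T>"
    and "0 < \<rho>" and "quasi_uniform \<rho> \<T>"
    and "\<And>K e. K \<in> \<T> \<Longrightarrow> e \<in> facets K \<Longrightarrow> RT0_basis K e (basis K e)"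
    and "\<And>K e. K \<in> \<T> \<Longrightarrow> e \<in> facets K \<Longrightarrow>
           local_solution k K (basis K e) (\<eta> K e) (\<psi> K e) (\<phi> K e)"
  shows "(\<exists>\<theta> u p. solves_L \<Omega> \<T> k f \<eta> \<psi> \<theta> u p)
    \<and> (\<forall>\<theta> u p \<theta>' u' p'.
         solves_L \<Omega> \<T> k f \<eta> \<psi> \<theta> u p \<and> solves_L \<Omega> \<T> k f \<eta> \<psi> \<theta>' u' p' \<longrightarrow>
         (AE x in lebesgue_on \<Omega>. \<theta> x = \<theta>' x \<and> u x = u' x \<and> p x = p' x))
    \<and> (\<exists>\<theta> u p lam. solves_HL \<Omega> \<T> k f \<eta> \<psi> \<theta> u p lam)
    \<and> (\<forall>\<theta> u p lam \<theta>' u' p' lam'.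
         solves_HL \<Omega> \<T> k f \<eta> \<psi> \<theta> u p lam \<and> solves_HL \<Omega> \<T> k f \<eta> \<psi> \<theta>' u' p' lam' \<longrightarrow>
         (AE x in lebesgue_on \<Omega>. \<theta> x = \<theta>' x \<and> u x = u' x \<and> p x = p' x) \<and>
         (\<forall>e\<in>interior_faces \<Omega> \<T>. AE y in face_measure e. lam y = lam' y))
    \<and> (\<forall>\<theta> u p \<theta>' u' p' lam.
         solves_L \<Omega> \<T> k f \<eta> \<psi> \<theta> u p \<and> solves_HL \<Omega> \<T> k f \<eta> \<psi> \<theta>' u' p' lam \<longrightarrow>
         (AE x in lebesgue_on \<Omega>. \<theta>' x = \<theta> x \<and> u' x = u x \<and> p' x = p x))"
proof -
  interpret multiscale_mesh \<Omega> \<T> k kmin basis \<eta> \<psi> \<phi>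
    by unfold_locales (fact assms | use assms in blast)+
  note f = \<open>f \<in> L2 (lebesgue_on \<Omega>)\<close>
  show ?thesis
  proof (intro conjI allI impI)
    show "\<exists>\<theta> u p. solves_L \<Omega> \<T> k f \<eta> \<psi> \<theta> u p"
      using solves_HL_exists[OF f] solves_HL_imp_solves_L[OF f] by blast
    show "\<exists>\<theta> u p lam. solves_HL \<Omega> \<T> k f \<eta> \<psi> \<theta> u p lam"
      by (rule solves_HL_exists[OF f])
  next
    fix \<theta> u p \<theta>' u' p'
    assume "solves_L \<Omega> \<T> k f \<eta> \<psi> \<theta> u p \<and> solves_L \<Omega> \<T> k f \<eta> \<psi> \<theta>' u' p'"
    then show "AE x in lebesgue_on \<Omega>. \<theta> x = \<theta>' x \<and> u x = u' x \<and> p x = p' x"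
      using solves_L_unique[OF f] by blast
  next
    fix \<theta> u p lam \<theta>' u' p' lam'
    assume "solves_HL \<Omega> \<T> k f \<eta> \<psi> \<theta> u p lam \<and> solves_HL \<Omega> \<T> k f \<eta> \<psi> \<theta>' u' p' lam'"
    then have s: "solves_HL \<Omega> \<T> k f \<eta> \<psi> \<theta> u p lam" "solves_HL \<Omega> \<T> k f \<eta> \<psi> \<theta>' u' p' lam'"
      by simp_all
    show "AE x in lebesgue_on \<Omega>. \<theta> x = \<theta>' x \<and> u x = u' x \<and> p x = p' x"
      by (rule solves_L_unique[OF f solves_HL_imp_solves_L[OF f s(1)] solves_HL_imp_solves_L[OF f s(2)]])
    show "\<forall>e\<in>interior_faces \<Omega> \<T>. AE y in face_measure e. lam y = lam' y"
      by (rule ballI, rule solves_HL_multiplier_unique[OF f s])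
  next
    fix \<theta> u p \<theta>' u' p' lam
    assume "solves_L \<Omega> \<T> k f \<eta> \<psi> \<theta> u p \<and> solves_HL \<Omega> \<T> k f \<eta> \<psi> \<theta>' u' p' lam"
    then show "AE x in lebesgue_on \<Omega>. \<theta>' x = \<theta> x \<and> u' x = u x \<and> p' x = p x"
      using solves_L_unique[OF f] solves_HL_imp_solves_L[OF f] by blast
  qed
qed

end
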